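(* Let $1\le p\le\infty$. Then $\mathcal K_p^{dual}=\mathcal{QN}_p$ and $\mathcal{QN}_p^{dual}=\mathcal K_p$, in both cases with equality of the ideal norms. That is, for all Banach spaces $E,F$ and every bounded linear operator $T\colon E\to F$: (i) $T\in\mathcal{QN}_p(E;F)$ if and only if $T'\in\mathcal K_p(F';E')$, and then $\nu_p^Q(T)=\kappa_p(T')$; (ii) $T\in\mathcal K_p(E;F)$ if and only if $T'\in\mathcal{QN}_p(F';E')$, and then $\kappa_p(T)=\nu_p^Q(T')$.
   Context: For a Banach space $E$ and $1\le p<\infty$, $\ell_p(E)$ is the space of sequences $(x_n)_n$ in $E$ with $\|(x_n)_n\|_p=(\sum_n\|x_n\|^p)^{1/p}<\infty$; for $p=\infty$ it is replaced by $c_0(E)$ with the supremum norm. With $\frac1p+\frac1{p'}=1$, for $(x_n)_n\in\ell_p(E)$ put $p\text{-}\mathrm{co}\{x_n\}=\{\sum_{n=1}^\infty\alpha_nx_n:(\alpha_n)_n\in B_{\ell_{p'}}\}$, where $\ell_{p'}$ is replaced by $c_0$ if $p=1$. A bounded operator $T\colon E\to F$ is $p$-compact, $T\in\mathcal K_p(E;F)$, if $T(B_E)\subset p\text{-}\mathrm{co}\{x_n\}$ for some $(x_n)_n\in\ell_p(F)$, and $\kappa_p(T)=\inf\{\|(x_n)_n\|_p: T(B_E)\subset p\text{-}\mathrm{co}\{x_n\}\}$. $T$ is quasi $p$-nuclear, $T\in\mathcal{QN}_p(E;F)$, if there is $(x_n')_n\in\ell_p(E')$ with $\|Tx\|\le(\sum_n|x_n'(x)|^p)^{1/p}$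 for all $x\in E$ (supremum in place of the $\ell_p$-sum if $p=\infty$), and $\nu_p^Q(T)=\inf\|(x_n')_n\|_p$ over all such sequences. For a Banach operator ideal $\mathcal A$, the dual ideal is $\mathcal A^{dual}(E;F)=\{T: T'\in\mathcal A(F';E')\}$ with norm $\|T\|_{\mathcal A^{dual}}=\|T'\|_{\mathcal A}$, where $T'$ is the adjoint of $T$. *)

theory Defs
  imports "HOL-Analysis.Analysis"
begin

text \<open>
  The scalar field is a type \<open>'k\<close> of sort \<open>{real_normed_field, euclidean_space}\<close>, which
  up to isometric isomorphism means the real or the complex numbers.  A Banach space over \<open>'k\<close> is a type of class \<open>banach\<close> (which
  carries the norm and the underlying real structure) with a compatible scalar multiplication.
\<close>

locale banach_over = vector_space scale
  for scale :: "'k::{real_normed_field,euclidean_space} \<Rightarrow> 'a::banach \<Rightarrow> 'a" +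
  assumes norm_scale: "norm (scale c x) = norm c * norm x"
    and scale_of_real: "scale (of_real r) x = r *\<^sub>R x"

lemma banach_over_scaleR: "banach_over ((*\<^sub>R) :: real \<Rightarrow> 'a::banach \<Rightarrow> 'a)"
  by unfold_locales (auto simp: algebra_simps)

lemma banach_over_complex: "banach_over ((*) :: complex \<Rightarrow> complex \<Rightarrow> complex)"
  by unfold_locales (auto simp: algebra_simps norm_mult scaleR_conv_of_real)

text \<open>
  The type \<open>'a \<Rightarrow>\<^sub>L 'k\<close> consists of the bounded real-linear maps, so that the dual space is the
  closed subspace of its \<open>'k\<close>-linear elements.  For this reason the notions below refer to spaces
  given by a scalar multiplication on the ambient type and a carrier set \<open>V\<close> (\<open>UNIV\<close> for the
  original spaces).
\<close>

definition dual_space ::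
  "('k \<Rightarrow> 'a \<Rightarrow> 'a) \<Rightarrow> ('a::real_normed_vector \<Rightarrow>\<^sub>L 'k::real_normed_field) set"
  where "dual_space s = {f :: 'a \<Rightarrow>\<^sub>L 'k. \<forall>c x. f (s c x) = c * f x}"

definition dual_scale ::
  "'k \<Rightarrow> ('a::real_normed_vector \<Rightarrow>\<^sub>L 'k::real_normed_field) \<Rightarrow> ('a \<Rightarrow>\<^sub>L 'k)"
  where "dual_scale c f = blinfun_mult_right c o\<^sub>L f"

lemma dual_scale_apply [simp]: "dual_scale c f x = c * f x"
  by (simp add: dual_scale_def)

definition adjoint_op ::
  "('a::real_normed_vector \<Rightarrow>\<^sub>L 'b::real_normed_vector) \<Rightarrow> ('b \<Rightarrow>\<^sub>L 'k::real_normed_field) \<Rightarrow> ('a \<Rightarrow>\<^sub>L 'k)"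
  where "adjoint_op T f = f o\<^sub>L T"

definition bounded_operators ::
  "('k \<Rightarrow> 'a \<Rightarrow> 'a) \<Rightarrow> 'a set \<Rightarrow> ('k \<Rightarrow> 'b \<Rightarrow> 'b) \<Rightarrow> 'b set
    \<Rightarrow> ('a::real_normed_vector \<Rightarrow> 'b::real_normed_vector) set"
  where "bounded_operators s V t W =
    {T. (\<forall>x\<in>V. T x \<in> W) \<and>
        (\<forall>x\<in>V. \<forall>y\<in>V. T (x + y) = T x + T y) \<and>
        (\<forall>c. \<forall>x\<in>V. T (s c x) = t c (T x)) \<and>
        (\<exists>C. \<forall>x\<in>V. norm (T x) \<le> C * norm x)}"

definition op_norm ::
  "'a::real_normed_vector set \<Rightarrow> ('a \<Rightarrow> 'b::real_normed_vector) \<Rightarrow> real"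
  where "op_norm V T = (SUP x\<in>{x\<in>V. norm x \<le> 1}. norm (T x))"

text \<open>
  Bounded functionals on a carrier \<open>V\<close> are functions \<open>'a \<Rightarrow> 'k\<close> considered on \<open>V\<close> only.
  For \<open>V = UNIV\<close> this agrees with \<^const>\<open>dual_space\<close>, including the norm.
\<close>

abbreviation functionals ::
  "('k \<Rightarrow> 'a \<Rightarrow> 'a) \<Rightarrow> 'a set \<Rightarrow> ('a::real_normed_vector \<Rightarrow> 'k::real_normed_field) set"
  where "functionals s V \<equiv> bounded_operators s V (*) UNIV"

lemma functionals_UNIV:
  assumes "banach_over s"
  shows "functionals s UNIV = blinfun_apply ` dual_space s"
proof (intro equalityI subsetI)
  fix T assume T: "T \<in> functionals s UNIV"
  then obtain C where C: "\<And>x. norm (T x) \<le> C * norm x"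
    by (auto simp: bounded_operators_def)
  have "T (r *\<^sub>R x) = r *\<^sub>R T x" for r x
    using T banach_over.scale_of_real[OF assms, of r x]
    by (auto simp: bounded_operators_def scaleR_conv_of_real) metis
  then have "bounded_linear T"
    using T C by (intro bounded_linear_intro[where K = C])
      (auto simp: bounded_operators_def mult.commute)
  then have "T = blinfun_apply (Blinfun T)"
    by (simp add: bounded_linear_Blinfun_apply)
  moreover from this have "Blinfun T \<in> dual_space s"
    using T by (auto simp: dual_space_def bounded_operators_def)
  ultimately show "T \<in> blinfun_apply ` dual_space s" by blast
next
  fix T :: "'b \<Rightarrow> 'a" assume "T \<in> blinfun_apply ` dual_space s"
  then show "T \<in> functionals s UNIV"
    by (auto simp: bounded_operators_def dual_space_def blinfun.add_right
        intro!: exI[where x = "norm _"] norm_blinfun)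
qed

lemma op_norm_UNIV: "op_norm UNIV (blinfun_apply f) = norm f"
proof -
  have le: "norm (f x) \<le> norm f" if "norm x \<le> 1" for x
    using norm_blinfun[of f x] mult_left_mono[OF that, of "norm f"] by simp
  then have bdd: "bdd_above ((\<lambda>x. norm (f x)) ` {x\<in>UNIV. norm x \<le> 1})"
    by (auto intro!: bdd_aboveI)
  have up: "norm (f x) \<le> op_norm UNIV (blinfun_apply f)" if "norm x \<le> 1" for x
    unfolding op_norm_def by (rule cSUP_upper[OF _ bdd]) (use that in auto)
  have "norm (f x) \<le> op_norm UNIV (blinfun_apply f) * norm x" for x
  proof (cases "x = 0")
    case False
    then show ?thesis
      using up[of "inverse (norm x) *\<^sub>R x"] by (simp add: blinfun.scaleR_right field_simps)
  qed simp
  moreover have "0 \<le> op_norm UNIV (blinfun_apply f)"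
    using up[of 0] by simp
  ultimately have "norm f \<le> op_norm UNIV (blinfun_apply f)"
    by (intro norm_blinfun_bound)
  moreover have "op_norm UNIV (blinfun_apply f) \<le> norm f"
    unfolding op_norm_def by (rule cSUP_least) (auto intro: le exI[where x = 0])
  ultimately show ?thesis by simp
qed

text \<open>
  The sequence spaces are expressed by the sequence of norms: \<open>x\<close> is in \<open>\<ell>\<^sub>p(V)\<close> if all terms are
  in \<open>V\<close> and \<open>\<lambda>n. \<parallel>x n\<parallel>\<close> is in \<open>ell p\<close>.  For \<open>p = \<infinity>\<close> this is \<open>c\<^sub>0\<close>.
\<close>

definition ell :: "ennreal \<Rightarrow> (nat \<Rightarrow> real) set"
  where "ell p = (if p = \<infinity> then {a. a \<longlonglongrightarrow> 0}
                  else {a. summable (\<lambda>n. \<bar>a n\<bar> powr enn2real p)})"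

definition ell_norm :: "ennreal \<Rightarrow> (nat \<Rightarrow> real) \<Rightarrow> real"
  where "ell_norm p a = (if p = \<infinity> then (SUP n. \<bar>a n\<bar>)
                         else (\<Sum>n. \<bar>a n\<bar> powr enn2real p) powr (1 / enn2real p))"

definition conj_exponent :: "ennreal \<Rightarrow> ennreal"
  where "conj_exponent p = inverse (1 - inverse p)"

lemma conj_exponent:
  assumes "1 \<le> p"
  shows "inverse p + inverse (conj_exponent p) = 1"
proof (cases p)
  case (real r)
  with assms have r: "1 \<le> r"
    by simp
  then have p: "inverse p = ennreal (inverse r)" "inverse r \<le> 1"
    using real by (auto simp: inverse_ennreal field_simps)
  then have q: "1 - inverse p = ennreal (1 - inverse r)"
    using r by (simp add: ennreal_minus flip: ennreal_1)
  show ?thesis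
  proof (cases "r = 1")
    case True
    with p show ?thesis by (simp add: conj_exponent_def)
  next
    case False
    with r have "0 < 1 - inverse r"
      by (simp add: field_simps)
    with r p q show ?thesis
      by (simp add: conj_exponent_def inverse_ennreal flip: ennreal_plus)
  qed
qed (simp add: conj_exponent_def)

definition p_co ::
  "ennreal \<Rightarrow> ('k::real_normed_field \<Rightarrow> 'a \<Rightarrow> 'a) \<Rightarrow> (nat \<Rightarrow> 'a::real_normed_vector) \<Rightarrow> 'a set"
  where "p_co p s x =
    {y. \<exists>\<alpha>. (\<lambda>n. norm (\<alpha> n)) \<in> ell (conj_exponent p) \<and>
            ell_norm (conj_exponent p) (\<lambda>n. norm (\<alpha> n)) \<le> 1 \<and>
            (\<lambda>n. s (\<alpha> n) (x n)) sums y}"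

definition compact_witnesses ::
  "ennreal \<Rightarrow> 'a set \<Rightarrow> ('k::real_normed_field \<Rightarrow> 'b \<Rightarrow> 'b) \<Rightarrow> 'b set
    \<Rightarrow> ('a::real_normed_vector \<Rightarrow> 'b::real_normed_vector) \<Rightarrow> (nat \<Rightarrow> 'b) set"
  where "compact_witnesses p V t W T =
    {x. (\<forall>n. x n \<in> W) \<and> (\<lambda>n. norm (x n)) \<in> ell p \<and> T ` {v\<in>V. norm v \<le> 1} \<subseteq> p_co p t x}"

definition p_compact ::
  "ennreal \<Rightarrow> ('k::real_normed_field \<Rightarrow> 'a \<Rightarrow> 'a) \<Rightarrow> 'a set \<Rightarrow> ('k \<Rightarrow> 'b \<Rightarrow> 'b) \<Rightarrow> 'b set
    \<Rightarrow> ('a::real_normed_vector \<Rightarrow> 'b::real_normed_vector) set"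
  where "p_compact p s V t W =
    {T \<in> bounded_operators s V t W. compact_witnesses p V t W T \<noteq> {}}"

definition kappa ::
  "ennreal \<Rightarrow> 'a set \<Rightarrow> ('k::real_normed_field \<Rightarrow> 'b \<Rightarrow> 'b) \<Rightarrow> 'b set
    \<Rightarrow> ('a::real_normed_vector \<Rightarrow> 'b::real_normed_vector) \<Rightarrow> real"
  where "kappa p V t W T = (INF x\<in>compact_witnesses p V t W T. ell_norm p (\<lambda>n. norm (x n)))"

definition nuclear_witnesses ::
  "ennreal \<Rightarrow> ('k::real_normed_field \<Rightarrow> 'a \<Rightarrow> 'a) \<Rightarrow> 'a set
    \<Rightarrow> ('a::real_normed_vector \<Rightarrow> 'b::real_normed_vector) \<Rightarrow> (nat \<Rightarrow> 'a \<Rightarrow> 'k) set"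
  where "nuclear_witnesses p s V T =
    {\<phi>. (\<forall>n. \<phi> n \<in> functionals s V) \<and> (\<lambda>n. op_norm V (\<phi> n)) \<in> ell p \<and>
        (\<forall>v\<in>V. norm (T v) \<le> ell_norm p (\<lambda>n. norm (\<phi> n v)))}"

definition quasi_p_nuclear ::
  "ennreal \<Rightarrow> ('k::real_normed_field \<Rightarrow> 'a \<Rightarrow> 'a) \<Rightarrow> 'a set \<Rightarrow> ('k \<Rightarrow> 'b \<Rightarrow> 'b) \<Rightarrow> 'b set
    \<Rightarrow> ('a::real_normed_vector \<Rightarrow> 'b::real_normed_vector) set"
  where "quasi_p_nuclear p s V t W =
    {T \<in> bounded_operators s V t W. nuclear_witnesses p s V T \<noteq> {}}"

definition nuQ ::
  "ennreal \<Rightarrow> ('k::real_normed_field \<Rightarrow> 'a \<Rightarrow> 'a) \<Rightarrow> 'a set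
    \<Rightarrow> ('a::real_normed_vector \<Rightarrow> 'b::real_normed_vector) \<Rightarrow> real"
  where "nuQ p s V T = (INF \<phi>\<in>nuclear_witnesses p s V T. ell_norm p (\<lambda>n. op_norm V (\<phi> n)))"

end

(*
If |g v| <= ||(phi_n v)_n||_p for functionals g and phi_n, the Hahn-Banach theorem gives coefficients
in the unit ball of l_p' (of l_oo for p = 1) with g = sum alpha_n phi_n. Applied to g = f o T this
turns quasi p-nuclear estimates for T into p-compactness of T'; the converse implications, from
p-compactness to quasi p-nuclear estimates, follow from the Hoelder inequality.

If T' is quasi p-nuclear, the same argument only places the image of the unit ball in the p-convex
hull of a sequence in the bidual of F. To descend to F one approximates: by a finite net and a finite
form of local reflexivity, a hull in the bidual is contained in the sum of a hull in F, at almost no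
cost in the norm, and a hull in the bidual of arbitrarily small norm. Iterating, and combining the
hulls in F with geometric weights, proves the claim.
*)

theory Submission
  imports Defs "HOL-Library.Function_Algebras"
begin

section \<open>Sublinear functionals and the Hahn-Banach theorem\<close>

text \<open>Between the two ideals everything is done with hulls whose coefficients lie in
  \<open>dual_ball p\<close>, because that is where Hahn-Banach puts them. Returning to
  \<open>p_co\<close> matters for p = 1 only, where bounded coefficients must become null ones; it
  costs an arbitrarily small amount, absorbed by the infimum in \<open>kappa\<close>. For p = top it
  is the null sequences that make tails small in norm, so that dominated functionals are given by
  series for every p alike. The obstacle in (ii) is that local reflexivity treats finitely many
  elements, and with an error, whereas a hull is infinite and must be covered exactly. Hence the
  finite net, a single sequence in F that serves all its points and is bounded term by term by (1 +
  \<eta>) times the bidual norms (which controls the norm whatever p is), and a remainder that is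
  again a bidual hull, so that the step can be repeated. The norm is preserved up to \<epsilon>
  because the main hull gets the weight 1 - \<theta>, while the later ones, with norms of order
  4^-k, share \<theta> in portions 2^-k. Real and complex scalars are treated together by means of
  the real functional c \<mapsto> c \<bullet> 1.\<close>

definition sublinear :: "('v::real_vector \<Rightarrow> real) \<Rightarrow> bool"
  where "sublinear q \<longleftrightarrow> (\<forall>x y. q (x + y) \<le> q x + q y) \<and> (\<forall>r x. 0 < r \<longrightarrow> q (r *\<^sub>R x) = r * q x)"

lemma sublinear_add: "sublinear q \<Longrightarrow> q (x + y) \<le> q x + q y"
  and sublinear_scaleR: "sublinear q \<Longrightarrow> 0 < r \<Longrightarrow> q (r *\<^sub>R x) = r * q x"
  by (auto simp: sublinear_def)

lemma sublinear_0: "sublinear q \<Longrightarrow> q 0 = 0"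
  using sublinear_scaleR[of q 2 0] by simp

text \<open>
  Convex cones in \<open>V \<times> \<real>\<close>, given as relations, that lie above some sublinear functional. In this
  form infimal convolutions and functionals prescribed on a subspace need no separate treatment.
\<close>

definition bounding_cone :: "('v::real_vector \<Rightarrow> real \<Rightarrow> bool) \<Rightarrow> bool"
  where "bounding_cone S \<longleftrightarrow>
    (\<forall>x y s t. S x s \<longrightarrow> S y t \<longrightarrow> S (x + y) (s + t)) \<and>
    (\<forall>x s r. S x s \<longrightarrow> 0 < r \<longrightarrow> S (r *\<^sub>R x) (r * s)) \<and>
    (\<forall>t. S 0 t \<longrightarrow> 0 \<le> t) \<and> (\<forall>x. \<exists>t. S x t)"

lemma bounding_coneI:
  assumes "\<And>x y s t. S x s \<Longrightarrow> S y t \<Longrightarrow> S (x + y) (s + t)"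
    and "\<And>x s r. S x s \<Longrightarrow> 0 < r \<Longrightarrow> S (r *\<^sub>R x) (r * s)"
    and "\<And>t. S 0 t \<Longrightarrow> 0 \<le> t" and "\<And>x. \<exists>t. S x t"
  shows "bounding_cone S"
  using assms by (auto simp: bounding_cone_def)

text \<open>A point of the cone over \<open>- x\<close> bounds the fibre over \<open>x\<close> from
  below, since the two add up to a point over 0. So the infimum is a genuine one.\<close>

lemma bounding_cone_Inf:
  assumes S: "bounding_cone S"
  defines "q \<equiv> \<lambda>x. Inf {t. S x t}"
  shows "sublinear q" and "S x t \<Longrightarrow> q x \<le> t"
proof -
  have add: "S (x + y) (s + t)" if "S x s" "S y t" for x y s t
    using S that by (auto simp: bounding_cone_def)
  have scale: "S (r *\<^sub>R x) (r * s)" if "S x s" "0 < r" for x s r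
    using S that by (auto simp: bounding_cone_def)
  have nonneg: "0 \<le> t" if "S 0 t" for t
    using S that by (auto simp: bounding_cone_def)
  have ne: "{t. S x t} \<noteq> {}" for x
    using S by (auto simp: bounding_cone_def)
  have bdd: "bdd_below {t. S x t}" for x
  proof -
    obtain t0 where t0: "S (- x) t0" using ne[of "- x"] by auto
    have "- t0 \<le> t" if "S x t" for t
      using nonneg[of "t + t0"] add[OF that t0] by simp
    then show ?thesis by (intro bdd_belowI[of _ "- t0"]) auto
  qed
  have le: "q x \<le> t" if "S x t" for x t
    unfolding q_def by (rule cInf_lower) (use that bdd in auto)
  then show "S x t \<Longrightarrow> q x \<le> t" .
  have greatest: "c \<le> q x" if "\<And>t. S x t \<Longrightarrow> c \<le> t" for c x
    unfolding q_def by (rule cInf_greatest) (use that ne in auto)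
  have "q (x + y) \<le> q x + q y" for x y
  proof -
    have "q (x + y) - q y \<le> s" if s: "S x s" for s
    proof -
      have "q (x + y) - s \<le> q y"
        by (rule greatest) (use le[OF add[OF s]] in force)
      then show ?thesis by simp
    qed
    then have "q (x + y) - q y \<le> q x" by (rule greatest)
    then show ?thesis by simp
  qed
  moreover have sc: "q (r *\<^sub>R x) \<le> r * q x" if r: "0 < r" for r x
  proof -
    have "q (r *\<^sub>R x) / r \<le> q x"
      by (rule greatest) (use le[OF scale] r in \<open>force simp: field_simps\<close>)
    then show ?thesis using r by (simp add: field_simps)
  qed
  moreover have "r * q x \<le> q (r *\<^sub>R x)" if r: "0 < r" for r x
    using sc[of "inverse r" "r *\<^sub>R x"] r by (simp add: field_simps)
  ultimately show "sublinear q" by (auto simp: sublinear_def intro: antisym)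
qed

text \<open>
  A minimal sublinear functional \<open>p\<close> equals \<open>\<lambda>x. INF t\<in>{0..}. p (x + t y) - t p y\<close> for every \<open>y\<close>,
  whence \<open>p (- y) \<le> - p y\<close>.
\<close>

lemma linear_minorant_of_sublinear:
  fixes q :: "'v::real_vector \<Rightarrow> real"
  assumes q: "sublinear q"
  shows "\<exists>f. linear f \<and> (\<forall>x. f x \<le> q x)"
proof -
  let ?A = "{p. sublinear p \<and> (\<forall>x. p x \<le> q x)}"
  \<comment> \<open>The order is reversed, so that the maximal element supplied by Zorn's lemma is a
    minimal functional.\<close>
  let ?P = "\<lambda>p p' :: 'v \<Rightarrow> real. \<forall>x. p' x \<le> p x"
  have po: "partial_order_on ?A (relation_of ?P ?A)"
    by (auto simp: partial_order_on_def preorder_on_def refl_on_def trans_def antisym_def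
        relation_of_def fun_eq_iff intro: order_trans antisym)
  have "\<exists>u\<in>?A. \<forall>a\<in>C. ?P a u" if C: "C \<in> Chains (relation_of ?P ?A)" for C
  proof (cases "C = {}")
    case True
    then show ?thesis using q by auto
  next
    case False
    have CA: "C \<subseteq> ?A" using C by (auto simp: Chains_def relation_of_def)
    then have Csub: "sublinear a" if "a \<in> C" for a using that by auto
    have chain: "?P a b \<or> ?P b a" if "a \<in> C" "b \<in> C" for a b
      using C that by (auto simp: Chains_def relation_of_def)
    \<comment> \<open>A chain is bounded by its pointwise infimum. The union of the cones above the
      members is a bounding cone, because two members always have a common lower one in the
      chain.\<close>
    let ?S = "\<lambda>x t. \<exists>a\<in>C. a x \<le> t"
    have S: "bounding_cone ?S"
    proof (rule bounding_coneI)
      fix x y s t assume "?S x s" "?S y t"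
      then obtain a b where ab: "a \<in> C" "b \<in> C" "a x \<le> s" "b y \<le> t" by auto
      then obtain c where c: "c \<in> C" "\<And>z. c z \<le> a z" "\<And>z. c z \<le> b z"
        using chain[of a b] by (metis order_refl)
      then have "c (x + y) \<le> s + t"
        using sublinear_add[OF Csub[OF c(1)], of x y] ab c(2)[of x] c(3)[of y] by linarith
      then show "?S (x + y) (s + t)" using c by auto
    next
      fix x s and r :: real assume "?S x s" "0 < r"
      then obtain a where a: "a \<in> C" "a x \<le> s" by (elim bexE)
      then have "a (r *\<^sub>R x) \<le> r * s"
        using \<open>0 < r\<close> sublinear_scaleR[OF Csub[OF a(1)]] by simp
      then show "?S (r *\<^sub>R x) (r * s)" using a(1) by blast
    next
      fix t assume "?S 0 t"
      then obtain a where a: "a \<in> C" "a 0 \<le> t" by (elim bexE)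
      then show "0 \<le> t" using sublinear_0[OF Csub[OF a(1)]] by simp
    qed (use False in auto)
    let ?u = "\<lambda>x. Inf {t. ?S x t}"
    have le: "?u x \<le> a x" if "a \<in> C" for a x
      by (rule bounding_cone_Inf(2)[OF S]) (use that in auto)
    moreover have "?u x \<le> q x" for x
    proof -
      obtain a where a: "a \<in> C" using False by auto
      moreover from this have "a x \<le> q x" using CA by auto
      ultimately show ?thesis using le[of a x] by linarith
    qed
    ultimately show ?thesis using bounding_cone_Inf(1)[OF S] by auto
  qed
  from predicate_Zorn[OF po this] obtain p where pA: "p \<in> ?A"
    and p_min: "\<forall>p'\<in>?A. ?P p p' \<longrightarrow> p' = p" by blast
  then have p: "sublinear p" "\<And>x. p x \<le> q x" by auto
  have minimal: "p' = p" if "sublinear p'" "\<And>x. p' x \<le> p x" for p'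
  proof -
    have "p' \<in> ?A" using that p(2) by (blast intro: order_trans)
    then show ?thesis using that(2) p_min by blast
  qed
  have neg: "p (- y) = - p y" for y
  proof -
    let ?S = "\<lambda>x u. \<exists>t\<ge>0. p (x + t *\<^sub>R y) - t * p y \<le> u"
    have S: "bounding_cone ?S"
    proof (rule bounding_coneI)
      fix x x' s s' assume "?S x s" "?S x' s'"
      then obtain t t' where t: "t \<ge> 0" "p (x + t *\<^sub>R y) - t * p y \<le> s"
        "t' \<ge> 0" "p (x' + t' *\<^sub>R y) - t' * p y \<le> s'" by auto
      have "p (x + x' + (t + t') *\<^sub>R y) - (t + t') * p y \<le> s + s'"
        using sublinear_add[OF p(1), of "x + t *\<^sub>R y" "x' + t' *\<^sub>R y"] t
        by (simp add: algebra_simps)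
      then show "?S (x + x') (s + s')" using t by (intro exI[of _ "t + t'"]) auto
    next
      fix x s and r :: real assume "?S x s" and r: "0 < r"
      then obtain t where t: "t \<ge> 0" "p (x + t *\<^sub>R y) - t * p y \<le> s" by auto
      have "p (r *\<^sub>R x + (r * t) *\<^sub>R y) - (r * t) * p y = r * (p (x + t *\<^sub>R y) - t * p y)"
        using sublinear_scaleR[OF p(1) r, of "x + t *\<^sub>R y"] by (simp add: algebra_simps)
      also have "\<dots> \<le> r * s" using t r by simp
      finally show "?S (r *\<^sub>R x) (r * s)" using t r by (intro exI[of _ "r * t"]) auto
    next
      fix u assume "?S 0 u"
      then obtain t where t: "t \<ge> 0" "p (t *\<^sub>R y) - t * p y \<le> u" by auto
      then show "0 \<le> u"
        using sublinear_scaleR[OF p(1), of t y] sublinear_0[OF p(1)] by (cases "t = 0") auto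
    next
      show "\<exists>t. ?S x t" for x by (intro exI[of _ "p x"] exI[of _ 0]) simp
    qed
    have "(\<lambda>x. Inf {u. ?S x u}) = p"
    proof (rule minimal[OF bounding_cone_Inf(1)[OF S]])
      show "Inf {u. ?S x u} \<le> p x" for x
        by (rule bounding_cone_Inf(2)[OF S], rule exI[of _ 0]) simp
    qed
    from fun_cong[OF this, of "- y"] have "p (- y) = Inf {u. ?S (- y) u}" by (rule sym)
    also have "\<dots> \<le> - p y"
      by (rule bounding_cone_Inf(2)[OF S], rule exI[of _ 1]) (simp add: sublinear_0[OF p(1)])
    finally have "p (- y) \<le> - p y" .
    moreover have "- p y \<le> p (- y)"
      using sublinear_add[OF p(1), of y "- y"] sublinear_0[OF p(1)] by simp
    ultimately show ?thesis by simp
  qed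
  have "p (x + y) = p x + p y" for x y
    using sublinear_add[OF p(1), of x y] sublinear_add[OF p(1), of "- x" "- y"]
      neg[of x] neg[of y] neg[of "x + y"] by (simp add: algebra_simps)
  moreover have "p (r *\<^sub>R x) = r * p x" for r x
    using sublinear_scaleR[OF p(1), of r x] sublinear_scaleR[OF p(1), of "- r" x]
      neg[of "r *\<^sub>R x"] sublinear_0[OF p(1)] by (cases r "0::real" rule: linorder_cases) auto
  ultimately have "linear p" by (auto intro: linearI)
  with p show ?thesis by blast
qed

lemma linear_minorant_of_cone:
  fixes S :: "'v::real_vector \<Rightarrow> real \<Rightarrow> bool"
  assumes "bounding_cone S"
  obtains f where "linear f" "\<And>x t. S x t \<Longrightarrow> f x \<le> t"
proof -
  obtain f where f: "linear f" "\<forall>x. f x \<le> Inf {t. S x t}"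
    using linear_minorant_of_sublinear[OF bounding_cone_Inf(1)[OF assms]] by (elim exE conjE)
  show thesis
  proof (rule that[OF f(1)])
    fix x t assume "S x t"
    then show "f x \<le> t"
      using bounding_cone_Inf(2)[OF assms, of x t] spec[OF f(2), of x] by linarith
  qed
qed

text \<open>An algebraic projection onto \<open>V\<close> pulls the cone back to the whole
  space.\<close>

lemma linear_minorant_of_cone_on_subspace:
  fixes S :: "'v::real_vector \<Rightarrow> real \<Rightarrow> bool"
  assumes V: "subspace V"
    and add: "\<And>x y s t. x \<in> V \<Longrightarrow> y \<in> V \<Longrightarrow> S x s \<Longrightarrow> S y t \<Longrightarrow> S (x + y) (s + t)"
    and scale: "\<And>x s r. x \<in> V \<Longrightarrow> S x s \<Longrightarrow> 0 < r \<Longrightarrow> S (r *\<^sub>R x) (r * s)"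
    and nonneg: "\<And>t. S 0 t \<Longrightarrow> 0 \<le> t" and dom: "\<And>x. x \<in> V \<Longrightarrow> \<exists>t. S x t"
  obtains f where "linear f" "\<And>x t. x \<in> V \<Longrightarrow> S x t \<Longrightarrow> f x \<le> t"
proof -
  obtain P where P: "range P \<subseteq> V" "linear P" "\<And>v. v \<in> V \<Longrightarrow> P v = v"
    using linear_exists_left_inverse_on[OF linear_id V] by auto
  have "bounding_cone (\<lambda>x. S (P x))"
    using P add scale nonneg dom
    by (intro bounding_coneI) (auto simp: linear_add linear_scale linear_0 image_subset_iff)
  then obtain f where f: "linear f" "\<And>x t. S (P x) t \<Longrightarrow> f x \<le> t"
    by (rule linear_minorant_of_cone) blast
  show thesis
    by (rule that[OF f(1)], rule f(2)) (simp add: P(3))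
qed

text \<open>The cone is enlarged by the ray through (-y, -Q), which forces f (-y) \<le> -Q. The
  hypothesis on \<open>Q\<close> ensures that the enlarged cone still contains no point (0, t) with
  t < 0.\<close>

lemma linear_minorant_of_cone_at_point:
  fixes S :: "'v::real_vector \<Rightarrow> real \<Rightarrow> bool"
  assumes S: "bounding_cone S" and S0: "S 0 0" and Q: "\<And>t. S y t \<Longrightarrow> Q \<le> t"
  obtains f where "linear f" "\<And>x t. S x t \<Longrightarrow> f x \<le> t" "Q \<le> f y"
proof -
  have add: "S (x + y) (s + t)" if "S x s" "S y t" for x y s t
    using S that by (auto simp: bounding_cone_def)
  have scale: "S (r *\<^sub>R x) (r * s)" if "S x s" "0 < r" for x s r
    using S that by (auto simp: bounding_cone_def)
  have nonneg: "0 \<le> t" if "S 0 t" for t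
    using S that by (auto simp: bounding_cone_def)
  have dom: "\<exists>t. S x t" for x
    using S by (auto simp: bounding_cone_def)
  let ?S = "\<lambda>x t. \<exists>r\<ge>0. S (x + r *\<^sub>R y) (t + r * Q)"
  have "bounding_cone ?S"
  proof (rule bounding_coneI)
    fix x x' s s' assume "?S x s" "?S x' s'"
    then obtain r r' where r: "r \<ge> 0" "S (x + r *\<^sub>R y) (s + r * Q)"
      "r' \<ge> 0" "S (x' + r' *\<^sub>R y) (s' + r' * Q)" by auto
    then show "?S (x + x') (s + s')"
      using add[OF r(2,4)] by (intro exI[of _ "r + r'"]) (auto simp: algebra_simps)
  next
    fix x s and u :: real assume "?S x s" and u: "0 < u"
    then obtain r where r: "r \<ge> 0" "S (x + r *\<^sub>R y) (s + r * Q)" by auto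
    then show "?S (u *\<^sub>R x) (u * s)"
      using scale[OF r(2) u] u by (intro exI[of _ "u * r"]) (auto simp: algebra_simps)
  next
    fix t assume "?S 0 t"
    then obtain r where r: "r \<ge> 0" "S (r *\<^sub>R y) (t + r * Q)" by auto
    show "0 \<le> t"
    proof (cases "r = 0")
      case True
      then show ?thesis using r nonneg by auto
    next
      case False
      then have "S y (inverse r * (t + r * Q))"
        using scale[OF r(2), of "inverse r"] r by simp
      from Q[OF this] show ?thesis using False r by (simp add: field_simps)
    qed
  next
    fix x
    obtain t where "S x t" using dom by auto
    then show "\<exists>t. ?S x t" by (intro exI[of _ t] exI[of _ 0]) simp
  qed
  then obtain f where f: "linear f" "\<And>x t. ?S x t \<Longrightarrow> f x \<le> t"
    by (rule linear_minorant_of_cone) blast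
  have "f (- y) \<le> - Q" using S0 by (intro f(2) exI[of _ 1]) simp
  then have "Q \<le> f y" using f(1) by (simp add: linear_neg)
  moreover have "f x \<le> t" if "S x t" for x t
    using that by (intro f(2) exI[of _ 0]) simp
  ultimately show thesis using that[OF f(1)] by blast
qed

text \<open>Function spaces carry two of the separation arguments: one for scalar sequences with
  norms in \<open>ell p\<close>, the other for families of vectors indexed by a finite set.\<close>

instantiation "fun" :: (type, real_vector) real_vector
begin

definition "r *\<^sub>R f = (\<lambda>x. r *\<^sub>R f x)"

instance
  by standard (simp_all add: scaleR_fun_def fun_eq_iff algebra_simps)

end

lemma scaleR_fun_apply [simp]: "(r *\<^sub>R f) x = r *\<^sub>R f x"
  by (simp add: scaleR_fun_def)

section \<open>Real parts of functionals\<close>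

text \<open>The inner product with \<open>1\<close> plays the role of the real part on \<open>'k\<close>.\<close>

lemma inner_mult_one_eq_0:
  fixes a :: "'k::{real_normed_field,euclidean_space}"
  assumes "\<And>c. (c * a) \<bullet> 1 = 0"
  shows "a = 0"
proof (rule ccontr)
  assume "a \<noteq> 0"
  then show False using assms[of "inverse a"] by simp
qed

lemma inner_mult_one_eqD:
  fixes a :: "'k::{real_normed_field,euclidean_space}"
  assumes "\<And>c. (c * a) \<bullet> 1 = (c * b) \<bullet> 1"
  shows "a = b"
  using inner_mult_one_eq_0[of "a - b"] assms by (simp add: algebra_simps inner_diff_left)

lemma inner_one_le_norm: "(c :: 'k::{real_normed_field,euclidean_space}) \<bullet> 1 \<le> norm c"
  using norm_cauchy_schwarz[of c 1] by simp

lemma of_real_inner_one: "(of_real r :: 'k::{real_normed_field,euclidean_space}) \<bullet> 1 = r"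
  by (simp add: of_real_def dot_square_norm)

text \<open>The real bilinear form (c, a) \<mapsto> (c * a) \<bullet> 1 is nondegenerate because
  \<open>a\<close> can be inverted. The map \<open>h\<close> that represents it by the inner product
  is therefore injective, and by finite dimension onto.\<close>

lemma linear_functional_as_inner_mult_one:
  fixes u :: "'k::{real_normed_field,euclidean_space} \<Rightarrow> real"
  assumes u: "linear u"
  shows "\<exists>a. \<forall>c. u c = (c * a) \<bullet> 1"
proof -
  define h where "h a = (\<Sum>b\<in>Basis. ((b * a) \<bullet> 1) *\<^sub>R b)" for a :: 'k
  have h: "c \<bullet> h a = (c * a) \<bullet> 1" for a c
  proof -
    have "(c * a) \<bullet> 1 = ((\<Sum>b\<in>Basis. (c \<bullet> b) *\<^sub>R b) * a) \<bullet> 1"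
      by (simp add: euclidean_representation)
    also have "\<dots> = c \<bullet> h a"
      by (simp add: h_def sum_distrib_right inner_sum_left inner_sum_right mult.commute[where 'a=real])
    finally show ?thesis ..
  qed
  have "linear h"
    by (rule linearI) (simp_all add: h_def algebra_simps inner_add_left sum.distrib scaleR_sum_right)
  moreover have "inj h"
  proof (subst linear_injective_0[OF \<open>linear h\<close>], safe)
    fix a assume a: "h a = 0"
    have "(c * a) \<bullet> 1 = 0" for c using h[of c a] a by simp
    then show "a = 0" by (rule inner_mult_one_eq_0)
  qed
  ultimately have "surj h" by (rule linear_injective_imp_surjective) (rule refl)
  from surjD[OF this] obtain a where a: "(\<Sum>b\<in>Basis. u b *\<^sub>R b) = h a" by blast
  have "u c = (c * a) \<bullet> 1" for c
  proof -
    have "u c = u (\<Sum>b\<in>Basis. (c \<bullet> b) *\<^sub>R b)" by (simp add: euclidean_representation)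
    also have "\<dots> = c \<bullet> h a"
      using u by (simp add: a[symmetric] linear_sum linear_scale inner_sum_right mult.commute)
    finally show ?thesis by (simp add: h)
  qed
  then show ?thesis by blast
qed

lemma (in banach_over) scale_scaleR: "scale c (r *\<^sub>R x) = r *\<^sub>R scale c x"
  by (metis scale_of_real scale_left_commute)

lemma (in banach_over) scaleR_scale_left: "scale (r *\<^sub>R c) x = r *\<^sub>R scale c x"
  by (metis scale_of_real scale_scale scaleR_conv_of_real)

text \<open>For fixed \<open>x\<close> the map c \<mapsto> u (s c x) is a real functional on the
  scalars, hence of the form (c * F x) \<bullet> 1. This \<open>F\<close> is the scalar-linear
  functional with real part \<open>u\<close>.\<close>

lemma complexification:
  fixes s :: "'k::{real_normed_field,euclidean_space} \<Rightarrow> 'a::banach \<Rightarrow> 'a"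
  assumes s: "banach_over s" and u: "linear u" and le: "\<And>x. u x \<le> M * norm x"
  shows "\<exists>f\<in>dual_space s. (\<forall>x. u x = f x \<bullet> 1) \<and> (\<forall>x. norm (f x) \<le> M * norm x)"
proof -
  interpret banach_over s by fact
  have "\<exists>a. \<forall>c. u (s c x) = (c * a) \<bullet> 1" for x
    using u by (intro linear_functional_as_inner_mult_one)
      (auto intro!: linearI simp: scale_left_distrib scaleR_scale_left linear_add linear_scale)
  then obtain F where F: "\<And>x c. u (s c x) = (c * F x) \<bullet> 1" by metis
  have bound: "norm (F x) \<le> M * norm x" for x
  proof (cases "F x = 0")
    case True
    have "0 \<le> M * norm x"
      using le[of x] le[of "- x"] linear_neg[OF u, of x] by simp
    then show ?thesis using True by simp
  next
    case False
    \<comment> \<open>Rotating and scaling \<open>x\<close> by the inverse of F x makes the value of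
      \<open>F\<close> equal to 1, where nothing is lost by passing to the real part.\<close>
    have "1 = u (s (inverse (F x)) x)" using False by (simp add: F dot_square_norm)
    also have "\<dots> \<le> M * (norm x / norm (F x))"
      using le[of "s (inverse (F x)) x"] by (simp add: norm_scale norm_inverse divide_inverse mult.commute)
    finally show ?thesis using False by (simp add: field_simps)
  qed
  have sF: "F (s c x) = c * F x" for c x
    by (rule inner_mult_one_eqD) (metis F scale_scale mult.assoc)
  have addF: "F (x + y) = F x + F y" for x y
    by (rule inner_mult_one_eqD)
      (metis F scale_right_distrib linear_add[OF u] inner_add_left distrib_left)
  have "bounded_linear F"
    using addF sF[of "of_real _"] bound
    by (intro bounded_linear_intro[where K = M]) (auto simp: scale_of_real scaleR_conv_of_real mult.commute)
  then have "blinfun_apply (Blinfun F) = F" by (rule bounded_linear_Blinfun_apply)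
  moreover have "u x = F x \<bullet> 1" for x using F[of 1 x] by simp
  ultimately show ?thesis using sF bound by (intro bexI[of _ "Blinfun F"]) (auto simp: dual_space_def)
qed

lemma norming_functional:
  fixes s :: "'k::{real_normed_field,euclidean_space} \<Rightarrow> 'a::banach \<Rightarrow> 'a"
  assumes s: "banach_over s"
  shows "\<exists>f\<in>dual_space s. norm f \<le> 1 \<and> norm x \<le> norm (blinfun_apply f x)"
proof -
  have "bounding_cone (\<lambda>v t. norm (v::'a) \<le> t)"
    by (rule bounding_coneI) (auto intro: norm_triangle_le)
  then obtain u :: "'a \<Rightarrow> real" where u: "linear u" "\<And>v t. norm v \<le> t \<Longrightarrow> u v \<le> t" "norm x \<le> u x"
    by (rule linear_minorant_of_cone_at_point[where y = x and Q = "norm x"]) auto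
  obtain f where f: "f \<in> dual_space s" "\<And>x. u x = f x \<bullet> 1" "\<And>x. norm (f x) \<le> 1 * norm x"
    using complexification[OF s u(1), of 1] u(2) by auto
  have "norm f \<le> 1" using f(3) by (intro norm_blinfun_bound) auto
  then show ?thesis using f(1) f(2)[of x] u(3) inner_one_le_norm[of "f x"] by force
qed

section \<open>The spaces \<open>ell p\<close>\<close>

lemma exponent_cases:
  assumes "1 \<le> (p::ennreal)"
  obtains "p = top" | r where "1 \<le> r" "p = ennreal r"
  using assms by (cases p) auto

section \<open>Convexity inequalities for powers\<close>

lemma powr_convex_nonneg:
  fixes x y u v r :: real
  assumes "0 \<le> x" "0 \<le> y" "0 \<le> u" "0 \<le> v" "u + v = 1" "1 \<le> r"
  shows "(u * x + v * y) powr r \<le> u * x powr r + v * y powr r"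
proof -
  have small: "(w * z) powr r \<le> w * z powr r" if "0 \<le> w" "w \<le> 1" "0 \<le> z" for w z
  proof -
    have "w powr r \<le> w"
      using that \<open>1 \<le> r\<close> powr_mono_both'[of 1 r w w] by (cases "w = 0") (auto simp: powr_le_one_le)
    then show ?thesis using that by (simp add: powr_mult mult_right_mono)
  qed
  consider "x = 0" | "y = 0" | "0 < x" "0 < y" using assms by fastforce
  then show ?thesis
  proof cases
    case 3
    have u: "u = 1 - v" using assms by simp
    show ?thesis
      using convex_onD[OF powr_convex[OF \<open>1 \<le> r\<close>], of v x y] 3 assms(3,4) unfolding u by simp
  qed (use small[of u x] small[of v y] assms in auto)
qed

text \<open>The termwise step of Minkowski's inequality. With A and B the norms of two sequences,
  summing over the entries turns both quotients into at most 1 and leaves (A + B) powr r.\<close>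

lemma powr_add_le_convex_combination:
  fixes x y A B r :: real
  assumes "0 \<le> x" "0 \<le> y" "0 < A" "0 < B" "1 \<le> r"
  shows "(x + y) powr r \<le> (A + B) powr r * (A / (A + B) * (x powr r / A powr r) + B / (A + B) * (y powr r / B powr r))"
proof -
  define u v where "u = A / (A + B)" and "v = B / (A + B)"
  have uv: "0 \<le> u" "0 \<le> v" "u + v = 1" "(A + B) * u = A" "(A + B) * v = B"
    using assms by (auto simp: u_def v_def add_divide_distrib[symmetric])
  have "x + y = (A + B) * u * (x / A) + (A + B) * v * (y / B)"
    unfolding uv using assms by simp
  also have "\<dots> = (A + B) * (u * (x / A) + v * (y / B))"
    by (simp only: distrib_left mult.assoc)
  finally have "(x + y) powr r = (A + B) powr r * (u * (x / A) + v * (y / B)) powr r"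
    using assms uv by (simp add: powr_mult)
  also have "\<dots> \<le> (A + B) powr r * (u * (x / A) powr r + v * (y / B) powr r)"
    using assms uv by (intro mult_left_mono powr_convex_nonneg) auto
  finally show ?thesis using assms by (simp add: powr_divide u_def v_def)
qed

text \<open>Write x powr r as x times x powr (r - 1) and bound the second factor by the same power
  of the whole sum.\<close>

lemma sum_powr_le_powr_sum:
  fixes x :: "'i \<Rightarrow> real"
  assumes "1 \<le> r" "\<And>i. i \<in> A \<Longrightarrow> 0 \<le> x i"
  shows "(\<Sum>i\<in>A. x i powr r) \<le> (\<Sum>i\<in>A. x i) powr r"
proof (cases "finite A")
  case True
  let ?S = "\<Sum>i\<in>A. x i"
  have S: "0 \<le> ?S" using assms by (intro sum_nonneg)
  have split: "z powr r = z * z powr (r - 1)" if "0 \<le> z" for z :: real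
    using that powr_add[of z 1 "r - 1"] by (cases "z = 0") auto
  have "(\<Sum>i\<in>A. x i powr r) \<le> (\<Sum>i\<in>A. x i * ?S powr (r - 1))"
  proof (rule sum_mono)
    fix i assume i: "i \<in> A"
    then have "x i \<le> ?S" using True assms by (intro member_le_sum) auto
    then have "x i powr (r - 1) \<le> ?S powr (r - 1)" using assms i by (intro powr_mono2) auto
    then show "x i powr r \<le> x i * ?S powr (r - 1)"
      using assms(2)[OF i] by (simp add: split mult_left_mono)
  qed
  also have "\<dots> = ?S powr r" by (simp add: sum_distrib_right[symmetric] split[OF S])
  finally show ?thesis .
qed simp

section \<open>Membership, norm estimates and tails in \<open>ell p\<close>\<close>

lemma ell_top_iff: "a \<in> ell top \<longleftrightarrow> a \<longlonglongrightarrow> 0"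
  by (simp add: ell_def)

lemma ell_real_iff: "1 \<le> r \<Longrightarrow> a \<in> ell (ennreal r) \<longleftrightarrow> summable (\<lambda>n. \<bar>a n\<bar> powr r)"
  by (simp add: ell_def)

lemma ell_norm_real:
  "1 \<le> r \<Longrightarrow> ell_norm (ennreal r) a = (\<Sum>n. \<bar>a n\<bar> powr r) powr (1 / r)"
  by (simp add: ell_norm_def)

lemma ell_norm_top_leI:
  assumes "\<And>n. \<bar>a n\<bar> \<le> C"
  shows "ell_norm top a \<le> C"
  unfolding ell_norm_def by (simp add: cSUP_least assms)

lemma ell_realI:
  assumes "1 \<le> r" "0 \<le> C" "\<And>N. (\<Sum>n<N. \<bar>a n\<bar> powr r) \<le> C powr r"
  shows "a \<in> ell (ennreal r)" "ell_norm (ennreal r) a \<le> C"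
proof -
  have s: "summable (\<lambda>n. \<bar>a n\<bar> powr r)"
    by (rule summableI_nonneg_bounded[where x = "C powr r"]) (use assms in auto)
  then show "a \<in> ell (ennreal r)" using assms by (simp add: ell_real_iff)
  have "(\<Sum>n. \<bar>a n\<bar> powr r) \<le> C powr r"
    using s assms(3) by (intro suminf_le_const) auto
  then have "(\<Sum>n. \<bar>a n\<bar> powr r) powr (1 / r) \<le> (C powr r) powr (1 / r)"
    using assms s by (intro powr_mono2) (auto intro: suminf_nonneg)
  then show "ell_norm (ennreal r) a \<le> C"
    using assms by (simp add: ell_norm_real powr_powr)
qed

lemma ell_norm_nonneg: "1 \<le> p \<Longrightarrow> a \<in> ell p \<Longrightarrow> 0 \<le> ell_norm p a"
proof (erule exponent_cases)
  assume "a \<in> ell p" "p = top"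
  then have "bdd_above (range (\<lambda>n. \<bar>a n\<bar>))"
    by (intro bdd_above_norm[THEN iffD2, of "range a", simplified image_image real_norm_def]
        convergent_imp_bounded) (auto simp: ell_top_iff convergent_def)
  then have "\<bar>a 0\<bar> \<le> (SUP n. \<bar>a n\<bar>)" by (intro cSUP_upper) auto
  then show ?thesis using \<open>p = top\<close> by (simp add: ell_norm_def)
qed (simp add: ell_norm_real)

lemma sum_le_ell_norm_real:
  assumes "1 \<le> r" "a \<in> ell (ennreal r)" "finite A"
  shows "(\<Sum>n\<in>A. \<bar>a n\<bar> powr r) \<le> ell_norm (ennreal r) a powr r"
proof -
  have s: "summable (\<lambda>n. \<bar>a n\<bar> powr r)" using assms by (simp add: ell_real_iff)
  have "(\<Sum>n\<in>A. \<bar>a n\<bar> powr r) \<le> (\<Sum>n. \<bar>a n\<bar> powr r)"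
    by (rule sum_le_suminf) (use s assms in auto)
  also have "\<dots> = ell_norm (ennreal r) a powr r"
    using assms s by (simp add: ell_norm_real powr_powr suminf_nonneg)
  finally show ?thesis .
qed

lemma abs_le_ell_norm:
  assumes "1 \<le> p" "a \<in> ell p"
  shows "\<bar>a n\<bar> \<le> ell_norm p a"
  using assms(1)
proof (cases rule: exponent_cases)
  case 1
  then have "bdd_above (range (\<lambda>n. \<bar>a n\<bar>))"
    using assms by (intro bdd_above_norm[THEN iffD2, of "range a", simplified image_image real_norm_def]
        convergent_imp_bounded) (auto simp: ell_top_iff convergent_def)
  then have "\<bar>a n\<bar> \<le> (SUP n. \<bar>a n\<bar>)" by (intro cSUP_upper) auto
  then show ?thesis using 1 by (simp add: ell_norm_def)
next
  case (2 r)
  then have "\<bar>a n\<bar> powr r \<le> ell_norm p a powr r"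
    using sum_le_ell_norm_real[of r a "{n}"] assms by simp
  then show ?thesis
    using 2 ell_norm_nonneg[OF assms] powr_less_mono2[of r "ell_norm p a" "\<bar>a n\<bar>"]
    by (cases "ell_norm p a < \<bar>a n\<bar>") auto
qed

lemma ell_mono:
  assumes "1 \<le> p" "a \<in> ell p" "\<And>n. \<bar>b n\<bar> \<le> \<bar>a n\<bar>"
  shows "b \<in> ell p" "ell_norm p b \<le> ell_norm p a"
proof -
  have "b \<in> ell p \<and> ell_norm p b \<le> ell_norm p a"
    using assms(1)
  proof (cases rule: exponent_cases)
    case 1
    have "b \<longlonglongrightarrow> 0"
      by (rule Lim_null_comparison[where g = "\<lambda>n. \<bar>a n\<bar>"])
        (use assms 1 in \<open>auto simp: ell_top_iff intro: tendsto_rabs_zero\<close>)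
    moreover have "\<bar>b n\<bar> \<le> ell_norm p a" for n
      using abs_le_ell_norm[OF assms(1,2), of n] assms(3)[of n] by linarith
    ultimately show ?thesis using 1 ell_norm_top_leI by (auto simp: ell_top_iff)
  next
    case (2 r)
    have "(\<Sum>n<N. \<bar>b n\<bar> powr r) \<le> ell_norm p a powr r" for N
    proof -
      have "(\<Sum>n<N. \<bar>b n\<bar> powr r) \<le> (\<Sum>n<N. \<bar>a n\<bar> powr r)"
        using 2 assms by (intro sum_mono powr_mono2) auto
      also have "\<dots> \<le> ell_norm p a powr r"
        using sum_le_ell_norm_real[of r a] 2 assms by simp
      finally show ?thesis .
    qed
    from ell_realI[OF 2(1) ell_norm_nonneg[OF assms(1,2)] this] 2(2) show ?thesis by simp
  qed
  then show "b \<in> ell p" "ell_norm p b \<le> ell_norm p a" by auto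
qed

lemma ell_finite_support:
  assumes "1 \<le> p" "\<And>n. n \<ge> N \<Longrightarrow> a n = 0"
  shows "a \<in> ell p" "ell_norm p a \<le> (\<Sum>n<N. \<bar>a n\<bar>)"
proof -
  have le: "\<bar>a n\<bar> \<le> (\<Sum>n<N. \<bar>a n\<bar>)" for n
  proof (cases "n < N")
    case True
    then show ?thesis by (intro member_le_sum) auto
  qed (simp add: assms sum_nonneg)
  have "a \<in> ell p \<and> ell_norm p a \<le> (\<Sum>n<N. \<bar>a n\<bar>)"
    using assms(1)
  proof (cases rule: exponent_cases)
    case 1
    have "a \<longlonglongrightarrow> 0"
      by (rule tendsto_eventually) (use assms in \<open>auto simp: eventually_sequentially\<close>)
    then show ?thesis using 1 le ell_norm_top_leI by (auto simp: ell_top_iff)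
  next
    case (2 r)
    have "(\<Sum>n<M. \<bar>a n\<bar> powr r) \<le> (\<Sum>n<N. \<bar>a n\<bar>) powr r" for M
    proof -
      have "(\<Sum>n<M. \<bar>a n\<bar> powr r) \<le> (\<Sum>n<M. \<bar>a n\<bar>) powr r"
        by (rule sum_powr_le_powr_sum) (use 2 in auto)
      also have "\<dots> \<le> (\<Sum>n<N. \<bar>a n\<bar>) powr r"
      proof (rule powr_mono2)
        have "(\<Sum>n<M. \<bar>a n\<bar>) = (\<Sum>n\<in>{..<M} \<inter> {..<N}. \<bar>a n\<bar>)"
          by (rule sum.mono_neutral_right) (use assms(2) in \<open>force simp: not_less\<close>)+
        also have "\<dots> \<le> (\<Sum>n<N. \<bar>a n\<bar>)" by (rule sum_mono2) auto
        finally show "(\<Sum>n<M. \<bar>a n\<bar>) \<le> (\<Sum>n<N. \<bar>a n\<bar>)" .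
      qed (use 2 in \<open>auto intro: sum_nonneg\<close>)
      finally show ?thesis .
    qed
    from ell_realI[OF 2(1) _ this] 2(2) show ?thesis by (simp add: sum_nonneg)
  qed
  then show "a \<in> ell p" "ell_norm p a \<le> (\<Sum>n<N. \<bar>a n\<bar>)" by auto
qed

lemma ell_cmult:
  assumes "1 \<le> p" "a \<in> ell p"
  shows "(\<lambda>n. c * a n) \<in> ell p" "ell_norm p (\<lambda>n. c * a n) \<le> \<bar>c\<bar> * ell_norm p a"
proof -
  have nn: "0 \<le> \<bar>c\<bar> * ell_norm p a" using ell_norm_nonneg[OF assms] by simp
  have "(\<lambda>n. c * a n) \<in> ell p \<and> ell_norm p (\<lambda>n. c * a n) \<le> \<bar>c\<bar> * ell_norm p a"
    using assms(1)
  proof (cases rule: exponent_cases)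
    case 1
    have "(\<lambda>n. c * a n) \<longlonglongrightarrow> 0"
      using tendsto_mult_left[of a 0 sequentially c] 1 assms by (simp add: ell_top_iff)
    then show ?thesis
      using 1 ell_norm_top_leI[of "\<lambda>n. c * a n"] abs_le_ell_norm[OF assms]
      by (auto simp: ell_top_iff abs_mult mult_left_mono)
  next
    case (2 r)
    have "(\<Sum>n<N. \<bar>c * a n\<bar> powr r) \<le> (\<bar>c\<bar> * ell_norm p a) powr r" for N
      using sum_le_ell_norm_real[of r a "{..<N}"] 2 assms ell_norm_nonneg[OF assms]
      by (simp add: abs_mult powr_mult sum_distrib_left[symmetric] mult_left_mono)
    from ell_realI[OF 2(1) nn this] 2(2) show ?thesis by simp
  qed
  then show "(\<lambda>n. c * a n) \<in> ell p" "ell_norm p (\<lambda>n. c * a n) \<le> \<bar>c\<bar> * ell_norm p a" by auto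
qed

lemma ell_add:
  assumes "1 \<le> p" "a \<in> ell p" "b \<in> ell p"
  shows "(\<lambda>n. a n + b n) \<in> ell p" "ell_norm p (\<lambda>n. a n + b n) \<le> ell_norm p a + ell_norm p b"
proof -
  let ?A = "ell_norm p a" and ?B = "ell_norm p b"
  have nn: "0 \<le> ?A" "0 \<le> ?B" using ell_norm_nonneg assms by auto
  have "(\<lambda>n. a n + b n) \<in> ell p \<and> ell_norm p (\<lambda>n. a n + b n) \<le> ?A + ?B"
    using assms(1)
  proof (cases rule: exponent_cases)
    case 1
    have "\<bar>a n + b n\<bar> \<le> ?A + ?B" for n
      using abs_le_ell_norm[OF assms(1,2), of n] abs_le_ell_norm[OF assms(1,3), of n] by linarith
    then show ?thesis
      using 1 assms ell_norm_top_leI[of "\<lambda>n. a n + b n"] tendsto_add_zero[of a sequentially b]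
      by (auto simp: ell_top_iff)
  next
    case (2 r)
    have "(\<Sum>n<N. \<bar>a n + b n\<bar> powr r) \<le> (?A + ?B) powr r" for N
    proof -
      have sa: "(\<Sum>n<N. \<bar>a n\<bar> powr r) \<le> ?A powr r" and sb: "(\<Sum>n<N. \<bar>b n\<bar> powr r) \<le> ?B powr r"
        using sum_le_ell_norm_real[of r a "{..<N}"] sum_le_ell_norm_real[of r b "{..<N}"] 2 assms by auto
      consider "?A = 0" | "?B = 0" | "0 < ?A" "0 < ?B" using nn by fastforce
      then show ?thesis
      proof cases
        case 1
        then have "a n = 0" for n using abs_le_ell_norm[OF assms(1,2), of n] by simp
        then show ?thesis using sb 1 by simp
      next
        case 2
        then have "b n = 0" for n using abs_le_ell_norm[OF assms(1,3), of n] by simp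
        then show ?thesis using sa 2 by simp
      next
        case 3
        define u v where "u = ?A / (?A + ?B)" and "v = ?B / (?A + ?B)"
        have uv: "0 \<le> u" "0 \<le> v" "u + v = 1"
          using 3 by (auto simp: u_def v_def add_divide_distrib[symmetric])
        have "\<bar>a n + b n\<bar> powr r \<le>
          (?A + ?B) powr r * (u * (\<bar>a n\<bar> powr r / ?A powr r) + v * (\<bar>b n\<bar> powr r / ?B powr r))" for n
        proof -
          have "\<bar>a n + b n\<bar> powr r \<le> (\<bar>a n\<bar> + \<bar>b n\<bar>) powr r"
            using 2 by (intro powr_mono2) auto
          also have "\<dots> \<le> (?A + ?B) powr r * (u * (\<bar>a n\<bar> powr r / ?A powr r) + v * (\<bar>b n\<bar> powr r / ?B powr r))"
            unfolding u_def v_def by (rule powr_add_le_convex_combination) (use 2 3 in auto)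
          finally show ?thesis .
        qed
        then have "(\<Sum>n<N. \<bar>a n + b n\<bar> powr r) \<le>
          (\<Sum>n<N. (?A + ?B) powr r * (u * (\<bar>a n\<bar> powr r / ?A powr r) + v * (\<bar>b n\<bar> powr r / ?B powr r)))"
          by (intro sum_mono)
        also have "\<dots> = (?A + ?B) powr r *
          (u * ((\<Sum>n<N. \<bar>a n\<bar> powr r) / ?A powr r) + v * ((\<Sum>n<N. \<bar>b n\<bar> powr r) / ?B powr r))"
          by (simp only: sum_distrib_left[symmetric] sum.distrib sum_divide_distrib[symmetric])
        also have "\<dots> \<le> (?A + ?B) powr r * (u * 1 + v * 1)"
          using sa sb 3 uv(1,2) by (intro mult_left_mono add_mono) auto
        finally show ?thesis using uv by simp
      qed
    qed
    from ell_realI[OF 2(1) _ this] 2(2) nn show ?thesis by simp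
  qed
  then show "(\<lambda>n. a n + b n) \<in> ell p" "ell_norm p (\<lambda>n. a n + b n) \<le> ?A + ?B" by auto
qed

text \<open>For p = top this rests on \<open>ell top\<close> consisting of null sequences rather
  than bounded ones.\<close>

lemma ell_tail:
  assumes "1 \<le> p" "a \<in> ell p" "0 < e"
  shows "\<exists>N. ell_norm p (\<lambda>n. if n < N then 0 else a n) \<le> e"
  using assms(1)
proof (cases rule: exponent_cases)
  case 1
  then obtain N where N: "\<And>n. n \<ge> N \<Longrightarrow> \<bar>a n\<bar> < e"
    using assms LIMSEQ_D[of a 0 e] by (auto simp: ell_top_iff)
  have "ell_norm p (\<lambda>n. if n < N then 0 else a n) \<le> e"
    unfolding 1 by (rule ell_norm_top_leI) (use N assms in \<open>auto simp: not_less less_imp_le\<close>)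
  then show ?thesis by blast
next
  case (2 r)
  have s: "summable (\<lambda>n. \<bar>a n\<bar> powr r)" using assms 2 by (simp add: ell_real_iff)
  obtain N where N: "norm (\<Sum>i. \<bar>a (i + N)\<bar> powr r) < e powr r"
    using suminf_exist_split[OF _ s, of "e powr r"] assms by auto
  have "(\<Sum>n<M. \<bar>if n < N then 0 else a n\<bar> powr r) \<le> e powr r" for M
  proof -
    have "(\<Sum>n<M. \<bar>if n < N then 0 else a n\<bar> powr r) = (\<Sum>n\<in>{N..<M}. \<bar>a n\<bar> powr r)"
      by (rule sum.mono_neutral_cong_right) auto
    also have "\<dots> = (\<Sum>n\<in>{..<M-N}. \<bar>a (n + N)\<bar> powr r)"
      by (rule sum.reindex_bij_witness[where i = "\<lambda>n. n + N" and j = "\<lambda>n. n - N"]) auto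
    also have "\<dots> \<le> (\<Sum>i. \<bar>a (i + N)\<bar> powr r)"
      using s by (intro sum_le_suminf) (auto simp: summable_iff_shift[of "\<lambda>n. \<bar>a n\<bar> powr r"])
    finally show ?thesis using N by simp
  qed
  then have "ell_norm p (\<lambda>n. if n < N then 0 else a n) \<le> e"
    unfolding 2 using 2 assms by (intro ell_realI) auto
  then show ?thesis by blast
qed

lemma ell_tail_LIMSEQ:
  assumes p: "1 \<le> p" and a: "a \<in> ell p"
  shows "(\<lambda>N. ell_norm p (\<lambda>n. if n < N then 0 else a n)) \<longlonglongrightarrow> 0"
proof (rule LIMSEQ_I)
  fix e :: real assume e: "0 < e"
  obtain N where N: "ell_norm p (\<lambda>n. if n < N then 0 else a n) \<le> e / 2"
    using ell_tail[OF p a, of "e / 2"] e by auto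
  have tail: "(\<lambda>n. if n < M then 0 else a n) \<in> ell p" for M
    by (rule ell_mono(1)[OF p a]) simp
  have "norm (ell_norm p (\<lambda>n. if n < M then 0 else a n) - 0) < e" if "M \<ge> N" for M
  proof -
    have "ell_norm p (\<lambda>n. if n < M then 0 else a n) \<le> ell_norm p (\<lambda>n. if n < N then 0 else a n)"
      by (rule ell_mono(2)[OF p tail]) (use that in auto)
    then show ?thesis using N e ell_norm_nonneg[OF p tail, of M] by simp
  qed
  then show "\<exists>N. \<forall>M\<ge>N. norm (ell_norm p (\<lambda>n. if n < M then 0 else a n) - 0) < e" by blast
qed

text \<open>For finite p distinct terms of the series are selected; for p = top an injection of the
  naturals tends to infinity. It is used to extract a row of a sequence indexed by
  \<open>prod_encode\<close>.\<close>

lemma ell_inj_reindex: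
  assumes "1 \<le> p" "a \<in> ell p" "inj g"
  shows "(\<lambda>n. a (g n)) \<in> ell p" "ell_norm p (\<lambda>n. a (g n)) \<le> ell_norm p a"
proof -
  have "(\<lambda>n. a (g n)) \<in> ell p \<and> ell_norm p (\<lambda>n. a (g n)) \<le> ell_norm p a"
    using assms(1)
  proof (cases rule: exponent_cases)
    case 1
    have "filterlim g cofinite cofinite"
      unfolding filterlim_iff eventually_cofinite
    proof (intro allI impI)
      fix P :: "nat \<Rightarrow> bool" assume "finite {x. \<not> P x}"
      from finite_vimageI[OF this assms(3)] show "finite {x. \<not> P (g x)}" by (simp add: vimage_def)
    qed
    then have "filterlim g sequentially sequentially" by (simp add: cofinite_eq_sequentially)
    then have "(\<lambda>n. a (g n)) \<longlonglongrightarrow> 0"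
      using 1 assms by (auto simp: ell_top_iff intro: filterlim_compose)
    then show ?thesis
      using 1 ell_norm_top_leI[of "\<lambda>n. a (g n)"] abs_le_ell_norm[OF assms(1,2)]
      by (auto simp: ell_top_iff)
  next
    case (2 r)
    have "(\<Sum>n<N. \<bar>a (g n)\<bar> powr r) \<le> ell_norm p a powr r" for N
    proof -
      have "(\<Sum>n<N. \<bar>a (g n)\<bar> powr r) = (\<Sum>m\<in>g ` {..<N}. \<bar>a m\<bar> powr r)"
        using assms(3) by (subst sum.reindex) (auto intro: inj_on_subset)
      also have "\<dots> \<le> ell_norm p a powr r"
        using sum_le_ell_norm_real[of r a] 2 assms by simp
      finally show ?thesis .
    qed
    from ell_realI[OF 2(1) ell_norm_nonneg[OF assms(1,2)] this] 2(2) show ?thesis by simp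
  qed
  then show "(\<lambda>n. a (g n)) \<in> ell p" "ell_norm p (\<lambda>n. a (g n)) \<le> ell_norm p a" by auto
qed

section \<open>Arranging a sequence of sequences into one sequence\<close>

definition concat_seq :: "(nat \<Rightarrow> nat \<Rightarrow> 'x) \<Rightarrow> nat \<Rightarrow> 'x"
  where "concat_seq z m = z (fst (prod_decode m)) (snd (prod_decode m))"

lemma concat_seq_encode [simp]: "concat_seq z (prod_encode (k, n)) = z k n"
  by (simp add: concat_seq_def)

text \<open>The code of a pair is at least as large as each component, so the indices below M decode
  into the square of side M.\<close>

lemma sum_concat_seq_le:
  fixes f :: "nat \<Rightarrow> nat \<Rightarrow> real"
  assumes "\<And>k n. 0 \<le> f k n"
  shows "(\<Sum>m<M. concat_seq f m) \<le> (\<Sum>k<M. \<Sum>n<M. f k n)"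
proof -
  have sub: "prod_decode ` {..<M} \<subseteq> {..<M} \<times> {..<M}"
  proof
    fix x assume "x \<in> prod_decode ` {..<M}"
    then obtain m where m: "m < M" "x = prod_decode m" by auto
    obtain k n where kn: "x = (k, n)" by force
    then have "m = prod_encode (k, n)" using m by (metis prod_decode_inverse)
    then show "x \<in> {..<M} \<times> {..<M}"
      using m kn le_prod_encode_1[of k n] le_prod_encode_2[of n k] by auto
  qed
  have "(\<Sum>m<M. concat_seq f m) = (\<Sum>x\<in>prod_decode ` {..<M}. case x of (k, n) \<Rightarrow> f k n)"
    by (subst sum.reindex) (auto simp: inj_prod_decode concat_seq_def case_prod_beta)
  also have "\<dots> \<le> (\<Sum>x\<in>{..<M} \<times> {..<M}. case x of (k, n) \<Rightarrow> f k n)"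
    using sub assms by (intro sum_mono2) auto
  finally show ?thesis by (simp add: sum.cartesian_product)
qed

text \<open>The triangle inequality for the rows. For p = top, all entries of modulus at least e lie
  in finitely many rows, because the row norms tend to zero, and each row contributes finitely many;
  \<open>?F\<close> contains them.\<close>

lemma ell_concat_seq:
  assumes p: "1 \<le> p" and z: "\<And>k. z k \<in> ell p" and s: "summable (\<lambda>k. ell_norm p (z k))"
  shows "concat_seq z \<in> ell p" "ell_norm p (concat_seq z) \<le> (\<Sum>k. ell_norm p (z k))"
proof -
  let ?C = "\<Sum>k. ell_norm p (z k)"
  have nn: "0 \<le> ell_norm p (z k)" for k using ell_norm_nonneg[OF p z] .
  then have C: "0 \<le> ?C" using s by (intro suminf_nonneg)
  have "concat_seq z \<in> ell p \<and> ell_norm p (concat_seq z) \<le> ?C"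
    using p
  proof (cases rule: exponent_cases)
    case 1
    have le: "\<bar>z k n\<bar> \<le> ell_norm p (z k)" for k n by (rule abs_le_ell_norm[OF p z])
    have "ell_norm p (z k) \<le> ?C" for k
      using sum_le_suminf[OF s, of "{k}"] nn by auto
    then have "\<bar>concat_seq z m\<bar> \<le> ?C" for m
      unfolding concat_seq_def using le order_trans by blast
    moreover have "concat_seq z \<longlonglongrightarrow> 0"
    proof (rule LIMSEQ_I)
      fix e :: real assume e: "0 < e"
      obtain K where K: "\<And>k. k \<ge> K \<Longrightarrow> ell_norm p (z k) < e"
        using LIMSEQ_D[OF summable_LIMSEQ_zero[OF s] e] nn by auto
      have "\<exists>N. \<forall>n\<ge>N. \<bar>z k n\<bar> < e" for k
        using z[of k] 1 LIMSEQ_D[of "z k" 0 e] e by (auto simp: ell_top_iff)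
      then obtain N where N: "\<And>k n. n \<ge> N k \<Longrightarrow> \<bar>z k n\<bar> < e" by metis
      let ?F = "Sigma {..<K} (\<lambda>k. {..<N k})"
      have "finite (prod_encode ` ?F)" by auto
      then obtain M where M: "\<forall>m\<in>prod_encode ` ?F. m < M"
        unfolding finite_nat_set_iff_bounded by (elim exE)
      have "\<bar>concat_seq z m\<bar> < e" if "m \<ge> M" for m
      proof -
        obtain k n where kn: "prod_decode m = (k, n)" by force
        then have m: "m = prod_encode (k, n)" by (metis prod_decode_inverse)
        have "(k, n) \<notin> ?F"
        proof
          assume "(k, n) \<in> ?F"
          then have "m \<in> prod_encode ` ?F" unfolding m by (rule imageI)
          with M have "m < M" by (rule bspec)
          with that show False by simp
        qed
        then have "K \<le> k \<or> N k \<le> n" by auto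
        then show ?thesis using m K[of k] N[of k n] le[of k n] by auto
      qed
      then show "\<exists>M. \<forall>m\<ge>M. norm (concat_seq z m - 0) < e" by auto
    qed
    ultimately show ?thesis using 1 ell_norm_top_leI by (auto simp: ell_top_iff)
  next
    case (2 r)
    have "(\<Sum>m<M. \<bar>concat_seq z m\<bar> powr r) \<le> ?C powr r" for M
    proof -
      have "(\<Sum>m<M. \<bar>concat_seq z m\<bar> powr r) = (\<Sum>m<M. concat_seq (\<lambda>k n. \<bar>z k n\<bar> powr r) m)"
        by (simp add: concat_seq_def)
      also have "\<dots> \<le> (\<Sum>k<M. \<Sum>n<M. \<bar>z k n\<bar> powr r)" by (rule sum_concat_seq_le) simp
      also have "\<dots> \<le> (\<Sum>k<M. ell_norm p (z k) powr r)"
        using sum_le_ell_norm_real 2 z by (intro sum_mono) auto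
      also have "\<dots> \<le> (\<Sum>k<M. ell_norm p (z k)) powr r"
        using 2 nn by (intro sum_powr_le_powr_sum) auto
      also have "\<dots> \<le> ?C powr r"
        using 2 nn s by (intro powr_mono2 sum_nonneg sum_le_suminf) auto
      finally show ?thesis .
    qed
    from ell_realI[OF 2(1) C this] 2(2) show ?thesis by simp
  qed
  then show "concat_seq z \<in> ell p" "ell_norm p (concat_seq z) \<le> ?C" by auto
qed

text \<open>
  For \<open>p = 1\<close> the coefficients in \<^const>\<open>p_co\<close> have to tend to zero, whereas duality only yields bounded
  ones. The factor \<open>w\<close>, essentially the square root of the tail sums, is moved from the sequence to them.
\<close>

lemma ell_1_vanishing_weight:
  assumes a: "a \<in> ell 1" and e: "0 < e"
  shows "\<exists>w. (\<forall>n. 0 < w n \<and> w n \<le> 1) \<and> w \<longlonglongrightarrow> 0 \<and> (\<lambda>n. a n / w n) \<in> ell 1 \<and>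
    ell_norm 1 (\<lambda>n. a n / w n) \<le> ell_norm 1 a + e"
proof -
  have s: "summable (\<lambda>n. \<bar>a n\<bar>)" using a ell_real_iff[of 1 a] by simp
  define t where "t n = (\<Sum>i. \<bar>a (i + n)\<bar>)" for n
  have s': "summable (\<lambda>i. \<bar>a (i + n)\<bar>)" for n
    using s by (simp add: summable_iff_shift[of "\<lambda>n. \<bar>a n\<bar>"])
  have t0: "0 \<le> t n" for n unfolding t_def using s' by (intro suminf_nonneg) auto
  have tS: "t n = \<bar>a n\<bar> + t (Suc n)" for n
    unfolding t_def using suminf_split_head[OF s'[of n]] by simp
  have tlim: "t \<longlonglongrightarrow> 0"
    unfolding t_def using suminf_exist_split2[OF s] by simp
  then obtain N where N: "\<And>n. n \<ge> N \<Longrightarrow> t n \<le> min 1 ((e / 2)\<^sup>2)"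
    using LIMSEQ_D[OF tlim, of "min 1 ((e / 2)\<^sup>2)"] e t0 by (force intro: less_imp_le)
  \<comment> \<open>With the square root, division by \<open>w\<close> leaves a telescoping bound: t
    n - t (n + 1) divided by sqrt (t n) is at most 2 (sqrt (t n) - sqrt (t (n + 1))). Starting at N,
    the total cost is at most 2 sqrt (t N) \<le> e, whence the bound (e / 2)^2 on the tails. The
    maximum with 1 / (n + 1) keeps \<open>w\<close> positive when a tail vanishes.\<close>
  define w where "w n = (if n < N then 1 else max (sqrt (t n)) (1 / real (Suc n)))" for n
  have w1: "w n \<le> 1" for n using N[of n] by (auto simp: w_def not_less)
  have w0: "0 < w n" for n by (auto simp: w_def less_max_iff_disj)
  have "w \<longlonglongrightarrow> 0"
  proof -
    have "(\<lambda>n. max (sqrt (t n)) (1 / real (Suc n))) \<longlonglongrightarrow> max (sqrt 0) 0"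
      by (intro tendsto_max tendsto_real_sqrt tlim LIMSEQ_Suc[OF lim_1_over_n])
    moreover have "eventually (\<lambda>n. max (sqrt (t n)) (1 / real (Suc n)) = w n) sequentially"
      using eventually_ge_at_top[of N] by eventually_elim (simp add: w_def)
    ultimately show ?thesis using Lim_transform_eventually by fastforce
  qed
  moreover have "(\<Sum>n<M. \<bar>a n / w n\<bar>) \<le> ell_norm 1 a + e" for M
  proof -
    have termwise: "\<bar>a n / w n\<bar> \<le> \<bar>a n\<bar> + (if n < N then 0 else 2 * (sqrt (t n) - sqrt (t (Suc n))))" for n
    proof (cases "n < N")
      case False
      have "\<bar>a n\<bar> = sqrt (t n) ^ 2 - sqrt (t (Suc n)) ^ 2" using tS[of n] t0 by simp
      also have "\<dots> = (sqrt (t n) + sqrt (t (Suc n))) * (sqrt (t n) - sqrt (t (Suc n)))"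
        by (simp add: algebra_simps power2_eq_square)
      also have "\<dots> \<le> (2 * sqrt (t n)) * (sqrt (t n) - sqrt (t (Suc n)))"
        using tS[of n] by (intro mult_right_mono) auto
      also have "\<dots> \<le> (2 * w n) * (sqrt (t n) - sqrt (t (Suc n)))"
        using tS[of n] False by (intro mult_right_mono) (auto simp: w_def)
      finally have "\<bar>a n / w n\<bar> \<le> 2 * (sqrt (t n) - sqrt (t (Suc n)))"
        using w0[of n] by (simp add: abs_divide field_simps)
      then show ?thesis using False by simp
    qed (simp add: w_def)
    have tele: "(\<Sum>n<M. if n < N then 0 else 2 * (sqrt (t n) - sqrt (t (Suc n)))) \<le> e"
    proof -
      have "(\<Sum>n<M. if n < N then 0 else 2 * (sqrt (t n) - sqrt (t (Suc n))))
        = (if M \<le> N then 0 else 2 * (sqrt (t N) - sqrt (t M)))"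
        by (induction M) (auto simp: not_less le_Suc_eq dest: le_antisym)
      also have "\<dots> \<le> 2 * sqrt (t N)" using t0 by simp
      also have "\<dots> \<le> e" using N[of N] e real_sqrt_le_mono[of "t N" "(e / 2)\<^sup>2"] by simp
      finally show ?thesis .
    qed
    have "(\<Sum>n<M. \<bar>a n / w n\<bar>)
      \<le> (\<Sum>n<M. \<bar>a n\<bar>) + (\<Sum>n<M. if n < N then 0 else 2 * (sqrt (t n) - sqrt (t (Suc n))))"
      unfolding sum.distrib[symmetric] by (intro sum_mono termwise)
    also have "\<dots> \<le> ell_norm 1 a + e"
      using tele sum_le_ell_norm_real[of 1 a "{..<M}"] a ell_norm_nonneg[of 1 a] by simp
    finally show ?thesis .
  qed
  then have "(\<lambda>n. a n / w n) \<in> ell 1 \<and> ell_norm 1 (\<lambda>n. a n / w n) \<le> ell_norm 1 a + e"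
    using ell_realI[of 1 "ell_norm 1 a + e" "\<lambda>n. a n / w n"] ell_norm_nonneg[of 1 a] a e
    by (simp add: powr_one)
  ultimately show ?thesis using w0 w1 by blast
qed

section \<open>The unit ball of the dual of \<open>ell p\<close>\<close>

text \<open>
  This is the unit ball of \<open>\<ell>\<^sub>p'\<close>, with \<open>\<ell>\<^sub>\<infinity>\<close> instead of \<open>c\<^sub>0\<close> for \<open>p = 1\<close>. Testing on partial sums
  avoids the junk value of \<^const>\<open>suminf\<close> on divergent series.
\<close>

definition dual_ball :: "ennreal \<Rightarrow> (nat \<Rightarrow> real) set"
  where "dual_ball p = {\<alpha>. \<forall>b\<in>ell p. \<forall>N. (\<Sum>n<N. \<bar>\<alpha> n\<bar> * \<bar>b n\<bar>) \<le> ell_norm p b}"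

lemma dual_ballD: "\<alpha> \<in> dual_ball p \<Longrightarrow> b \<in> ell p \<Longrightarrow> (\<Sum>n<N. \<bar>\<alpha> n\<bar> * \<bar>b n\<bar>) \<le> ell_norm p b"
  by (auto simp: dual_ball_def)

lemma dual_ball_summable:
  assumes "\<alpha> \<in> dual_ball p" "b \<in> ell p"
  shows "summable (\<lambda>n. \<bar>\<alpha> n\<bar> * \<bar>b n\<bar>)" "(\<Sum>n. \<bar>\<alpha> n\<bar> * \<bar>b n\<bar>) \<le> ell_norm p b"
proof -
  show *: "summable (\<lambda>n. \<bar>\<alpha> n\<bar> * \<bar>b n\<bar>)"
    by (rule summableI_nonneg_bounded[where x = "ell_norm p b"]) (use dual_ballD[OF assms] in auto)
  show "(\<Sum>n. \<bar>\<alpha> n\<bar> * \<bar>b n\<bar>) \<le> ell_norm p b"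
    by (rule suminf_le_const[OF *]) (use dual_ballD[OF assms] in auto)
qed

lemma dual_ball_abs_le_1:
  assumes "1 \<le> p" "\<alpha> \<in> dual_ball p"
  shows "\<bar>\<alpha> n\<bar> \<le> 1"
proof -
  let ?b = "\<lambda>m. if m = n then 1 else 0 :: real"
  have z: "?b m = 0" if "m \<ge> Suc n" for m using that by auto
  note b = ell_finite_support[OF assms(1), of "Suc n" ?b, OF z]
  have "(\<Sum>m<Suc n. \<bar>\<alpha> m\<bar> * \<bar>?b m\<bar>) \<le> (\<Sum>m<Suc n. \<bar>?b m\<bar>)"
    using dual_ballD[OF assms(2) b(1)] b(2) by (rule order_trans)
  then show ?thesis by simp
qed

text \<open>Row k is tested against row k of b, whose norm is at most that of b. So it contributes
  at most w k times \<open>ell_norm p b\<close>, and a total weight of at most 1 suffices for every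
  p.\<close>

lemma dual_ball_concat_seq:
  assumes p: "1 \<le> p" and \<alpha>: "\<And>k. \<alpha> k \<in> dual_ball p"
    and w: "\<And>k. 0 \<le> w k" "summable w" "suminf w \<le> 1"
  shows "concat_seq (\<lambda>k n. w k * \<alpha> k n) \<in> dual_ball p"
  unfolding dual_ball_def
proof (intro CollectI ballI allI)
  fix b N assume b: "b \<in> ell p"
  let ?b = "\<lambda>k n. b (prod_encode (k, n))"
  have inj: "inj (\<lambda>n. prod_encode (k, n))" for k by (auto intro: injI)
  have eq: "concat_seq ?b = b" by (simp add: concat_seq_def fun_eq_iff)
  have "(\<Sum>m<N. \<bar>concat_seq (\<lambda>k n. w k * \<alpha> k n) m\<bar> * \<bar>b m\<bar>)
    = (\<Sum>m<N. concat_seq (\<lambda>k n. w k * (\<bar>\<alpha> k n\<bar> * \<bar>?b k n\<bar>)) m)"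
    by (simp add: concat_seq_def abs_mult w ac_simps)
  also have "\<dots> \<le> (\<Sum>k<N. \<Sum>n<N. w k * (\<bar>\<alpha> k n\<bar> * \<bar>?b k n\<bar>))"
    by (rule sum_concat_seq_le) (simp add: w)
  also have "\<dots> \<le> (\<Sum>k<N. w k * ell_norm p b)"
    unfolding sum_distrib_left[symmetric]
  proof (intro sum_mono mult_left_mono w)
    fix k
    show "(\<Sum>n<N. \<bar>\<alpha> k n\<bar> * \<bar>?b k n\<bar>) \<le> ell_norm p b"
      using dual_ballD[OF \<alpha> ell_inj_reindex(1)[OF p b inj]] ell_inj_reindex(2)[OF p b inj]
      by (rule order_trans)
  qed
  also have "\<dots> = (\<Sum>k<N. w k) * ell_norm p b" by (simp add: sum_distrib_right)
  also have "\<dots> \<le> 1 * ell_norm p b"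
    using sum_le_suminf[OF w(2), of "{..<N}"] w ell_norm_nonneg[OF p b]
    by (intro mult_right_mono) auto
  finally show "(\<Sum>m<N. \<bar>concat_seq (\<lambda>k n. w k * \<alpha> k n) m\<bar> * \<bar>b m\<bar>) \<le> ell_norm p b" by simp
qed

section \<open>Conjugate exponents, the Hoelder inequality and its converse\<close>

lemma conj_exponent_top: "conj_exponent top = 1"
  by (simp add: conj_exponent_def)

lemma conj_exponent_1: "conj_exponent 1 = top"
  by (simp add: conj_exponent_def)

lemma conj_exponent_real:
  assumes "1 < r"
  shows "conj_exponent (ennreal r) = ennreal (r / (r - 1))"
proof -
  have "1 - inverse (ennreal r) = ennreal (1 - inverse r)"
    using assms by (simp add: inverse_ennreal ennreal_minus flip: ennreal_1)
  then show ?thesis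
    using assms by (simp add: conj_exponent_def inverse_ennreal divide_simps)
qed

lemma conj_exponent_ge_1:
  assumes "1 \<le> p"
  shows "1 \<le> conj_exponent p"
  using assms
proof (cases rule: exponent_cases)
  case (2 r)
  show ?thesis
  proof (cases "r = 1")
    case False
    then have "1 < r" using 2 by simp
    then show ?thesis using 2 by (simp add: conj_exponent_real)
  qed (use 2 conj_exponent_1 in simp)
qed (simp add: conj_exponent_top)

text \<open>The Hoelder inequality for partial sums. For 1 < p < top it results from summing Young's
  inequality for the coefficients and the normalised entries of b.\<close>

lemma unit_ball_conj_subset_dual_ball:
  assumes p: "1 \<le> p" and \<alpha>: "\<alpha> \<in> ell (conj_exponent p)" and le: "ell_norm (conj_exponent p) \<alpha> \<le> 1"
  shows "\<alpha> \<in> dual_ball p"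
  unfolding dual_ball_def
proof (intro CollectI ballI allI)
  fix b N assume b: "b \<in> ell p"
  let ?B = "ell_norm p b"
  have B: "0 \<le> ?B" by (rule ell_norm_nonneg[OF p b])
  consider "p = top" | "p = 1" | r where "1 < r" "p = ennreal r"
    using p by (cases rule: exponent_cases) (auto simp: le_less)
  then show "(\<Sum>n<N. \<bar>\<alpha> n\<bar> * \<bar>b n\<bar>) \<le> ?B"
  proof cases
    case 1
    have "(\<Sum>n<N. \<bar>\<alpha> n\<bar> * \<bar>b n\<bar>) \<le> (\<Sum>n<N. \<bar>\<alpha> n\<bar> * ?B)"
      using abs_le_ell_norm[OF p b] by (intro sum_mono mult_left_mono) auto
    also have "\<dots> = (\<Sum>n<N. \<bar>\<alpha> n\<bar>) * ?B" by (simp add: sum_distrib_right)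
    also have "\<dots> \<le> 1 * ?B"
      using sum_le_ell_norm_real[of 1 \<alpha> "{..<N}"] \<alpha> le 1 ell_norm_nonneg[of 1 \<alpha>] B
      by (intro mult_right_mono) (auto simp: conj_exponent_top)
    finally show ?thesis by simp
  next
    case 2
    have "\<bar>\<alpha> n\<bar> \<le> 1" for n
      using abs_le_ell_norm[OF conj_exponent_ge_1[OF p] \<alpha>, of n] le by linarith
    then have "(\<Sum>n<N. \<bar>\<alpha> n\<bar> * \<bar>b n\<bar>) \<le> (\<Sum>n<N. \<bar>b n\<bar>)"
      by (intro sum_mono) (simp add: mult_left_le_one_le)
    also have "\<dots> \<le> ?B" using sum_le_ell_norm_real[of 1 b "{..<N}"] b B 2 by simp
    finally show ?thesis .
  next
    case (3 r)
    define s where "s = r / (r - 1)"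
    have s: "1 < s" "1 / r + 1 / s = 1" using 3 by (auto simp: s_def field_simps)
    have q: "conj_exponent p = ennreal s" using 3 by (simp add: conj_exponent_real s_def)
    show ?thesis
    proof (cases "?B = 0")
      case True
      then have "b n = 0" for n using abs_le_ell_norm[OF p b, of n] by simp
      then show ?thesis using True by simp
    next
      case False
      then have B: "0 < ?B" using B by simp
      have sa: "(\<Sum>n<N. \<bar>\<alpha> n\<bar> powr s) \<le> 1"
      proof -
        have "(\<Sum>n<N. \<bar>\<alpha> n\<bar> powr s) \<le> ell_norm (conj_exponent p) \<alpha> powr s"
          using sum_le_ell_norm_real[of s \<alpha> "{..<N}"] \<alpha> s q by simp
        also have "\<dots> \<le> 1 powr s"
          using le ell_norm_nonneg[OF conj_exponent_ge_1[OF p] \<alpha>] s by (intro powr_mono2) auto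
        finally show ?thesis by simp
      qed
      have sb: "(\<Sum>n<N. \<bar>b n\<bar> powr r) / ?B powr r \<le> 1"
        using sum_le_ell_norm_real[of r b "{..<N}"] b 3 B by simp
      have "(\<Sum>n<N. \<bar>\<alpha> n\<bar> * (\<bar>b n\<bar> / ?B)) \<le> (\<Sum>n<N. \<bar>\<alpha> n\<bar> powr s / s + (\<bar>b n\<bar> / ?B) powr r / r)"
        by (intro sum_mono Youngs_inequality) (use s 3 B in auto)
      also have "\<dots> = (\<Sum>n<N. \<bar>\<alpha> n\<bar> powr s) / s + ((\<Sum>n<N. \<bar>b n\<bar> powr r) / ?B powr r) / r"
        using B by (simp add: sum.distrib sum_divide_distrib powr_divide)
      also have "\<dots> \<le> 1 / s + 1 / r"
        using sa sb s 3 by (intro add_mono divide_right_mono) auto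
      also have "\<dots> = 1" using s by simp
      finally have "(\<Sum>n<N. \<bar>\<alpha> n\<bar> * \<bar>b n\<bar>) / ?B \<le> 1" by (simp add: sum_divide_distrib)
      then show ?thesis using B by (simp add: field_simps)
    qed
  qed
qed

text \<open>Test with the extremal sequence |\<alpha> n| powr (s - 1), cut off at N. The partial sum
  S of the s-th powers satisfies S \<le> S powr (1 / r) with r > 1, so S \<le> 1. For p = 1
  membership may fail: elements of \<open>dual_ball 1\<close> are merely bounded, and
  \<open>conj_exponent 1\<close> asks for null sequences.\<close>

lemma dual_ball_subset_unit_ball_conj:
  assumes p: "1 \<le> p" "p \<noteq> 1" and \<alpha>: "\<alpha> \<in> dual_ball p"
  shows "\<alpha> \<in> ell (conj_exponent p)" "ell_norm (conj_exponent p) \<alpha> \<le> 1"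
proof -
  have "\<alpha> \<in> ell (conj_exponent p) \<and> ell_norm (conj_exponent p) \<alpha> \<le> 1"
    using p(1)
  proof (cases rule: exponent_cases)
    case 1
    have "(\<Sum>n<N. \<bar>\<alpha> n\<bar>) \<le> 1" for N
    proof -
      let ?b = "\<lambda>n. if n < N then 1 else 0 :: real"
      have b: "?b \<in> ell p" by (rule ell_finite_support(1)[of _ N]) (use p in auto)
      have "(\<Sum>n<N. \<bar>\<alpha> n\<bar>) = (\<Sum>n<N. \<bar>\<alpha> n\<bar> * \<bar>?b n\<bar>)" by simp
      also have "\<dots> \<le> ell_norm p ?b" by (rule dual_ballD[OF \<alpha> b])
      also have "\<dots> \<le> 1" unfolding 1 by (rule ell_norm_top_leI) simp
      finally show ?thesis .
    qed
    then show ?thesis using ell_realI[of 1 1 \<alpha>] 1 by (simp add: conj_exponent_top)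
  next
    case (2 r)
    then have r: "1 < r" using p by (cases "r = 1") auto
    define s where "s = r / (r - 1)"
    have s: "1 < s" "(s - 1) * r = s" using r by (auto simp: s_def field_simps)
    have q: "conj_exponent p = ennreal s" using 2 r by (simp add: conj_exponent_real s_def)
    have "(\<Sum>n<N. \<bar>\<alpha> n\<bar> powr s) \<le> 1" for N
    proof -
      let ?b = "\<lambda>n. if n < N then \<bar>\<alpha> n\<bar> powr (s - 1) else 0"
      let ?S = "\<Sum>n<N. \<bar>\<alpha> n\<bar> powr s"
      have S: "0 \<le> ?S" by (intro sum_nonneg) auto
      have b: "?b \<in> ell p" by (rule ell_finite_support(1)[of _ N]) (use p in auto)
      have split: "z powr s = z * z powr (s - 1)" if "0 \<le> z" for z :: real
        using that powr_add[of z 1 "s - 1"] by (cases "z = 0") auto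
      have "?S = (\<Sum>n<N. \<bar>\<alpha> n\<bar> * \<bar>?b n\<bar>)" by (simp add: split)
      also have "\<dots> \<le> ell_norm p ?b" by (rule dual_ballD[OF \<alpha> b])
      also have "\<dots> \<le> ?S powr (1 / r)"
        unfolding 2
      proof (rule ell_realI)
        fix M
        have "(\<Sum>n<M. \<bar>?b n\<bar> powr r) = (\<Sum>n\<in>{..<M} \<inter> {..<N}. \<bar>\<alpha> n\<bar> powr s)"
          using r by (intro sum.mono_neutral_cong_right) (auto simp: powr_powr s)
        also have "\<dots> \<le> ?S" by (intro sum_mono2) auto
        finally show "(\<Sum>n<M. \<bar>?b n\<bar> powr r) \<le> (?S powr (1 / r)) powr r"
          using r S by (simp add: powr_powr)
      qed (use 2 in auto)
      finally have le: "?S \<le> ?S powr (1 / r)" .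
      show ?thesis
      proof (rule ccontr)
        assume "\<not> ?thesis"
        then have "?S powr (1 / r) < ?S powr 1" using r by (intro powr_less_mono) auto
        then show False using le S by simp
      qed
    qed
    then show ?thesis using ell_realI[of s 1 \<alpha>] s q by simp
  qed
  then show "\<alpha> \<in> ell (conj_exponent p)" "ell_norm (conj_exponent p) \<alpha> \<le> 1" by auto
qed

section \<open>Hulls with coefficients in the dual ball\<close>

text \<open>For p \<ge> 1 this differs from \<open>p_co p s x\<close> only if p = 1, where the
  coefficients are bounded instead of null.\<close>

definition dual_hull ::
  "ennreal \<Rightarrow> ('k::real_normed_field \<Rightarrow> 'a \<Rightarrow> 'a) \<Rightarrow> (nat \<Rightarrow> 'a::real_normed_vector) \<Rightarrow> 'a set"
  where "dual_hull p s x =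
    {y. \<exists>\<alpha>. (\<lambda>n. norm (\<alpha> n)) \<in> dual_ball p \<and> (\<lambda>n. s (\<alpha> n) (x n)) sums y}"

lemma (in banach_over) dual_ball_abs_summable:
  assumes "(\<lambda>n. norm (\<alpha> n)) \<in> dual_ball p" "(\<lambda>n. norm (x n)) \<in> ell p"
  shows "summable (\<lambda>n. norm (scale (\<alpha> n) (x n)))"
    and "norm (\<Sum>n. scale (\<alpha> n) (x n)) \<le> ell_norm p (\<lambda>n. norm (x n))"
proof -
  show s: "summable (\<lambda>n. norm (scale (\<alpha> n) (x n)))"
    using dual_ball_summable(1)[OF assms] by (simp add: norm_scale)
  have "norm (\<Sum>n. scale (\<alpha> n) (x n)) \<le> (\<Sum>n. norm (scale (\<alpha> n) (x n)))"
    by (rule summable_norm[OF s])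
  also have "\<dots> \<le> ell_norm p (\<lambda>n. norm (x n))"
    using dual_ball_summable(2)[OF assms] by (simp add: norm_scale)
  finally show "norm (\<Sum>n. scale (\<alpha> n) (x n)) \<le> ell_norm p (\<lambda>n. norm (x n))" .
qed

lemma p_co_subset_dual_hull: "1 \<le> p \<Longrightarrow> p_co p s x \<subseteq> dual_hull p s x"
  unfolding p_co_def dual_hull_def using unit_ball_conj_subset_dual_ball by blast

text \<open>For p = 1 the coefficients are multiplied by a vanishing weight and the entries divided
  by it. Taking each y n to be a multiple of x n keeps the new sequence in the carrier subspace, for
  instance the scalar-linear functionals.\<close>

lemma dual_hull_subset_p_co:
  assumes p: "1 \<le> p" and s: "banach_over s" and x: "(\<lambda>n. norm (x n)) \<in> ell p" and e: "0 < e"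
  shows "\<exists>y. (\<forall>n. \<exists>c. y n = s c (x n)) \<and> (\<lambda>n. norm (y n)) \<in> ell p \<and>
    ell_norm p (\<lambda>n. norm (y n)) \<le> ell_norm p (\<lambda>n. norm (x n)) + e \<and> dual_hull p s x \<subseteq> p_co p s y"
proof -
  interpret banach_over s by fact
  show ?thesis
  proof (cases "p = 1")
    case False
    have "dual_hull p s x \<subseteq> p_co p s x"
      unfolding p_co_def dual_hull_def
      using dual_ball_subset_unit_ball_conj[OF p False] by blast
    moreover have "x n = s 1 (x n)" for n by simp
    ultimately show ?thesis using x e by (intro exI[of _ x]) (auto intro: exI[of _ 1])
  next
    case True
    obtain w where w: "\<And>n. 0 < w n" "\<And>n. w n \<le> 1" "w \<longlonglongrightarrow> 0" "(\<lambda>n. norm (x n) / w n) \<in> ell 1"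
      "ell_norm 1 (\<lambda>n. norm (x n) / w n) \<le> ell_norm 1 (\<lambda>n. norm (x n)) + e"
      using ell_1_vanishing_weight[OF x[unfolded True] e] by blast
    define y where "y n = s (of_real (1 / w n)) (x n)" for n
    have ny: "(\<lambda>n. norm (y n)) = (\<lambda>n. norm (x n) / w n)"
      using w(1) by (simp add: y_def norm_scale norm_divide fun_eq_iff less_imp_le)
    have "dual_hull p s x \<subseteq> p_co p s y"
    proof
      fix z assume "z \<in> dual_hull p s x"
      then obtain \<alpha> where \<alpha>: "(\<lambda>n. norm (\<alpha> n)) \<in> dual_ball p" "(\<lambda>n. s (\<alpha> n) (x n)) sums z"
        by (auto simp: dual_hull_def)
      define \<beta> where "\<beta> n = of_real (w n) * \<alpha> n" for n
      have eq: "s (\<beta> n) (y n) = s (\<alpha> n) (x n)" for n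
        using w(1)[of n] by (simp add: \<beta>_def y_def field_simps)
      have \<alpha>1: "norm (\<alpha> n) \<le> 1" for n using dual_ball_abs_le_1[OF p \<alpha>(1), of n] by simp
      have \<beta>w: "norm (\<beta> n) \<le> w n" for n
        using \<alpha>1[of n] w(1)[of n] by (simp add: \<beta>_def norm_mult mult_left_le)
      have "(\<lambda>n. norm (\<beta> n)) \<longlonglongrightarrow> 0"
        by (rule Lim_null_comparison[OF _ w(3)]) (simp add: \<beta>w)
      moreover have "ell_norm top (\<lambda>n. norm (\<beta> n)) \<le> 1"
        by (rule ell_norm_top_leI) (simp add: order_trans[OF \<beta>w w(2)])
      ultimately show "z \<in> p_co p s y"
        using \<alpha>(2) eq by (auto simp: p_co_def True conj_exponent_1 ell_top_iff intro!: exI[of _ \<beta>])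
    qed
    then show ?thesis using w ny True by (intro exI[of _ y]) (auto simp: y_def)
  qed
qed

section \<open>Operators on carrier subspaces\<close>

definition scale_subspace :: "('k \<Rightarrow> 'a \<Rightarrow> 'a) \<Rightarrow> 'a::real_vector set \<Rightarrow> bool"
  where "scale_subspace s V \<longleftrightarrow> 0 \<in> V \<and> (\<forall>x\<in>V. \<forall>y\<in>V. x + y \<in> V) \<and> (\<forall>c. \<forall>x\<in>V. s c x \<in> V)"

lemma scale_subspace_UNIV: "scale_subspace s UNIV"
  by (simp add: scale_subspace_def)

lemma bounded_operators_0:
  assumes "T \<in> bounded_operators s V t W" "scale_subspace s V"
  shows "T 0 = 0"
proof -
  have "T (0 + 0) = T 0 + T 0" using assms unfolding bounded_operators_def scale_subspace_def by blast
  then show ?thesis by simp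
qed

lemma op_norm_leI:
  assumes "scale_subspace s V" "\<And>v. v \<in> V \<Longrightarrow> norm v \<le> 1 \<Longrightarrow> norm (T v) \<le> C"
  shows "op_norm V T \<le> C"
  unfolding op_norm_def
  by (rule cSUP_least) (use assms in \<open>auto simp: scale_subspace_def intro!: exI[of _ 0]\<close>)

lemma op_norm_nonneg:
  assumes T: "T \<in> bounded_operators s V t W" and V: "scale_subspace s V"
  shows "0 \<le> op_norm V T"
proof -
  obtain C where C: "\<forall>v\<in>V. norm (T v) \<le> C * norm v" using T by (auto simp: bounded_operators_def)
  have "norm (T v) \<le> \<bar>C\<bar>" if v: "v \<in> V" "norm v \<le> 1" for v
  proof -
    have "norm (T v) \<le> C * norm v" using C v(1) by (rule bspec)
    also have "\<dots> \<le> \<bar>C\<bar> * 1" using v by (intro mult_mono) auto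
    finally show ?thesis by simp
  qed
  then have "bdd_above ((\<lambda>v. norm (T v)) ` {v\<in>V. norm v \<le> 1})"
    by (auto intro!: bdd_aboveI)
  then have "norm (T 0) \<le> op_norm V T"
    unfolding op_norm_def by (rule cSUP_upper[rotated]) (use V in \<open>simp add: scale_subspace_def\<close>)
  then show ?thesis using norm_ge_zero order_trans by blast
qed

lemma norm_le_op_norm:
  assumes T: "T \<in> bounded_operators s V t W" and V: "scale_subspace s V"
    and s: "banach_over s" and t: "banach_over t" and v: "v \<in> V"
  shows "norm (T v) \<le> op_norm V T * norm v"
proof -
  interpret s: banach_over s by fact
  interpret t: banach_over t by fact
  obtain C where "\<forall>x\<in>V. norm (T x) \<le> C * norm x"
    using T by (auto simp: bounded_operators_def)
  then have C: "norm (T x) \<le> C * norm x" if "x \<in> V" for x using that by (rule bspec)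
  have "norm (T x) \<le> \<bar>C\<bar>" if "x \<in> V" "norm x \<le> 1" for x
  proof -
    have "norm (T x) \<le> C * norm x" by (rule C[OF that(1)])
    also have "\<dots> \<le> \<bar>C\<bar> * 1" using that by (intro mult_mono) auto
    finally show ?thesis by simp
  qed
  then have bdd: "bdd_above ((\<lambda>x. norm (T x)) ` {x\<in>V. norm x \<le> 1})"
    by (auto intro!: bdd_aboveI)
  show ?thesis
  proof (cases "v = 0")
    case True
    then show ?thesis using bounded_operators_0[OF T V] by simp
  next
    case False
    let ?v = "s (of_real (inverse (norm v))) v"
    have "?v \<in> V" using V v by (auto simp: scale_subspace_def)
    moreover have "norm ?v \<le> 1" using False by (simp add: s.norm_scale norm_inverse)
    ultimately have "norm (T ?v) \<le> op_norm V T"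
      unfolding op_norm_def by (intro cSUP_upper[OF _ bdd]) auto
    moreover have "T ?v = t (of_real (inverse (norm v))) (T v)"
      using T v by (auto simp: bounded_operators_def)
    ultimately have "norm (T v) / norm v \<le> op_norm V T"
      by (simp add: t.norm_scale norm_inverse divide_inverse mult.commute)
    then show ?thesis using False by (simp add: field_simps)
  qed
qed

lemma banach_over_mult: "banach_over ((*) :: 'k \<Rightarrow> 'k \<Rightarrow> 'k::{real_normed_field,euclidean_space})"
  by unfold_locales (auto simp: algebra_simps norm_mult scaleR_conv_of_real)

section \<open>Functionals dominated by an \<open>ell p\<close>-norm\<close>

lemma linear_functional_on_truncation:
  fixes f :: "(nat \<Rightarrow> 'k::{real_normed_field,euclidean_space}) \<Rightarrow> real"
  assumes f: "linear f" and \<alpha>: "\<And>n c. f (\<lambda>m. if m = n then c else 0) = (c * \<alpha> n) \<bullet> 1"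
  shows "f (\<lambda>n. if n < N then a n else 0) = (\<Sum>n<N. (a n * \<alpha> n) \<bullet> 1)"
proof (induction N)
  case 0
  then show ?case using linear_0[OF f] by (simp add: zero_fun_def)
next
  case (Suc N)
  have "(\<lambda>n. if n < Suc N then a n else 0)
    = (\<lambda>n. if n < N then a n else 0) + (\<lambda>m. if m = N then a N else 0)"
    by (auto simp: fun_eq_iff less_Suc_eq)
  then show ?case by (simp add: linear_add[OF f] Suc \<alpha>)
qed

text \<open>The assignment sending (\<phi> n v) to g v is well defined and contractive for the
  \<open>ell p\<close> norm, so it extends to a functional on all sequences. Its values on unit
  vectors are the coefficients \<alpha> n; norm-small tails show that they determine it.\<close>

lemma functional_dominated_by_ell_norm:
  fixes \<phi> :: "nat \<Rightarrow> 'v::real_normed_vector \<Rightarrow> 'k::{real_normed_field,euclidean_space}" and g :: "'v \<Rightarrow> 'k"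
  assumes p: "1 \<le> p" and V: "scale_subspace s V"
    and \<phi>: "\<And>n. \<phi> n \<in> functionals s V" and g: "g \<in> functionals s V"
    and ell: "\<And>v. v \<in> V \<Longrightarrow> (\<lambda>n. norm (\<phi> n v)) \<in> ell p"
    and le: "\<And>v. v \<in> V \<Longrightarrow> norm (g v) \<le> ell_norm p (\<lambda>n. norm (\<phi> n v))"
  shows "\<exists>\<alpha>. (\<lambda>n. norm (\<alpha> n)) \<in> dual_ball p \<and> (\<forall>v\<in>V. (\<lambda>n. \<alpha> n * \<phi> n v) sums g v)"
proof -
  have addV: "x + y \<in> V" if "x \<in> V" "y \<in> V" for x y using V that by (auto simp: scale_subspace_def)
  have scaleV: "s c x \<in> V" if "x \<in> V" for c x using V that by (auto simp: scale_subspace_def)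
  have V0: "0 \<in> V" using V by (auto simp: scale_subspace_def)
  have \<phi>_add: "\<phi> n (x + y) = \<phi> n x + \<phi> n y" if "x \<in> V" "y \<in> V" for n x y
    using \<phi>[of n] that by (auto simp: bounded_operators_def)
  have \<phi>_scale: "\<phi> n (s c x) = c * \<phi> n x" if "x \<in> V" for n c x
    using \<phi>[of n] that by (auto simp: bounded_operators_def)
  have g_add: "g (x + y) = g x + g y" if "x \<in> V" "y \<in> V" for x y
    using g that by (auto simp: bounded_operators_def)
  have g_scale: "g (s c x) = c * g x" if "x \<in> V" for c x
    using g that by (auto simp: bounded_operators_def)
  let ?X = "{a :: nat \<Rightarrow> 'k. (\<lambda>n. norm (a n)) \<in> ell p}"
  let ?\<phi> = "\<lambda>v n. \<phi> n v"
  have add_ell: "(\<lambda>n. norm (a n + b n)) \<in> ell p"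
    "ell_norm p (\<lambda>n. norm (a n + b n)) \<le> ell_norm p (\<lambda>n. norm (a n)) + ell_norm p (\<lambda>n. norm (b n))"
    if "a \<in> ?X" "b \<in> ?X" for a b :: "nat \<Rightarrow> 'k"
  proof -
    have ab: "(\<lambda>n. norm (a n)) \<in> ell p" "(\<lambda>n. norm (b n)) \<in> ell p" using that by auto
    have m: "\<bar>norm (a n + b n)\<bar> \<le> \<bar>norm (a n) + norm (b n)\<bar>" for n
      using norm_triangle_ineq[of "a n" "b n"] by simp
    show "(\<lambda>n. norm (a n + b n)) \<in> ell p" by (rule ell_mono(1)[OF p ell_add(1)[OF p ab] m])
    show "ell_norm p (\<lambda>n. norm (a n + b n)) \<le> ell_norm p (\<lambda>n. norm (a n)) + ell_norm p (\<lambda>n. norm (b n))"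
      using ell_mono(2)[OF p ell_add(1)[OF p ab] m] ell_add(2)[OF p ab] by linarith
  qed
  have scale_ell: "(\<lambda>n. norm (r *\<^sub>R a n)) \<in> ell p"
    "ell_norm p (\<lambda>n. norm (r *\<^sub>R a n)) \<le> \<bar>r\<bar> * ell_norm p (\<lambda>n. norm (a n))"
    if "a \<in> ?X" for a :: "nat \<Rightarrow> 'k" and r
    using ell_cmult[OF p, of "\<lambda>n. norm (a n)" "\<bar>r\<bar>"] that by auto
  have minus_ell: "(\<lambda>n. a n - b n) \<in> ?X" if "a \<in> ?X" "b \<in> ?X" for a b :: "nat \<Rightarrow> 'k"
    using add_ell(1)[of a "\<lambda>n. - b n"] that by simp
  have \<phi>X: "?\<phi> v \<in> ?X" if "v \<in> V" for v using ell[OF that] by simp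
  have subX: "subspace ?X"
    using add_ell(1) scale_ell(1) ell_finite_support(1)[OF p, of 0 "\<lambda>n. 0"]
    by (auto simp: subspace_def)
  \<comment> \<open>The infimal convolution of the norm with the real part of g along the sequences
    \<phi> v. A minorant lies below the norm (take v = 0) and below the real part of g v at \<phi> v
    (take the same v); using -v as well gives equality there.\<close>
  let ?S = "\<lambda>a t. \<exists>v\<in>V. ell_norm p (\<lambda>n. norm (a n - \<phi> n v)) + g v \<bullet> 1 \<le> t"
  obtain f where f: "linear f" "\<And>a t. a \<in> ?X \<Longrightarrow> ?S a t \<Longrightarrow> f a \<le> t"
  proof (rule linear_minorant_of_cone_on_subspace[OF subX, of ?S])
    fix a b s t assume ab: "a \<in> ?X" "b \<in> ?X" and "?S a s" "?S b t"
    then obtain v w where v: "v \<in> V" "ell_norm p (\<lambda>n. norm (a n - \<phi> n v)) + g v \<bullet> 1 \<le> s"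
      and w: "w \<in> V" "ell_norm p (\<lambda>n. norm (b n - \<phi> n w)) + g w \<bullet> 1 \<le> t" by blast
    have "ell_norm p (\<lambda>n. norm ((a + b) n - \<phi> n (v + w)))
      = ell_norm p (\<lambda>n. norm ((a n - \<phi> n v) + (b n - \<phi> n w)))"
      by (simp add: \<phi>_add v w algebra_simps)
    also have "\<dots> \<le> ell_norm p (\<lambda>n. norm (a n - \<phi> n v)) + ell_norm p (\<lambda>n. norm (b n - \<phi> n w))"
      by (rule add_ell(2)) (intro minus_ell ab \<phi>X v w)+
    finally show "?S (a + b) (s + t)"
      using v w by (intro bexI[of _ "v + w"] addV) (auto simp: g_add inner_add_left)
  next
    fix a t and r :: real assume a: "a \<in> ?X" and "?S a t" and r: "0 < r"
    then obtain v where v: "v \<in> V" "ell_norm p (\<lambda>n. norm (a n - \<phi> n v)) + g v \<bullet> 1 \<le> t" by blast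
    have "ell_norm p (\<lambda>n. norm ((r *\<^sub>R a) n - \<phi> n (s (of_real r) v)))
      = ell_norm p (\<lambda>n. norm (r *\<^sub>R (a n - \<phi> n v)))"
      by (simp add: \<phi>_scale v scaleR_conv_of_real right_diff_distrib)
    also have "\<dots> \<le> r * ell_norm p (\<lambda>n. norm (a n - \<phi> n v))"
      using scale_ell(2)[OF minus_ell[OF a \<phi>X[OF v(1)]], of r] r by simp
    finally have "ell_norm p (\<lambda>n. norm ((r *\<^sub>R a) n - \<phi> n (s (of_real r) v))) + g (s (of_real r) v) \<bullet> 1
      \<le> r * (ell_norm p (\<lambda>n. norm (a n - \<phi> n v)) + g v \<bullet> 1)"
      by (simp add: g_scale v scaleR_conv_of_real[symmetric] distrib_left)
    also have "\<dots> \<le> r * t" using v r by simp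
    finally show "?S (r *\<^sub>R a) (r * t)" using scaleV[OF v(1)] by blast
  next
    fix t assume "?S 0 t"
    then obtain v where v: "v \<in> V" "ell_norm p (\<lambda>n. norm (\<phi> n v)) + g v \<bullet> 1 \<le> t" by auto
    show "0 \<le> t" using v le[OF v(1)] inner_one_le_norm[of "- g v"] by simp
  next
    fix a
    show "\<exists>t. ?S a t" using V0 by blast
  next
    fix f assume "linear f" "\<And>a t. a \<in> ?X \<Longrightarrow> ?S a t \<Longrightarrow> f a \<le> t"
    then show thesis by (rule that)
  qed
  have g0: "g 0 = 0" and \<phi>0: "\<phi> n 0 = 0" for n
    using bounded_operators_0[OF _ V] g \<phi> by auto
  have f_le: "f a \<le> ell_norm p (\<lambda>n. norm (a n))" if "a \<in> ?X" for a
    by (rule f(2)[OF that], rule bexI[OF _ V0]) (simp add: g0 \<phi>0)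
  have ell0: "ell_norm p (\<lambda>n. 0) = 0"
    using ell_finite_support[OF p, of 0 "\<lambda>n. 0"] ell_norm_nonneg[OF p, of "\<lambda>n. 0"] by simp
  have f\<phi>_le: "f (?\<phi> v) \<le> g v \<bullet> 1" if "v \<in> V" for v
    by (rule f(2)[OF \<phi>X[OF that]], rule bexI[OF _ that]) (simp add: ell0)
  have f\<phi>: "f (?\<phi> v) = g v \<bullet> 1" if "v \<in> V" for v
  proof -
    have "?\<phi> (s (- 1) v) = - ?\<phi> v" by (simp add: \<phi>_scale that fun_eq_iff)
    then have "- f (?\<phi> v) \<le> - (g v \<bullet> 1)"
      using f\<phi>_le[OF scaleV[OF that, of "- 1"]] linear_neg[OF f(1), of "?\<phi> v"] by (simp add: g_scale that)
    then show ?thesis using f\<phi>_le[OF that] by simp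
  qed
  have "\<exists>a. \<forall>c. f (\<lambda>m. if m = n then c else 0) = (c * a) \<bullet> 1" for n
  proof (rule linear_functional_as_inner_mult_one, rule linearI)
    fix c d :: 'k and r :: real
    have "(\<lambda>m. if m = n then c + d else 0) = (\<lambda>m. if m = n then c else 0) + (\<lambda>m. if m = n then d else 0)"
      by (auto simp: fun_eq_iff)
    then show "f (\<lambda>m. if m = n then c + d else 0)
      = f (\<lambda>m. if m = n then c else 0) + f (\<lambda>m. if m = n then d else 0)"
      by (simp add: linear_add[OF f(1)])
    have "(\<lambda>m. if m = n then r *\<^sub>R c else 0) = r *\<^sub>R (\<lambda>m. if m = n then c else 0)"
      by (auto simp: fun_eq_iff)
    then show "f (\<lambda>m. if m = n then r *\<^sub>R c else 0) = r *\<^sub>R f (\<lambda>m. if m = n then c else 0)"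
      by (simp add: linear_scale[OF f(1)])
  qed
  then obtain \<alpha> where "\<And>n c. f (\<lambda>m. if m = n then c else 0) = (c * \<alpha> n) \<bullet> 1" by metis
  note f_trunc = linear_functional_on_truncation[OF f(1) this]
  have \<alpha>: "(\<lambda>n. norm (\<alpha> n)) \<in> dual_ball p"
    unfolding dual_ball_def
  proof (intro CollectI ballI allI)
    fix b N assume b: "b \<in> ell p"
    \<comment> \<open>\<open>a\<close> has the moduli of b, with phases that turn a n * \<alpha> n
      into its modulus; where \<alpha> n = 0 it is 0 because \<open>inverse 0 = 0\<close>.\<close>
    define a where "a n = of_real (\<bar>b n\<bar> * norm (\<alpha> n)) * inverse (\<alpha> n)" for n
    have a\<alpha>: "(a n * \<alpha> n) \<bullet> 1 = \<bar>norm (\<alpha> n)\<bar> * \<bar>b n\<bar>" for n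
      by (cases "\<alpha> n = 0") (auto simp: a_def of_real_inner_one mult.assoc simp flip: of_real_mult)
    have na: "norm (if n < N then a n else 0) \<le> \<bar>b n\<bar>" for n
      by (cases "\<alpha> n = 0") (auto simp: a_def norm_mult norm_inverse mult.assoc)
    have X: "(\<lambda>n. if n < N then a n else 0) \<in> ?X"
      using ell_mono(1)[OF p b, of "\<lambda>n. norm (if n < N then a n else 0)"] na by simp
    have "(\<Sum>n<N. \<bar>norm (\<alpha> n)\<bar> * \<bar>b n\<bar>) = f (\<lambda>n. if n < N then a n else 0)"
      unfolding f_trunc by (simp only: a\<alpha>)
    also have "\<dots> \<le> ell_norm p (\<lambda>n. norm (if n < N then a n else 0))" by (rule f_le[OF X])
    also have "\<dots> \<le> ell_norm p b" by (rule ell_mono(2)[OF p b]) (use na in simp)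
    finally show "(\<Sum>n<N. \<bar>norm (\<alpha> n)\<bar> * \<bar>b n\<bar>) \<le> ell_norm p b" .
  qed
  have summ: "summable (\<lambda>n. \<alpha> n * \<phi> n v)" if "v \<in> V" for v
    using banach_over.dual_ball_abs_summable(1)[OF banach_over_mult \<alpha> ell[OF that]]
    by (rule summable_norm_cancel)
  have re: "(\<Sum>n. \<alpha> n * \<phi> n v) \<bullet> 1 = g v \<bullet> 1" if v: "v \<in> V" for v
  proof -
    have "(\<lambda>N. (\<Sum>n<N. \<alpha> n * \<phi> n v) \<bullet> 1) \<longlonglongrightarrow> (\<Sum>n. \<alpha> n * \<phi> n v) \<bullet> 1"
      using summable_LIMSEQ[OF summ[OF v]] by (intro tendsto_inner tendsto_const)
    moreover have "(\<lambda>N. (\<Sum>n<N. \<alpha> n * \<phi> n v) \<bullet> 1) \<longlonglongrightarrow> g v \<bullet> 1"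
    \<comment> \<open>The difference is, up to sign, the value of f on the tail of \<phi> v, which
      is bounded by the norm of that tail.\<close>
    proof (rule LIM_zero_cancel, rule Lim_null_comparison[OF _ ell_tail_LIMSEQ[OF p ell[OF v]]],
        rule always_eventually, rule allI)
      fix N
      let ?t = "\<lambda>n. if n < N then 0 else \<phi> n v" and ?h = "\<lambda>n. if n < N then \<phi> n v else 0"
      have tX: "?t \<in> ?X"
        using ell_mono(1)[OF p ell[OF v], of "\<lambda>n. norm (?t n)"] by simp
      then have tX': "- ?t \<in> ?X" by (simp add: if_distrib cong: if_cong)
      have "?\<phi> v = ?h + ?t" by (auto simp: fun_eq_iff)
      then have "g v \<bullet> 1 = f ?h + f ?t" using f\<phi>[OF v] by (simp add: linear_add[OF f(1)])
      then have "(\<Sum>n<N. \<alpha> n * \<phi> n v) \<bullet> 1 - g v \<bullet> 1 = - f ?t"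
        by (simp add: f_trunc inner_sum_left mult.commute)
      moreover have "f ?t \<le> ell_norm p (\<lambda>n. norm (?t n))" by (rule f_le[OF tX])
      moreover have "- f ?t \<le> ell_norm p (\<lambda>n. norm (?t n))"
        using f_le[OF tX'] linear_neg[OF f(1), of ?t] by simp
      moreover have "(\<lambda>n. norm (?t n)) = (\<lambda>n. if n < N then 0 else norm (\<phi> n v))" by auto
      ultimately show "norm ((\<Sum>n<N. \<alpha> n * \<phi> n v) \<bullet> 1 - g v \<bullet> 1)
        \<le> ell_norm p (\<lambda>n. if n < N then 0 else norm (\<phi> n v))" by simp
    qed
    ultimately show ?thesis by (rule LIMSEQ_unique)
  qed
  have "(\<Sum>n. \<alpha> n * \<phi> n v) = g v" if v: "v \<in> V" for v
  proof (rule inner_mult_one_eqD)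
    fix c
    have "c * (\<Sum>n. \<alpha> n * \<phi> n v) = (\<Sum>n. \<alpha> n * \<phi> n (s c v))"
      using suminf_mult[OF summ[OF v], of c] by (simp add: \<phi>_scale v mult.left_commute)
    then show "(c * (\<Sum>n. \<alpha> n * \<phi> n v)) \<bullet> 1 = (c * g v) \<bullet> 1"
      using re[OF scaleV[OF v, of c]] by (simp add: g_scale v)
  qed
  then have "(\<lambda>n. \<alpha> n * \<phi> n v) sums g v" if "v \<in> V" for v
    using summable_sums[OF summ[OF that]] that by simp
  then show ?thesis using \<alpha> by blast
qed

section \<open>Superposition of hulls\<close>

text \<open>Dividing the k-th sequence by w k and multiplying its coefficients by w k does not
  change the sums. The joined coefficients remain in the dual ball because the weights add up to at
  most 1, and the price is the division of the norms by w k.\<close>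

lemma (in banach_over) dual_hull_superposition:
  assumes p: "1 \<le> p" and z: "\<And>k. (\<lambda>n. norm (z k n)) \<in> ell p"
    and w: "\<And>k. 0 < w k" "summable w" "suminf w \<le> 1"
    and s: "summable (\<lambda>k. ell_norm p (\<lambda>n. norm (z k n)) / w k)"
  defines "Z \<equiv> concat_seq (\<lambda>k n. scale (of_real (1 / w k)) (z k n))"
  shows "(\<lambda>n. norm (Z n)) \<in> ell p"
    and "ell_norm p (\<lambda>n. norm (Z n)) \<le> (\<Sum>k. ell_norm p (\<lambda>n. norm (z k n)) / w k)"
    and "(\<And>k. y k \<in> dual_hull p scale (z k)) \<Longrightarrow> y sums y' \<Longrightarrow> y' \<in> dual_hull p scale Z"
proof -
  let ?z = "\<lambda>k n. (1 / w k) * norm (z k n)"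
  have nZ: "(\<lambda>n. norm (Z n)) = concat_seq ?z"
    using w(1) by (simp add: Z_def concat_seq_def fun_eq_iff norm_scale norm_divide less_imp_le)
  have z1: "?z k \<in> ell p" for k by (rule ell_cmult(1)[OF p z])
  have z2: "ell_norm p (?z k) \<le> ell_norm p (\<lambda>n. norm (z k n)) / w k" for k
    using ell_cmult(2)[OF p z[of k], of "1 / w k"] w(1)[of k] by (simp add: less_imp_le)
  have s1: "summable (\<lambda>k. ell_norm p (?z k))"
    by (rule summable_comparison_test'[OF s]) (use z2 ell_norm_nonneg[OF p z1] in simp)
  show Z_ell: "(\<lambda>n. norm (Z n)) \<in> ell p"
    unfolding nZ by (rule ell_concat_seq(1)[OF p z1 s1])
  show "ell_norm p (\<lambda>n. norm (Z n)) \<le> (\<Sum>k. ell_norm p (\<lambda>n. norm (z k n)) / w k)"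
    unfolding nZ using ell_concat_seq(2)[OF p z1 s1] suminf_le[OF z2 s1 s] by (rule order_trans)
  assume y: "\<And>k. y k \<in> dual_hull p scale (z k)" and y': "y sums y'"
  have "\<exists>\<alpha>. (\<lambda>n. norm (\<alpha> n)) \<in> dual_ball p \<and> (\<lambda>n. scale (\<alpha> n) (z k n)) sums y k" for k
    using y[of k] by (simp add: dual_hull_def)
  then obtain \<alpha> where \<alpha>: "\<And>k. (\<lambda>n. norm (\<alpha> k n)) \<in> dual_ball p"
    "\<And>k. (\<lambda>n. scale (\<alpha> k n) (z k n)) sums y k" by metis
  define \<beta> where "\<beta> = concat_seq (\<lambda>k n. of_real (w k) * \<alpha> k n)"
  have "(\<lambda>n. norm (\<beta> n)) = concat_seq (\<lambda>k n. w k * norm (\<alpha> k n))"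
    using w(1) by (simp add: \<beta>_def concat_seq_def fun_eq_iff norm_mult less_imp_le)
  then have \<beta>: "(\<lambda>n. norm (\<beta> n)) \<in> dual_ball p"
    using dual_ball_concat_seq[OF p \<alpha>(1) less_imp_le[OF w(1)] w(2,3)] by simp
  have "w k \<noteq> 0" for k using w(1)[of k] by simp
  then have t: "scale (\<beta> m) (Z m) = concat_seq (\<lambda>k n. scale (\<alpha> k n) (z k n)) m" for m
    by (simp add: \<beta>_def Z_def concat_seq_def)
  let ?f = "\<lambda>x. scale (\<alpha> (fst x) (snd x)) (z (fst x) (snd x))"
  have abs: "summable (\<lambda>m. norm (scale (\<beta> m) (Z m)))"
    by (rule dual_ball_abs_summable(1)[OF \<beta> Z_ell])
  define L where "L = (\<Sum>m. scale (\<beta> m) (Z m))"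
  \<comment> \<open>Absolute convergence of the joined series permits regrouping it by rows, so its
    sum is the sum of the y k.\<close>
  have "((\<lambda>m. scale (\<beta> m) (Z m)) has_sum L) UNIV"
    unfolding L_def by (rule norm_summable_imp_has_sum[OF abs summable_sums[OF summable_norm_cancel[OF abs]]])
  moreover have "(\<lambda>m. scale (\<beta> m) (Z m)) = (\<lambda>m. ?f (prod_decode m))"
    by (simp add: t concat_seq_def)
  ultimately have "(?f has_sum L) (UNIV \<times> UNIV)"
    using has_sum_reindex_bij_betw[OF bij_prod_decode, of ?f L] by simp
  moreover have "((\<lambda>n. ?f (k, n)) has_sum y k) UNIV" for k
    using norm_summable_imp_has_sum[OF dual_ball_abs_summable(1)[OF \<alpha>(1) z] \<alpha>(2), of k] by simp
  ultimately have "(y has_sum L) UNIV"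
    by (rule has_sum_SigmaD[where f = ?f])
  then have "y sums L" by (rule has_sum_imp_sums)
  then have "y' = L" using y' sums_unique2 by blast
  then show "y' \<in> dual_hull p scale Z"
    using \<beta> summable_sums[OF summable_norm_cancel[OF abs]] by (auto simp: dual_hull_def L_def)
qed

lemma dual_hull_0: "1 \<le> p \<Longrightarrow> banach_over s \<Longrightarrow> 0 \<in> dual_hull p s x"
proof -
  assume p: "1 \<le> p" and "banach_over s"
  then interpret banach_over s by simp
  have "(\<lambda>n. norm (0::'a)) \<in> dual_ball p"
    using ell_norm_nonneg[OF p] by (simp add: dual_ball_def)
  then show ?thesis by (auto simp: dual_hull_def intro!: exI[of _ "\<lambda>n. 0"])
qed

text \<open>Index 0 is reserved for the main hull, whose norm is thereby multiplied by 1 / (1 -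
  \<theta>) only.\<close>

lemma geometric_weights:
  fixes \<theta> :: real
  assumes "0 < \<theta>" "\<theta> < 1"
  defines "w \<equiv> \<lambda>k. if k = 0 then 1 - \<theta> else \<theta> / 2 ^ k"
  shows "0 < w k" "summable w" "suminf w \<le> 1"
proof -
  show "0 < w k" using assms by simp
  have "(\<lambda>k. w (Suc k)) sums (\<theta> * 1)"
    using sums_mult[OF power_half_series, of \<theta>] by (simp add: w_def power_divide field_simps)
  then have "w sums (\<theta> * 1 + w 0)" by (rule sums_Suc)
  then have "w sums 1" by (simp add: w_def)
  then show "summable w" "suminf w \<le> 1" by (auto simp: sums_iff)
qed

text \<open>Here \<theta> is fixed before \<tau>: it brings C / (1 - \<theta>) below C + \<epsilon>
  / 2, and \<tau> is so small that the other terms amount to \<epsilon> / 2. The term 8 * \<tau> /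
  \<theta> is the total cost of the later hulls in
  \<open>bidual_hull_subset_dual_hull\<close>.\<close>

lemma geometric_weights_cost:
  fixes C \<epsilon> :: real
  assumes "0 \<le> C" "0 < \<epsilon>"
  obtains \<theta> \<tau> where "0 < \<theta>" "\<theta> < 1" "0 < \<tau>" "(C + \<tau>) / (1 - \<theta>) + 8 * \<tau> / \<theta> \<le> C + \<epsilon>"
proof -
  define \<theta> where "\<theta> = \<epsilon> / (4 * (C + \<epsilon>))"
  have \<theta>: "0 < \<theta>" "\<theta> < 1" using assms by (auto simp: \<theta>_def field_simps)
  have "C \<le> (C + \<epsilon> / 2) * (1 - \<theta>)"
  proof -
    have "(C + \<epsilon> / 2) * \<theta> \<le> (C + \<epsilon>) * \<theta>" using \<theta> assms by (intro mult_right_mono) auto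
    also have "\<dots> = \<epsilon> / 4"
    proof -
      obtain D where D: "D = C + \<epsilon>" by blast
      then have "D \<noteq> 0" using assms by simp
      then show ?thesis by (simp add: \<theta>_def flip: D)
    qed
    finally show ?thesis using assms by (simp add: algebra_simps)
  qed
  then have 1: "C / (1 - \<theta>) \<le> C + \<epsilon> / 2" using \<theta> by (simp add: field_simps)
  define K where "K = 1 / (1 - \<theta>) + 8 / \<theta>"
  have K: "0 < K" using \<theta> by (simp add: K_def add_pos_pos)
  define \<tau> where "\<tau> = \<epsilon> / (2 * K)"
  have "0 < \<tau>" using K assms by (simp add: \<tau>_def)
  moreover have "(C + \<tau>) / (1 - \<theta>) + 8 * \<tau> / \<theta> = C / (1 - \<theta>) + \<tau> * K"
    by (simp add: K_def add_divide_distrib algebra_simps)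
  moreover have "\<tau> * K = \<epsilon> / 2" using K by (simp add: \<tau>_def)
  ultimately show ?thesis using that[of \<theta> \<tau>] \<theta> 1 by simp
qed

text \<open>A superposition in which all sequences but two are zero. Their weights are 1 - \<theta>
  and \<theta> / 2, whence the factor 2.\<close>

lemma dual_hull_add:
  fixes s :: "'k::{real_normed_field,euclidean_space} \<Rightarrow> 'a::banach \<Rightarrow> 'a"
  assumes s: "banach_over s" and p: "1 \<le> p" and \<theta>: "0 < \<theta>" "\<theta> < 1"
    and x: "(\<lambda>n. norm (x n)) \<in> ell p" and e: "(\<lambda>n. norm (e n)) \<in> ell p"
  shows "\<exists>z. (\<lambda>n. norm (z n)) \<in> ell p \<and>
    ell_norm p (\<lambda>n. norm (z n)) \<le> ell_norm p (\<lambda>n. norm (x n)) / (1 - \<theta>) + 2 * ell_norm p (\<lambda>n. norm (e n)) / \<theta> \<and>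
    (\<forall>a\<in>dual_hull p s x. \<forall>b\<in>dual_hull p s e. a + b \<in> dual_hull p s z)"
proof -
  interpret banach_over s by fact
  define w where "w k = (if k = 0 then 1 - \<theta> else \<theta> / 2 ^ k)" for k :: nat
  note w = geometric_weights[OF \<theta>, folded w_def]
  define z where "z k = (if k = 0 then x else if k = 1 then e else (\<lambda>n. 0))" for k :: nat
  have z: "(\<lambda>n. norm (z k n)) \<in> ell p" for k
    using x e ell_finite_support(1)[OF p, of 0 "\<lambda>n. 0"] by (simp add: z_def)
  have ell0: "ell_norm p (\<lambda>n. 0) = 0"
    using ell_finite_support[OF p, of 0 "\<lambda>n. 0"] ell_norm_nonneg[OF p, of "\<lambda>n. 0"] by simp
  have sums_two: "f sums (f 0 + f 1)" if "\<And>k. k \<ge> 2 \<Longrightarrow> f k = 0" for f :: "nat \<Rightarrow> 'c::real_normed_vector"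
    using sums_finite[of "{0, 1}" f] that by (auto simp: numeral_2_eq_2 not_less_eq_eq[symmetric] less_Suc_eq)
  have c: "(\<lambda>k. ell_norm p (\<lambda>n. norm (z k n)) / w k) sums
    (ell_norm p (\<lambda>n. norm (x n)) / (1 - \<theta>) + 2 * ell_norm p (\<lambda>n. norm (e n)) / \<theta>)"
    using sums_two[of "\<lambda>k. ell_norm p (\<lambda>n. norm (z k n)) / w k"]
    by (simp add: z_def w_def ell0 mult.commute)
  let ?Z = "concat_seq (\<lambda>k n. s (of_real (1 / w k)) (z k n))"
  note Z = dual_hull_superposition[OF p z w sums_summable[OF c]]
  have "a + b \<in> dual_hull p s ?Z" if "a \<in> dual_hull p s x" "b \<in> dual_hull p s e" for a b
  proof (rule Z(3))
    let ?y = "\<lambda>k. if k = 0 then a else if k = 1 then b else 0 :: 'a"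
    show "?y k \<in> dual_hull p s (z k)" for k
      using that dual_hull_0[OF p s] by (simp add: z_def)
    show "?y sums (a + b)" using sums_two[of ?y] by simp
  qed
  then show ?thesis using Z(1,2) sums_unique[OF c] by (intro exI[of _ ?Z]) auto
qed

text \<open>The elements are listed and the coefficients are unit vectors. This will absorb the
  finitely many errors left by local reflexivity.\<close>

lemma finite_set_subset_dual_hull:
  fixes s :: "'k::{real_normed_field,euclidean_space} \<Rightarrow> 'a::banach \<Rightarrow> 'a"
  assumes s: "banach_over s" and p: "1 \<le> p" and I: "finite I"
  shows "\<exists>x. (\<lambda>n. norm (x n)) \<in> ell p \<and> ell_norm p (\<lambda>n. norm (x n)) \<le> (\<Sum>i\<in>I. norm (e i)) \<and>
    (\<forall>i\<in>I. e i \<in> dual_hull p s x)"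
proof -
  interpret banach_over s by fact
  obtain h where h: "bij_betw h {0..<card I} I" using ex_bij_betw_nat_finite[OF I] by blast
  define x where "x n = (if n < card I then e (h n) else 0)" for n
  have "norm (x n) = 0" if "n \<ge> card I" for n using that by (simp add: x_def)
  note fin = ell_finite_support[OF p, of "card I" "\<lambda>n. norm (x n)", OF this]
  have "(\<Sum>n<card I. \<bar>norm (x n)\<bar>) = (\<Sum>n\<in>{0..<card I}. norm (e (h n)))"
    by (intro sum.cong) (auto simp: x_def)
  also have "\<dots> = (\<Sum>i\<in>I. norm (e i))" by (rule sum.reindex_bij_betw[OF h])
  finally have "ell_norm p (\<lambda>n. norm (x n)) \<le> (\<Sum>i\<in>I. norm (e i))" using fin(2) by simp
  moreover have "e i \<in> dual_hull p s x" if i: "i \<in> I" for i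
  proof -
    have "i \<in> h ` {0..<card I}" using h i by (simp add: bij_betw_def)
    then obtain n where n: "n < card I" "h n = i" by auto
    let ?\<alpha> = "\<lambda>m. if m = n then 1 else 0 :: 'k"
    have "(\<lambda>m. norm (?\<alpha> m)) \<in> dual_ball p"
      unfolding dual_ball_def
    proof (intro CollectI ballI allI)
      fix b N assume b: "b \<in> ell p"
      have "(\<Sum>m<N. \<bar>norm (?\<alpha> m)\<bar> * \<bar>b m\<bar>) = (\<Sum>m<N. if m = n then \<bar>b n\<bar> else 0)"
        by (intro sum.cong) auto
      also have "\<dots> \<le> \<bar>b n\<bar>" by (subst sum.delta) auto
      also have "\<dots> \<le> ell_norm p b" by (rule abs_le_ell_norm[OF p b])
      finally show "(\<Sum>m<N. \<bar>norm (?\<alpha> m)\<bar> * \<bar>b m\<bar>) \<le> ell_norm p b" .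
    qed
    moreover have "(\<lambda>m. s (?\<alpha> m) (x m)) sums e i"
      using sums_single[of n "\<lambda>m. x m"] n by (simp add: x_def if_distrib[where f = "\<lambda>c. s c _"] cong: if_cong)
    ultimately show ?thesis by (auto simp: dual_hull_def)
  qed
  ultimately show ?thesis using fin(1) by blast
qed

lemma (in banach_over) dual_ball_partial_sum_error:
  assumes p: "1 \<le> p" and \<alpha>: "(\<lambda>n. norm (\<alpha> n)) \<in> dual_ball p" and x: "(\<lambda>n. norm (x n)) \<in> ell p"
    and y: "(\<lambda>n. scale (\<alpha> n) (x n)) sums y"
  shows "norm (y - (\<Sum>n<N. scale (\<alpha> n) (x n))) \<le> ell_norm p (\<lambda>n. if n < N then 0 else norm (x n))"
proof -
  let ?x = "\<lambda>n. if n < N then 0 else x n"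
  have nx: "(\<lambda>n. norm (?x n)) = (\<lambda>n. if n < N then 0 else norm (x n))" by auto
  have x': "(\<lambda>n. norm (?x n)) \<in> ell p" by (rule ell_mono(1)[OF p x]) simp
  have "(\<lambda>n. if n < N then scale (\<alpha> n) (x n) else 0) sums (\<Sum>n<N. scale (\<alpha> n) (x n))"
    using sums_If_finite_set[of "{..<N}" "\<lambda>n. scale (\<alpha> n) (x n)"] by simp
  from sums_diff[OF y this] have "(\<lambda>n. scale (\<alpha> n) (?x n)) sums (y - (\<Sum>n<N. scale (\<alpha> n) (x n)))"
    by (rule back_subst[of "\<lambda>f. f sums _"]) auto
  then have "y - (\<Sum>n<N. scale (\<alpha> n) (x n)) = (\<Sum>n. scale (\<alpha> n) (?x n))" by (simp add: sums_iff)
  then show ?thesis using dual_ball_abs_summable(2)[OF \<alpha> x'] nx by simp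
qed

section \<open>Descent from the bidual\<close>

lemma banach_over_dual_scale:
  "banach_over (dual_scale :: 'k \<Rightarrow> ('b::real_normed_vector \<Rightarrow>\<^sub>L 'k) \<Rightarrow> 'b \<Rightarrow>\<^sub>L 'k::{real_normed_field,euclidean_space})"
proof unfold_locales
  fix c d :: 'k and f g :: "'b \<Rightarrow>\<^sub>L 'k" and r :: real
  have le: "norm (dual_scale c f) \<le> norm c * norm f" for c :: 'k and f :: "'b \<Rightarrow>\<^sub>L 'k"
  proof (rule norm_blinfun_bound)
    fix x
    show "norm (dual_scale c f x) \<le> norm c * norm f * norm x"
      using mult_left_mono[OF norm_blinfun[of f x], of "norm c"] by (simp add: norm_mult mult.assoc)
  qed simp
  show "norm (dual_scale c f) = norm c * norm f"
  proof (cases "c = 0")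
    case True
    then show ?thesis using le[of c f] by simp
  next
    case False
    have "dual_scale (inverse c) (dual_scale c f) = f"
      using False by (intro blinfun_eqI) simp
    then have "norm f \<le> inverse (norm c) * norm (dual_scale c f)"
      using le[of "inverse c" "dual_scale c f"] by (simp add: norm_inverse)
    then show ?thesis using le[of c f] False by (simp add: field_simps)
  qed
qed (auto intro!: blinfun_eqI simp: blinfun.add_left blinfun.scaleR_left algebra_simps scaleR_conv_of_real)

lemma scale_subspace_dual_space: "scale_subspace dual_scale (dual_space s)"
  by (auto simp: scale_subspace_def dual_space_def blinfun.add_left algebra_simps)

lemma dual_norm_almost_attained:
  fixes f :: "'b::banach \<Rightarrow>\<^sub>L 'k::{real_normed_field,euclidean_space}"
  assumes s: "banach_over s" and f: "f \<in> dual_space s" and t: "0 < t" "t < 1"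
  shows "\<exists>z. norm z \<le> 1 \<and> t * norm f \<le> f z \<bullet> 1"
proof (cases "f = 0")
  case True
  then show ?thesis by (intro exI[of _ 0]) simp
next
  case False
  interpret banach_over s by fact
  have "\<exists>z. t * norm f * norm z < norm (f z)"
  proof (rule ccontr)
    assume "\<not> ?thesis"
    then have "norm f \<le> t * norm f"
      using t by (intro norm_blinfun_bound) (auto simp: not_less)
    then show False using t False by simp
  qed
  then obtain z where z: "t * norm f * norm z < norm (f z)" by blast
  then have z0: "z \<noteq> 0" by auto
  have "0 \<le> t * norm f * norm z" using t by simp
  then have fz: "f z \<noteq> 0" using z by auto
  \<comment> \<open>This scalar normalises \<open>z\<close> and rotates the value of
    \<open>f\<close> to a positive real.\<close>
  define c where "c = of_real (norm (f z) / norm z) / f z"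
  have "norm c = 1 / norm z" using fz z0 by (simp add: c_def norm_divide norm_mult)
  then have "norm (s c z) = 1" using z0 by (simp add: norm_scale)
  moreover have "f (s c z) = of_real (norm (f z) / norm z)"
    using f fz by (simp add: dual_space_def c_def)
  moreover have "t * norm f \<le> norm (f z) / norm z" using z z0 by (simp add: field_simps)
  ultimately show ?thesis by (intro exI[of _ "s c z"]) (simp only: of_real_inner_one order_refl simp_thms)
qed

lemma functional_sum:
  assumes \<phi>: "\<phi> \<in> functionals s V" and V: "scale_subspace s V" and I: "finite I" and g: "\<And>i. i \<in> I \<Longrightarrow> g i \<in> V"
  shows "(\<Sum>i\<in>I. s (c i) (g i)) \<in> V \<and> \<phi> (\<Sum>i\<in>I. s (c i) (g i)) = (\<Sum>i\<in>I. c i * \<phi> (g i))"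
  using I g
proof induction
  case empty
  then show ?case using V bounded_operators_0[OF \<phi> V] by (simp add: scale_subspace_def)
next
  case (insert i I)
  then have "s (c i) (g i) \<in> V" "(\<Sum>i\<in>I. s (c i) (g i)) \<in> V" "g i \<in> V"
    using V by (auto simp: scale_subspace_def)
  then show ?case using insert \<phi> V by (auto simp: scale_subspace_def bounded_operators_def)
qed

text \<open>The part of the hull of \<phi> in the bidual that lies in the space itself: the series
  is required to converge weak-* to the canonical image of y.\<close>

definition bidual_hull ::
  "ennreal \<Rightarrow> ('k::real_normed_field \<Rightarrow> 'b \<Rightarrow> 'b) \<Rightarrow> (nat \<Rightarrow> ('b \<Rightarrow>\<^sub>L 'k) \<Rightarrow> 'k) \<Rightarrow> 'b::real_normed_vector set"
  where "bidual_hull p s \<phi> = {y. \<exists>\<alpha>. (\<lambda>n. norm (\<alpha> n)) \<in> dual_ball p \<and>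
    (\<forall>f\<in>dual_space s. (\<lambda>n. \<alpha> n * \<phi> n f) sums f y)}"

definition bidual_sequences ::
  "ennreal \<Rightarrow> ('k::real_normed_field \<Rightarrow> 'b \<Rightarrow> 'b) \<Rightarrow> (nat \<Rightarrow> ('b::real_normed_vector \<Rightarrow>\<^sub>L 'k) \<Rightarrow> 'k) set"
  where "bidual_sequences p s = {\<phi>. (\<forall>n. \<phi> n \<in> functionals dual_scale (dual_space s)) \<and>
    (\<lambda>n. op_norm (dual_space s) (\<phi> n)) \<in> ell p}"

lemma bidual_sequences_bound:
  fixes s :: "'k::{real_normed_field,euclidean_space} \<Rightarrow> 'b::banach \<Rightarrow> 'b"
  assumes \<phi>: "\<phi> \<in> bidual_sequences p s" and g: "g \<in> dual_space s"
  shows "norm (\<phi> n g) \<le> op_norm (dual_space s) (\<phi> n) * norm g"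
proof -
  have "\<phi> n \<in> functionals dual_scale (dual_space s)" using \<phi> by (simp add: bidual_sequences_def)
  from norm_le_op_norm[OF this scale_subspace_dual_space banach_over_dual_scale banach_over_mult g]
  show ?thesis .
qed

lemma op_norm_bidual_nonneg:
  assumes "\<phi> \<in> bidual_sequences p s"
  shows "0 \<le> op_norm (dual_space s) (\<phi> n)"
proof -
  have "\<phi> n \<in> functionals dual_scale (dual_space s)" using assms by (simp add: bidual_sequences_def)
  then show ?thesis using scale_subspace_dual_space by (rule op_norm_nonneg)
qed

lemma bidual_sequences_ell:
  fixes s :: "'k::{real_normed_field,euclidean_space} \<Rightarrow> 'b::banach \<Rightarrow> 'b"
  assumes p: "1 \<le> p" and \<phi>: "\<phi> \<in> bidual_sequences p s" and g: "g \<in> dual_space s"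
  shows "(\<lambda>n. norm (\<phi> n g)) \<in> ell p"
    and "ell_norm p (\<lambda>n. if n < N then 0 else norm (\<phi> n g)) \<le>
      norm g * ell_norm p (\<lambda>n. if n < N then 0 else op_norm (dual_space s) (\<phi> n))"
proof -
  let ?c = "\<lambda>n. op_norm (dual_space s) (\<phi> n)"
  have c: "?c \<in> ell p" using \<phi> by (simp add: bidual_sequences_def)
  have le: "norm (\<phi> n g) \<le> norm g * ?c n" for n
    using bidual_sequences_bound[OF \<phi> g, of n] by (simp add: mult.commute)
  show "(\<lambda>n. norm (\<phi> n g)) \<in> ell p"
    by (rule ell_mono(1)[OF p ell_cmult(1)[OF p c, of "norm g"]]) (use le abs_ge_self order_trans in \<open>simp, blast\<close>)
  have t: "(\<lambda>n. if n < N then 0 else ?c n) \<in> ell p" by (rule ell_mono(1)[OF p c]) simp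
  have "ell_norm p (\<lambda>n. if n < N then 0 else norm (\<phi> n g))
    \<le> ell_norm p (\<lambda>n. norm g * (if n < N then 0 else ?c n))"
    by (rule ell_mono(2)[OF p ell_cmult(1)[OF p t]]) (use le order_trans[OF le abs_ge_self] in auto)
  also have "\<dots> \<le> norm g * ell_norm p (\<lambda>n. if n < N then 0 else ?c n)"
    using ell_cmult(2)[OF p t, of "norm g"] by simp
  finally show "ell_norm p (\<lambda>n. if n < N then 0 else norm (\<phi> n g)) \<le> norm g * ell_norm p (\<lambda>n. if n < N then 0 else ?c n)" .
qed

text \<open>This makes the remainders of the iterated splitting tend to zero.\<close>

lemma norm_le_of_bidual_hull:
  fixes s :: "'k::{real_normed_field,euclidean_space} \<Rightarrow> 'b::banach \<Rightarrow> 'b"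
  assumes p: "1 \<le> p" and s: "banach_over s" and \<phi>: "\<phi> \<in> bidual_sequences p s" and y: "y \<in> bidual_hull p s \<phi>"
  shows "norm y \<le> ell_norm p (\<lambda>n. op_norm (dual_space s) (\<phi> n))"
proof -
  obtain f where f: "f \<in> dual_space s" "norm f \<le> 1" "norm y \<le> norm (f y)"
    using norming_functional[OF s, of y] by blast
  obtain \<alpha> where \<alpha>: "(\<lambda>n. norm (\<alpha> n)) \<in> dual_ball p" "(\<lambda>n. \<alpha> n * \<phi> n f) sums f y"
    using y f(1) by (auto simp: bidual_hull_def)
  let ?C = "ell_norm p (\<lambda>n. op_norm (dual_space s) (\<phi> n))"
  have c: "(\<lambda>n. op_norm (dual_space s) (\<phi> n)) \<in> ell p" using \<phi> by (simp add: bidual_sequences_def)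
  have "norm (f y) \<le> ell_norm p (\<lambda>n. norm (\<phi> n f))"
    using banach_over.dual_ball_abs_summable(2)[OF banach_over_mult \<alpha>(1) bidual_sequences_ell(1)[OF p \<phi> f(1)]] \<alpha>(2)
    by (simp add: sums_iff)
  also have "\<dots> \<le> norm f * ?C" using bidual_sequences_ell(2)[OF p \<phi> f(1), of 0] by simp
  also have "\<dots> \<le> 1 * ?C" using f(2) ell_norm_nonneg[OF p c] by (rule mult_right_mono)
  finally show ?thesis using f(3) by simp
qed

text \<open>
  An instance of local reflexivity: finitely many elements represented in the bidual almost have the
  same representation in the space itself. The cone \<open>?S\<close> consists of the points above the gauge of
  the families that have such an approximate representation, and a functional separating \<open>d\<close>
  from it would contradict the representation in the bidual.
\<close>

lemma finite_bidual_representation: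
  fixes s :: "'k::{real_normed_field,euclidean_space} \<Rightarrow> 'b::banach \<Rightarrow> 'b" and \<gamma> :: "'i \<Rightarrow> nat \<Rightarrow> 'k"
  assumes p: "1 \<le> p" and s: "banach_over s" and \<phi>: "\<phi> \<in> bidual_sequences p s"
    and I: "finite I" and \<gamma>: "\<And>i. i \<in> I \<Longrightarrow> (\<lambda>n. norm (\<gamma> i n)) \<in> dual_ball p"
    and d: "\<And>i f. i \<in> I \<Longrightarrow> f \<in> dual_space s \<Longrightarrow> (\<lambda>n. \<gamma> i n * \<phi> n f) sums f (d i)"
    and \<eta>: "0 < \<eta>"
  shows "\<exists>x N. (\<forall>n\<ge>N. x n = 0) \<and> (\<forall>n. norm (x n) \<le> (1 + \<eta>) * op_norm (dual_space s) (\<phi> n)) \<and>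
    (\<Sum>i\<in>I. norm (d i - (\<Sum>n<N. s (\<gamma> i n) (x n)))) \<le> \<eta>"
proof -
  interpret banach_over s by fact
  interpret dual: banach_over "dual_scale :: 'k \<Rightarrow> ('b \<Rightarrow>\<^sub>L 'k) \<Rightarrow> 'b \<Rightarrow>\<^sub>L 'k"
    by (rule banach_over_dual_scale)
  define c where "c n = op_norm (dual_space s) (\<phi> n)" for n
  have c_ell: "c \<in> ell p" using \<phi> by (simp add: bidual_sequences_def c_def[abs_def])
  have c0: "0 \<le> c n" for n using op_norm_bidual_nonneg[OF \<phi>] by (simp add: c_def)
  \<comment> \<open>The penalty for the representation error: as soon as r + M * error is below 1 +
    \<eta>, both r \<le> 1 + \<eta> and error \<le> \<eta> follow.\<close>
  define M where "M = (1 + \<eta>) / \<eta>"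
  have M: "0 < M" "M * \<eta> = 1 + \<eta>" using \<eta> by (auto simp: M_def)
  \<comment> \<open>Truncating the \<open>card I\<close> series, paired with functionals of norm at
    most M, must cost at most \<eta> / 2, so that F d \<le> 1 + \<eta> / 2 contradicts 1 + \<eta>
    \<le> F d.\<close>
  define e where "e = \<eta> / (2 * (real (card I) * M + 1))"
  have den: "0 < real (card I) * M + 1" using M(1) by (simp add: add_nonneg_pos)
  then have e: "0 < e" using \<eta> by (simp add: e_def)
  have "real (card I) * (M * e) \<le> (real (card I) * M + 1) * e" using e by (simp add: algebra_simps)
  also have "\<dots> = \<eta> / 2" using den by (simp add: e_def field_simps)
  finally have cardMe: "real (card I) * (M * e) \<le> \<eta> / 2" .
  obtain N where N: "ell_norm p (\<lambda>n. if n < N then 0 else c n) \<le> e"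
    using ell_tail[OF p c_ell e] by blast
  define A where "A x i = (\<Sum>n<N. s (\<gamma> i n) (x n))" for x :: "nat \<Rightarrow> 'b" and i
  have A_add: "A (\<lambda>n. x n + x' n) i = A x i + A x' i" for x x' i
    by (simp add: A_def scale_right_distrib sum.distrib)
  have A_scale: "A (\<lambda>n. r *\<^sub>R x n) i = r *\<^sub>R A x i" for x i and r :: real
    by (simp add: A_def scale_scaleR scaleR_sum_right)
  let ?S = "\<lambda>(y :: 'i \<Rightarrow> 'b) t. \<exists>x r. 0 \<le> r \<and> (\<forall>n. norm (x n) \<le> r * c n) \<and>
    r + M * (\<Sum>i\<in>I. norm (y i - A x i)) \<le> t"
  have "\<exists>t. ?S d t \<and> t < 1 + \<eta>"
  proof (rule ccontr)
    assume neg: "\<not> ?thesis"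
    have S: "bounding_cone ?S"
    proof (rule bounding_coneI)
      fix y y' t t' assume "?S y t" "?S y' t'"
      then obtain x r x' r' where 1: "0 \<le> r" "\<And>n. norm (x n) \<le> r * c n" "r + M * (\<Sum>i\<in>I. norm (y i - A x i)) \<le> t"
        and 2: "0 \<le> r'" "\<And>n. norm (x' n) \<le> r' * c n" "r' + M * (\<Sum>i\<in>I. norm (y' i - A x' i)) \<le> t'" by blast
      have "(\<Sum>i\<in>I. norm ((y + y') i - A (\<lambda>n. x n + x' n) i))
        \<le> (\<Sum>i\<in>I. norm (y i - A x i) + norm (y' i - A x' i))"
        by (intro sum_mono) (simp add: A_add norm_diff_triangle_ineq)
      from mult_left_mono[OF this, of M] M(1)
      have "r + r' + M * (\<Sum>i\<in>I. norm ((y + y') i - A (\<lambda>n. x n + x' n) i)) \<le> t + t'"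
        using 1(3) 2(3) by (simp add: sum.distrib distrib_left)
      moreover have "norm (x n + x' n) \<le> (r + r') * c n" for n
        using norm_triangle_ineq[of "x n" "x' n"] 1(2)[of n] 2(2)[of n] by (simp add: distrib_right)
      ultimately show "?S (y + y') (t + t')"
        using 1(1) 2(1) by (intro exI[of _ "\<lambda>n. x n + x' n"] exI[of _ "r + r'"]) simp
    next
      fix y t and u :: real assume "?S y t" and u: "0 < u"
      then obtain x r where 1: "0 \<le> r" "\<And>n. norm (x n) \<le> r * c n" "r + M * (\<Sum>i\<in>I. norm (y i - A x i)) \<le> t" by blast
      have "norm ((u *\<^sub>R y) i - A (\<lambda>n. u *\<^sub>R x n) i) = u * norm (y i - A x i)" for i
        using u by (simp add: A_scale scaleR_diff_right[symmetric] del: scaleR_diff_right)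
      then have "u * r + M * (\<Sum>i\<in>I. norm ((u *\<^sub>R y) i - A (\<lambda>n. u *\<^sub>R x n) i))
        = u * (r + M * (\<Sum>i\<in>I. norm (y i - A x i)))"
        by (simp add: sum_distrib_left[symmetric] algebra_simps)
      also have "\<dots> \<le> u * t" using 1(3) u by simp
      finally show "?S (u *\<^sub>R y) (u * t)"
        using 1(1,2) u by (intro exI[of _ "\<lambda>n. u *\<^sub>R x n"] exI[of _ "u * r"]) (simp add: mult.assoc)
    next
      fix t assume "?S 0 t"
      then obtain x r where 1: "0 \<le> r" "r + M * (\<Sum>i\<in>I. norm (0 - A x i)) \<le> t" by auto
      have "0 \<le> M * (\<Sum>i\<in>I. norm (0 - A x i))" using M(1) by (simp add: sum_nonneg)
      then show "0 \<le> t" using 1 by linarith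
    next
      fix y
      have "?S y (M * (\<Sum>i\<in>I. norm (y i)))"
        by (intro exI[of _ "\<lambda>n. 0"] exI[of _ 0]) (simp add: A_def)
      then show "\<exists>t. ?S y t" by (rule exI)
    qed
    have S00: "?S 0 0" by (intro exI[of _ "\<lambda>n. 0"] exI[of _ 0]) (simp add: A_def)
    obtain F where F: "linear F" "\<And>y t. ?S y t \<Longrightarrow> F y \<le> t" "1 + \<eta> \<le> F d"
    proof (rule linear_minorant_of_cone_at_point[of ?S d "1 + \<eta>", OF S S00])
      fix t assume "?S d t"
      then show "1 + \<eta> \<le> t" using neg not_less by blast
    next
      fix F assume "linear F" "\<And>y t. ?S y t \<Longrightarrow> F y \<le> t" "1 + \<eta> \<le> F d"
      then show thesis by (rule that)
    qed
    have F_simple: "F y \<le> M * (\<Sum>i\<in>I. norm (y i))" for y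
      by (rule F(2), intro exI[of _ "\<lambda>n. 0"] exI[of _ 0]) (simp add: A_def)
    \<comment> \<open>Restricted to the i-th coordinate, \<open>F\<close> is the real part of a
      functional g i of norm at most M.\<close>
    let ?single = "\<lambda>i (v::'b) j. if j = i then v else 0"
    have "\<exists>g\<in>dual_space s. (\<forall>v. F (?single i v) = g v \<bullet> 1) \<and> (\<forall>v. norm (g v) \<le> M * norm v)" for i
    proof (rule complexification[OF s])
      show "linear (\<lambda>v. F (?single i v))"
      proof (rule linearI)
        fix v w :: 'b and r :: real
        have "?single i (v + w) = ?single i v + ?single i w" by (auto simp: fun_eq_iff)
        then show "F (?single i (v + w)) = F (?single i v) + F (?single i w)"
          by (simp only: linear_add[OF F(1)])
        have "?single i (r *\<^sub>R v) = r *\<^sub>R ?single i v" by (auto simp: fun_eq_iff)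
        then show "F (?single i (r *\<^sub>R v)) = r *\<^sub>R F (?single i v)"
          by (simp only: linear_scale[OF F(1)])
      qed
      fix v
      have "(\<Sum>j\<in>I. norm (?single i v j)) = (\<Sum>j\<in>I. if j = i then norm v else 0)"
        by (intro sum.cong) auto
      also have "\<dots> \<le> norm v" using I by (simp add: sum.delta)
      finally have "M * (\<Sum>j\<in>I. norm (?single i v j)) \<le> M * norm v"
        using M(1) by (intro mult_left_mono) auto
      with F_simple[of "?single i v"] show "F (?single i v) \<le> M * norm v" by (rule order_trans)
    qed
    then obtain g where g: "\<And>i. g i \<in> dual_space s" "\<And>i v. F (?single i v) = blinfun_apply (g i) v \<bullet> 1"
      "\<And>i v. norm (blinfun_apply (g i) v) \<le> M * norm v" by metis
    have ng: "norm (g i) \<le> M" for i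
      using g(3) M(1) by (intro norm_blinfun_bound) auto
    have F_le: "F y = (\<Sum>i\<in>I. g i (y i) \<bullet> 1)" for y
    proof -
      \<comment> \<open>\<open>F_simple\<close> bounds \<open>F\<close> by coordinates in I alone,
        so \<open>F\<close> vanishes on families that vanish on I and is the sum of its parts g i
        over I.\<close>
      have zero: "F z \<le> 0" if "\<And>i. i \<in> I \<Longrightarrow> z i = 0" for z
        using F_simple[of z] that by simp
      define z where "z = y - (\<Sum>i\<in>I. ?single i (y i))"
      have "(\<Sum>i\<in>I. ?single i (y i)) j = (if j \<in> I then y j else 0)" for j
      proof -
        have "(\<Sum>i\<in>J. ?single i (y i)) j = (\<Sum>i\<in>J. ?single i (y i) j)" if "finite J" for J
          using that by induction auto
        then show ?thesis using I by (simp add: sum.delta)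
      qed
      then have "z i = 0" if "i \<in> I" for i using that by (simp add: z_def)
      then have "F z \<le> 0" "F (- z) \<le> 0" by (auto intro!: zero)
      then have "F z = 0" using linear_neg[OF F(1), of z] by simp
      then have "F y = F (\<Sum>i\<in>I. ?single i (y i))"
        unfolding z_def by (simp add: linear_diff[OF F(1)])
      then show ?thesis by (simp only: linear_sum[OF F(1)] g(2))
    qed
    \<comment> \<open>The functionals regrouped by n: F (A x) is the sum of the real parts of H n (x
      n), and the representation of d turns F d into the sum of those of \<phi> n (H n), up to the
      tails.\<close>
    define H where "H n = (\<Sum>i\<in>I. dual_scale (\<gamma> i n) (g i))" for n
    have \<phi>fun: "\<phi> n \<in> functionals dual_scale (dual_space s)" for n
      using \<phi> by (simp add: bidual_sequences_def)
    have H: "H n \<in> dual_space s" "\<phi> n (H n) = (\<Sum>i\<in>I. \<gamma> i n * \<phi> n (g i))" for n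
      using functional_sum[OF \<phi>fun scale_subspace_dual_space I, of g "\<lambda>i. \<gamma> i n"] g(1)
      by (auto simp: H_def)
    have H_apply: "H n v = (\<Sum>i\<in>I. \<gamma> i n * g i v)" for n v
      unfolding H_def using I by induction (auto simp: blinfun.add_left)
    \<comment> \<open>Choose x n of norm at most c n that almost norms H n. Then A x lies in the
      cone at height 1, with r = 1 and no error, so F (A x) \<le> 1.\<close>
    have sumH: "(\<Sum>n<N. c n * norm (H n)) \<le> 1"
    proof (rule field_le_mult_one_interval)
      fix t :: real assume t: "0 < t" "t < 1"
      have "\<exists>z. norm z \<le> 1 \<and> t * norm (H n) \<le> H n z \<bullet> 1" for n
        by (rule dual_norm_almost_attained[OF s H(1) t])
      then obtain z where z: "\<And>n. norm (z n) \<le> 1" "\<And>n. t * norm (H n) \<le> H n (z n) \<bullet> 1" by metis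
      define x where "x n = c n *\<^sub>R z n" for n
      have nx: "norm (x n) \<le> 1 * c n" for n
        using mult_left_mono[OF z(1)[of n] c0[of n]] c0[of n] by (simp add: x_def)
      have "t * (\<Sum>n<N. c n * norm (H n)) = (\<Sum>n<N. c n * (t * norm (H n)))"
        by (simp add: sum_distrib_left mult_ac)
      also have "\<dots> \<le> (\<Sum>n<N. c n * (H n (z n) \<bullet> 1))"
        using z(2) c0 by (intro sum_mono mult_left_mono)
      also have "\<dots> = (\<Sum>n<N. H n (x n) \<bullet> 1)"
        by (simp add: x_def blinfun.scaleR_right)
      also have "\<dots> = (\<Sum>i\<in>I. \<Sum>n<N. (\<gamma> i n * g i (x n)) \<bullet> 1)"
        unfolding H_apply inner_sum_left by (rule sum.swap)
      also have "\<dots> = (\<Sum>i\<in>I. g i (A x i) \<bullet> 1)"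
        using g(1) by (simp add: A_def blinfun.sum_right inner_sum_left dual_space_def)
      also have "\<dots> = F (A x)" by (simp add: F_le)
      also have "\<dots> \<le> 1"
        by (rule F(2), intro exI[of _ x] exI[of _ 1]) (use nx in simp)
      finally show "t * (\<Sum>n<N. c n * norm (H n)) \<le> 1" .
    qed
    have rep: "g i (d i) \<bullet> 1 \<le> (\<Sum>n<N. (\<gamma> i n * \<phi> n (g i)) \<bullet> 1) + M * e" if i: "i \<in> I" for i
    proof -
      let ?P = "\<Sum>n<N. \<gamma> i n * \<phi> n (g i)"
      have "norm (g i (d i) - ?P) \<le> ell_norm p (\<lambda>n. if n < N then 0 else norm (\<phi> n (g i)))"
        by (rule banach_over.dual_ball_partial_sum_error[OF banach_over_mult p \<gamma>[OF i]
              bidual_sequences_ell(1)[OF p \<phi> g(1)] d[OF i g(1)]])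
      also have "\<dots> \<le> norm (g i) * ell_norm p (\<lambda>n. if n < N then 0 else c n)"
        using bidual_sequences_ell(2)[OF p \<phi> g(1), where N = N] unfolding c_def .
      also have "\<dots> \<le> norm (g i) * e" using N by (simp add: mult_left_mono)
      also have "\<dots> \<le> M * e" using ng[of i] e by simp
      finally have "(g i (d i) - ?P) \<bullet> 1 \<le> M * e"
        using inner_one_le_norm[of "g i (d i) - ?P"] by linarith
      then show ?thesis by (simp add: inner_diff_left inner_sum_left)
    qed
    have "F d \<le> (\<Sum>i\<in>I. (\<Sum>n<N. (\<gamma> i n * \<phi> n (g i)) \<bullet> 1) + M * e)"
      unfolding F_le by (intro sum_mono rep)
    also have "\<dots> = (\<Sum>n<N. \<phi> n (H n) \<bullet> 1) + real (card I) * (M * e)"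
      unfolding H(2) inner_sum_left by (simp add: sum.distrib sum.swap[of _ I])
    also have "(\<Sum>n<N. \<phi> n (H n) \<bullet> 1) \<le> (\<Sum>n<N. c n * norm (H n))"
      unfolding c_def
      by (intro sum_mono order_trans[OF inner_one_le_norm bidual_sequences_bound[OF \<phi> H(1)]])
    finally show False using sumH cardMe F(3) \<eta> by linarith
  qed
  then obtain x r where xr: "0 \<le> r" "\<And>n. norm (x n) \<le> r * c n"
    "r + M * (\<Sum>i\<in>I. norm (d i - A x i)) < 1 + \<eta>" by (blast intro: le_less_trans)
  have E0: "0 \<le> (\<Sum>i\<in>I. norm (d i - A x i))" by (intro sum_nonneg) auto
  then have "0 \<le> M * (\<Sum>i\<in>I. norm (d i - A x i))" using M(1) by simp
  then have r: "r \<le> 1 + \<eta>" using xr(3) by linarith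
  have "M * (\<Sum>i\<in>I. norm (d i - A x i)) \<le> M * \<eta>" using xr(1,3) M(2) by linarith
  then have E: "(\<Sum>i\<in>I. norm (d i - A x i)) \<le> \<eta>" using M(1) by simp
  define x' where "x' n = (if n < N then x n else 0)" for n
  have "norm (x' n) \<le> (1 + \<eta>) * c n" for n
    using order_trans[OF xr(2)[of n] mult_right_mono[OF r c0[of n]]] c0[of n] \<eta>
    by (simp add: x'_def)
  moreover have "A x i = (\<Sum>n<N. s (\<gamma> i n) (x' n))" for i
    unfolding A_def by (intro sum.cong) (auto simp: x'_def)
  ultimately show ?thesis
    using E by (intro exI[of _ x'] exI[of _ N]) (simp add: x'_def c_def)
qed

text \<open>
  A finite net for the first coordinates of the coefficients replaces the elements of the hull by
  finitely many ones, which descend to the space; the differences have small coefficients on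
  these coordinates, and \<open>\<phi>\<close> is small on the others.
\<close>

lemma bidual_hull_split:
  fixes s :: "'k::{real_normed_field,euclidean_space} \<Rightarrow> 'b::banach \<Rightarrow> 'b"
  assumes p: "1 \<le> p" and s: "banach_over s" and \<phi>: "\<phi> \<in> bidual_sequences p s" and \<eta>: "0 < \<eta>"
  shows "\<exists>z \<phi>'. (\<lambda>n. norm (z n)) \<in> ell p \<and>
    ell_norm p (\<lambda>n. norm (z n)) \<le> ell_norm p (\<lambda>n. op_norm (dual_space s) (\<phi> n)) + \<eta> \<and>
    \<phi>' \<in> bidual_sequences p s \<and> ell_norm p (\<lambda>n. op_norm (dual_space s) (\<phi>' n)) \<le> \<eta> \<and>
    (\<forall>y\<in>bidual_hull p s \<phi>. \<exists>b\<in>dual_hull p s z. y - b \<in> bidual_hull p s \<phi>')"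
proof -
  interpret banach_over s by fact
  define c where "c n = op_norm (dual_space s) (\<phi> n)" for n
  have c_ell: "c \<in> ell p" using \<phi> by (simp add: bidual_sequences_def c_def[abs_def])
  have c0: "0 \<le> c n" for n using op_norm_bidual_nonneg[OF \<phi>] by (simp add: c_def)
  define C where "C = ell_norm p c"
  have C0: "0 \<le> C" unfolding C_def by (rule ell_norm_nonneg[OF p c_ell])
  obtain N where N: "ell_norm p (\<lambda>n. if n < N then 0 else c n) \<le> \<eta> / 8"
    using ell_tail[OF p c_ell, of "\<eta> / 8"] \<eta> by auto
  define \<delta> where "\<delta> = \<eta> / (4 * (C + 1))"
  have \<delta>: "0 < \<delta>" "2 * \<delta> * C \<le> \<eta> / 2"
  proof -
    obtain D where D: "D = C + 1" "0 < D" "C \<le> D" using C0 by simp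
    then show "0 < \<delta>" using \<eta> by (simp add: \<delta>_def flip: D(1))
    have "2 * \<delta> * C \<le> 2 * \<delta> * D" using \<open>0 < \<delta>\<close> D by simp
    also have "\<dots> = \<eta> / 2" using D(2) by (simp add: \<delta>_def flip: D(1))
    finally show "2 * \<delta> * C \<le> \<eta> / 2" .
  qed
  \<comment> \<open>Differences of coefficients divided by r n have to lie in the dual ball. Half of
    it is spent on n < N, where the differences are below \<delta> / (N + 1), and half beyond N,
    where a quarter of each of the two coefficient sequences is used. The norm of \<phi>' is at most
    2 * \<delta> * C + 4 * (\<eta> / 8) \<le> \<eta>.\<close>
  define r where "r n = (if n < N then 2 * \<delta> else 4)" for n
  have r: "0 < r n" for n using \<delta> by (simp add: r_def)
  define \<phi>' where "\<phi>' n f = of_real (r n) * \<phi> n f" for n f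
  have \<phi>_fun: "\<phi> n \<in> functionals dual_scale (dual_space s)" for n
    using \<phi> by (simp add: bidual_sequences_def)
  have \<phi>'_bound: "norm (\<phi>' n f) \<le> r n * c n * norm f" if "f \<in> dual_space s" for n f
    using mult_left_mono[OF bidual_sequences_bound[OF \<phi> that, of n] less_imp_le[OF r[of n]]] r[of n]
    by (simp add: \<phi>'_def norm_mult c_def)
  have \<phi>'_fun: "\<phi>' n \<in> functionals dual_scale (dual_space s)" for n
    using \<phi>_fun[of n] \<phi>'_bound[of _ n] unfolding bounded_operators_def
    by (auto simp: \<phi>'_def algebra_simps intro!: exI[of _ "r n * c n"])
  have op_le: "op_norm (dual_space s) (\<phi>' n) \<le> r n * c n" for n
  proof (rule op_norm_leI[OF scale_subspace_dual_space])
    fix f :: "'b \<Rightarrow>\<^sub>L 'k" assume f: "f \<in> dual_space s" "norm f \<le> 1"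
    have "norm (\<phi>' n f) \<le> r n * c n * norm f" by (rule \<phi>'_bound[OF f(1)])
    also have "\<dots> \<le> r n * c n * 1" using f(2) r[of n] c0[of n] by (intro mult_left_mono) auto
    finally show "norm (\<phi>' n f) \<le> r n * c n" by simp
  qed
  have op_nonneg: "0 \<le> op_norm (dual_space s) (\<phi>' n)" for n
    by (rule op_norm_nonneg[OF \<phi>'_fun scale_subspace_dual_space])
  let ?t = "\<lambda>n. if n < N then 0 else c n"
  have t: "?t \<in> ell p" by (rule ell_mono(1)[OF p c_ell]) simp
  have rc: "(\<lambda>n. 2 * \<delta> * c n + 4 * ?t n) \<in> ell p"
    by (intro ell_add(1)[OF p] ell_cmult(1)[OF p] c_ell t)
  have rc_le: "\<bar>op_norm (dual_space s) (\<phi>' n)\<bar> \<le> \<bar>2 * \<delta> * c n + 4 * ?t n\<bar>" for n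
  proof -
    have "0 \<le> 2 * \<delta> * c n" using c0[of n] \<delta>(1) by simp
    then have "r n * c n \<le> 2 * \<delta> * c n + 4 * ?t n" by (simp add: r_def)
    then show ?thesis using op_nonneg[of n] op_le[of n] by linarith
  qed
  have \<phi>'_seq: "\<phi>' \<in> bidual_sequences p s"
    using ell_mono(1)[OF p rc rc_le] \<phi>'_fun by (simp add: bidual_sequences_def)
  have "ell_norm p (\<lambda>n. op_norm (dual_space s) (\<phi>' n)) \<le> ell_norm p (\<lambda>n. 2 * \<delta> * c n + 4 * ?t n)"
    by (rule ell_mono(2)[OF p rc rc_le])
  also have "\<dots> \<le> ell_norm p (\<lambda>n. 2 * \<delta> * c n) + ell_norm p (\<lambda>n. 4 * ?t n)"
    by (intro ell_add(2)[OF p] ell_cmult(1)[OF p] c_ell t)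
  also have "\<dots> \<le> 2 * \<delta> * C + 4 * ell_norm p ?t"
    using ell_cmult(2)[OF p c_ell, of "2 * \<delta>"] ell_cmult(2)[OF p t, of 4] \<delta>(1) by (simp add: C_def)
  also have "\<dots> \<le> \<eta>" using \<delta>(2) N by simp
  finally have \<phi>'_norm: "ell_norm p (\<lambda>n. op_norm (dual_space s) (\<phi>' n)) \<le> \<eta>" .
  let ?A = "bidual_hull p s \<phi>"
  have "\<exists>\<alpha>. (\<lambda>n. norm (\<alpha> n)) \<in> dual_ball p \<and> (\<forall>f\<in>dual_space s. (\<lambda>n. \<alpha> n * \<phi> n f) sums f y)" if "y \<in> ?A" for y
    using that by (simp add: bidual_hull_def)
  then obtain al where al: "\<And>y. y \<in> ?A \<Longrightarrow> (\<lambda>n. norm (al y n)) \<in> dual_ball p"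
    "\<And>y f. y \<in> ?A \<Longrightarrow> f \<in> dual_space s \<Longrightarrow> (\<lambda>n. al y n * \<phi> n f) sums f y" by metis
  define e where "e = \<delta> / real (Suc N)"
  have e: "0 < e" using \<delta>(1) by (simp add: e_def)
  obtain K :: "'k set" where K: "finite K" "cball 0 1 \<subseteq> (\<Union>k\<in>K. ball k (e / 2))"
    using compact_eq_totally_bounded[of "cball (0::'k) 1"] e by (metis compact_cball half_gt_zero)
  have "\<exists>k\<in>K. dist k u < e / 2" if "norm u \<le> 1" for u
    using K(2) that by (auto simp: subset_iff)
  then obtain \<kappa> where \<kappa>: "\<And>u. norm u \<le> 1 \<Longrightarrow> \<kappa> u \<in> K" "\<And>u. norm u \<le> 1 \<Longrightarrow> dist (\<kappa> u) u < e / 2"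
    by metis
  have al1: "norm (al y n) \<le> 1" if "y \<in> ?A" for y n
    using dual_ball_abs_le_1[OF p al(1)[OF that], of n] by simp
  \<comment> \<open>P y records the net points next to the leading N coefficients of y. It takes
    finitely many values, and \<open>rep\<close> selects one element of the hull for each.\<close>
  define P where "P y = restrict (\<lambda>n. \<kappa> (al y n)) {..<N}" for y
  have "P ` ?A \<subseteq> PiE {..<N} (\<lambda>_. K)" using \<kappa>(1) al1 by (force simp: P_def)
  then have finI: "finite (P ` ?A)" using K(1) by (meson finite_PiE finite_lessThan finite_subset)
  define rep where "rep = inv_into ?A P"
  have rep: "rep q \<in> ?A" "P (rep q) = q" if "q \<in> P ` ?A" for q
    using that by (auto simp: rep_def inv_into_into f_inv_into_f)
  obtain \<theta> \<tau> where \<theta>: "0 < \<theta>" "\<theta> < 1" and \<tau>: "0 < \<tau>" "(C + \<tau>) / (1 - \<theta>) + 8 * \<tau> / \<theta> \<le> C + \<eta>"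
    by (rule geometric_weights_cost[OF C0 \<eta>])
  \<comment> \<open>Keeps both the increase \<eta>' * C of the norm and the total error \<eta>' at
    most \<tau>.\<close>
  define \<eta>' where "\<eta>' = \<tau> / (C + 1)"
  have \<eta>': "0 < \<eta>'" "\<eta>' \<le> \<tau>" "(1 + \<eta>') * C \<le> C + \<tau>"
  proof -
    show "0 < \<eta>'" using \<tau> C0 by (simp add: \<eta>'_def)
    have *: "\<eta>' * (C + 1) = \<tau>" using C0 by (simp add: \<eta>'_def)
    have "0 \<le> \<eta>' * C" using \<open>0 < \<eta>'\<close> C0 by simp
    then show "\<eta>' \<le> \<tau>" "(1 + \<eta>') * C \<le> C + \<tau>" using * \<open>0 < \<eta>'\<close> by (auto simp: algebra_simps)
  qed
  obtain x M where x: "\<And>n. n \<ge> M \<Longrightarrow> x n = 0" "\<And>n. norm (x n) \<le> (1 + \<eta>') * c n"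
    "(\<Sum>q\<in>P ` ?A. norm (rep q - (\<Sum>n<M. s (al (rep q) n) (x n)))) \<le> \<eta>'"
    using finite_bidual_representation[OF p s \<phi> finI, of "\<lambda>q. al (rep q)" rep \<eta>'] al rep \<eta>'(1)
    unfolding c_def by blast
  have x_le: "\<bar>norm (x n)\<bar> \<le> \<bar>(1 + \<eta>') * c n\<bar>" for n using x(2)[of n] by simp
  have x_ell: "(\<lambda>n. norm (x n)) \<in> ell p" by (rule ell_mono(1)[OF p ell_cmult(1)[OF p c_ell] x_le])
  have "ell_norm p (\<lambda>n. norm (x n)) \<le> ell_norm p (\<lambda>n. (1 + \<eta>') * c n)"
    by (rule ell_mono(2)[OF p ell_cmult(1)[OF p c_ell] x_le])
  also have "\<dots> \<le> (1 + \<eta>') * C" using ell_cmult(2)[OF p c_ell, of "1 + \<eta>'"] \<eta>'(1) by (simp add: C_def)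
  also have "\<dots> \<le> C + \<tau>" by (rule \<eta>'(3))
  finally have x_norm: "ell_norm p (\<lambda>n. norm (x n)) \<le> C + \<tau>" .
  let ?b = "\<lambda>q. \<Sum>n<M. s (al (rep q) n) (x n)"
  have b: "?b q \<in> dual_hull p s x" if "q \<in> P ` ?A" for q
  proof -
    have "(\<lambda>n. s (al (rep q) n) (x n)) sums ?b q" by (rule sums_finite) (auto simp: x(1))
    then show ?thesis using al(1)[OF rep(1)[OF that]] by (auto simp: dual_hull_def)
  qed
  \<comment> \<open>Adding these errors back puts the representatives themselves, not just
    approximations, into the hull of z.\<close>
  obtain v where v: "(\<lambda>n. norm (v n)) \<in> ell p"
    "ell_norm p (\<lambda>n. norm (v n)) \<le> (\<Sum>q\<in>P ` ?A. norm (rep q - ?b q))"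
    "\<forall>q\<in>P ` ?A. rep q - ?b q \<in> dual_hull p s v"
    using finite_set_subset_dual_hull[OF s p finI, of "\<lambda>q. rep q - ?b q"] by blast
  obtain z where z: "(\<lambda>n. norm (z n)) \<in> ell p"
    "ell_norm p (\<lambda>n. norm (z n)) \<le> ell_norm p (\<lambda>n. norm (x n)) / (1 - \<theta>) + 2 * ell_norm p (\<lambda>n. norm (v n)) / \<theta>"
    "\<forall>a\<in>dual_hull p s x. \<forall>b\<in>dual_hull p s v. a + b \<in> dual_hull p s z"
    using dual_hull_add[OF s p \<theta> x_ell v(1)] by blast
  have "ell_norm p (\<lambda>n. norm (v n)) \<le> \<tau>" using v(2) x(3) \<eta>'(2) by linarith
  then have "2 * ell_norm p (\<lambda>n. norm (v n)) \<le> 8 * \<tau>" using \<tau>(1) by linarith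
  then have "2 * ell_norm p (\<lambda>n. norm (v n)) / \<theta> \<le> 8 * \<tau> / \<theta>"
    using \<theta> by (intro divide_right_mono) auto
  moreover have "ell_norm p (\<lambda>n. norm (x n)) / (1 - \<theta>) \<le> (C + \<tau>) / (1 - \<theta>)"
    using \<theta> x_norm by (intro divide_right_mono) auto
  ultimately have z_norm: "ell_norm p (\<lambda>n. norm (z n)) \<le> C + \<eta>" using z(2) \<tau>(2) by linarith
  have "\<exists>b\<in>dual_hull p s z. y - b \<in> bidual_hull p s \<phi>'" if y: "y \<in> ?A" for y
  proof
    let ?y = "rep (P y)"
    have y': "?y \<in> ?A" "P ?y = P y" using rep y by auto
    have "?b (P y) + (?y - ?b (P y)) \<in> dual_hull p s z"
      using z(3) b v(3) y by blast
    then show "?y \<in> dual_hull p s z" by simp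
    define \<beta> where "\<beta> n = (al y n - al ?y n) / of_real (r n)" for n
    have \<beta>\<phi>: "\<beta> n * \<phi>' n f = al y n * \<phi> n f - al ?y n * \<phi> n f" for n f
    proof -
      have "\<beta> n * of_real (r n) = al y n - al ?y n" using r[of n] by (simp add: \<beta>_def)
      then show ?thesis by (simp add: \<phi>'_def left_diff_distrib flip: mult.assoc)
    qed
    have "(\<lambda>n. norm (\<beta> n)) \<in> dual_ball p"
      unfolding dual_ball_def
    proof (intro CollectI ballI allI)
      fix b L assume b: "b \<in> ell p"
      let ?B = "ell_norm p b"
      have B0: "0 \<le> ?B" by (rule ell_norm_nonneg[OF p b])
      \<comment> \<open>The three summands contribute at most 1/2, 1/4 and 1/4 of the norm of b. The
        N leading terms of size at most 1 / (2 (N + 1)) account for the half; the successor avoids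
        division by zero for N = 0.\<close>
      have \<beta>_le: "norm (\<beta> n) * \<bar>b n\<bar> \<le> (if n < N then ?B / (2 * real (Suc N)) else 0)
        + 1 / 4 * (norm (al y n) * \<bar>b n\<bar>) + 1 / 4 * (norm (al ?y n) * \<bar>b n\<bar>)" for n
      proof (cases "n < N")
        case True
        then have "\<kappa> (al y n) = \<kappa> (al ?y n)"
          using fun_cong[OF y'(2), of n] by (simp add: P_def)
        then have "dist (al y n) (al ?y n) < e"
          using \<kappa>(2)[OF al1[OF y, of n]] \<kappa>(2)[OF al1[OF y'(1), of n]]
          by (metis dist_commute dist_triangle_half_l)
        then have "norm (\<beta> n) \<le> e / (2 * \<delta>)"
          using True \<delta>(1) by (simp add: \<beta>_def norm_divide r_def dist_norm divide_right_mono norm_mult)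
        also have "e / (2 * \<delta>) = 1 / (2 * real (Suc N))" using \<delta>(1) by (simp add: e_def del: of_nat_Suc)
        finally have "norm (\<beta> n) * \<bar>b n\<bar> \<le> 1 / (2 * real (Suc N)) * ?B"
          using abs_le_ell_norm[OF p b, of n] by (intro mult_mono) auto
        then show ?thesis using True by (simp add: add_nonneg_nonneg add_increasing2 del: of_nat_Suc)
      next
        case False
        have "norm (\<beta> n) \<le> (norm (al y n) + norm (al ?y n)) / 4"
          using False norm_triangle_ineq4[of "al y n" "al ?y n"]
          by (simp add: \<beta>_def norm_divide r_def)
        then have "norm (\<beta> n) * \<bar>b n\<bar> \<le> (norm (al y n) + norm (al ?y n)) / 4 * \<bar>b n\<bar>"
          by (intro mult_right_mono) auto
        then show ?thesis using False by (simp add: algebra_simps add_divide_distrib)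
      qed
      have first: "(\<Sum>n<L. if n < N then ?B / (2 * real (Suc N)) else 0) \<le> ?B / 2"
      proof -
        have "(\<Sum>n<L. if n < N then ?B / (2 * real (Suc N)) else 0) = (\<Sum>n\<in>{..<L} \<inter> {..<N}. ?B / (2 * real (Suc N)))"
          by (rule sum.mono_neutral_cong_right) auto
        also have "\<dots> \<le> (\<Sum>n<Suc N. ?B / (2 * real (Suc N)))"
          using B0 by (intro sum_mono2) auto
        also have "\<dots> = ?B / 2" by (simp del: of_nat_Suc sum.lessThan_Suc)
        finally show ?thesis .
      qed
      have "(\<Sum>n<L. \<bar>norm (\<beta> n)\<bar> * \<bar>b n\<bar>) \<le> (\<Sum>n<L. (if n < N then ?B / (2 * real (Suc N)) else 0)
        + 1 / 4 * (norm (al y n) * \<bar>b n\<bar>) + 1 / 4 * (norm (al ?y n) * \<bar>b n\<bar>))"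
        unfolding abs_norm_cancel by (intro sum_mono \<beta>_le)
      also have "\<dots> = (\<Sum>n<L. if n < N then ?B / (2 * real (Suc N)) else 0)
        + 1 / 4 * (\<Sum>n<L. norm (al y n) * \<bar>b n\<bar>) + 1 / 4 * (\<Sum>n<L. norm (al ?y n) * \<bar>b n\<bar>)"
        by (simp only: sum.distrib sum_distrib_left)
      also have "\<dots> \<le> ?B / 2 + 1 / 4 * ?B + 1 / 4 * ?B"
        using first dual_ballD[OF al(1)[OF y] b, of L] dual_ballD[OF al(1)[OF y'(1)] b, of L]
        by (intro add_mono mult_left_mono) auto
      finally show "(\<Sum>n<L. \<bar>norm (\<beta> n)\<bar> * \<bar>b n\<bar>) \<le> ?B" by simp
    qed
    moreover have "(\<lambda>n. \<beta> n * \<phi>' n f) sums f (y - ?y)" if "f \<in> dual_space s" for f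
      unfolding \<beta>\<phi> blinfun.diff_right
      by (rule sums_diff[OF al(2)[OF y that] al(2)[OF y'(1) that]])
    ultimately show "y - ?y \<in> bidual_hull p s \<phi>'" by (auto simp: bidual_hull_def)
  qed
  then show ?thesis using z(1) z_norm \<phi>'_seq \<phi>'_norm
    unfolding C_def c_def[abs_def] by (intro exI[of _ z] exI[of _ \<phi>']) auto
qed

text \<open>An element y of the bidual hull is split again and again. The remainders a k tend to
  zero in norm, so y is the telescoping sum of the differences a k - a (k + 1), each of which lies
  in a hull in the space.\<close>

lemma bidual_hull_subset_dual_hull:
  fixes s :: "'k::{real_normed_field,euclidean_space} \<Rightarrow> 'b::banach \<Rightarrow> 'b"
  assumes p: "1 \<le> p" and s: "banach_over s" and \<phi>: "\<phi> \<in> bidual_sequences p s" and \<epsilon>: "0 < \<epsilon>"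
  shows "\<exists>z. (\<lambda>n. norm (z n)) \<in> ell p \<and>
    ell_norm p (\<lambda>n. norm (z n)) \<le> ell_norm p (\<lambda>n. op_norm (dual_space s) (\<phi> n)) + \<epsilon> \<and>
    bidual_hull p s \<phi> \<subseteq> dual_hull p s z"
proof -
  interpret banach_over s by fact
  let ?N = "\<lambda>\<psi>. ell_norm p (\<lambda>n. op_norm (dual_space s) (\<psi> n))"
  define C where "C = ?N \<phi>"
  have C0: "0 \<le> C" unfolding C_def using \<phi> by (intro ell_norm_nonneg[OF p]) (simp add: bidual_sequences_def)
  obtain \<theta> \<tau> where \<theta>: "0 < \<theta>" "\<theta> < 1" and \<tau>: "0 < \<tau>" "(C + \<tau>) / (1 - \<theta>) + 8 * \<tau> / \<theta> \<le> C + \<epsilon>"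
    by (rule geometric_weights_cost[OF C0 \<epsilon>])
  \<comment> \<open>The errors decrease like 4^-k, faster than the weights 2^-k, so the costs remain
    summable after division by the weights.\<close>
  define \<eta> where "\<eta> k = \<tau> / 4 ^ k" for k :: nat
  have \<eta>: "0 < \<eta> k" for k using \<tau> by (simp add: \<eta>_def)
  let ?R = "\<lambda>k \<psi> \<psi>' z. (\<lambda>n. norm (z n)) \<in> ell p \<and> ell_norm p (\<lambda>n. norm (z n)) \<le> ?N \<psi> + \<eta> k \<and>
    ?N \<psi>' \<le> \<eta> k \<and> (\<forall>y\<in>bidual_hull p s \<psi>. \<exists>b\<in>dual_hull p s z. y - b \<in> bidual_hull p s \<psi>')"
  have "\<exists>\<Psi>. \<forall>k. (\<Psi> k \<in> bidual_sequences p s \<and> (k = 0 \<longrightarrow> \<Psi> k = \<phi>)) \<and> (\<exists>z. ?R k (\<Psi> k) (\<Psi> (Suc k)) z)"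
  proof (rule dependent_nat_choice)
    show "\<exists>\<psi>. \<psi> \<in> bidual_sequences p s \<and> (0 = (0::nat) \<longrightarrow> \<psi> = \<phi>)" using \<phi> by blast
  next
    fix \<psi> k assume "\<psi> \<in> bidual_sequences p s \<and> (k = (0::nat) \<longrightarrow> \<psi> = \<phi>)"
    then have "\<psi> \<in> bidual_sequences p s" by blast
    from bidual_hull_split[OF p s this \<eta>[of k]]
    show "\<exists>\<psi>'. (\<psi>' \<in> bidual_sequences p s \<and> (Suc k = 0 \<longrightarrow> \<psi>' = \<phi>)) \<and> (\<exists>z. ?R k \<psi> \<psi>' z)" by blast
  qed
  then obtain \<Psi> where \<Psi>': "\<forall>k. (\<Psi> k \<in> bidual_sequences p s \<and> (k = 0 \<longrightarrow> \<Psi> k = \<phi>)) \<and> (\<exists>z. ?R k (\<Psi> k) (\<Psi> (Suc k)) z)"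
    by (elim exE)
  then have \<Psi>: "\<And>k. \<Psi> k \<in> bidual_sequences p s" "\<Psi> 0 = \<phi>" by blast+
  have "\<forall>k. \<exists>z. ?R k (\<Psi> k) (\<Psi> (Suc k)) z" using \<Psi>' by blast
  then obtain z where "\<And>k. ?R k (\<Psi> k) (\<Psi> (Suc k)) (z k)" by metis
  then have z: "\<And>k. (\<lambda>n. norm (z k n)) \<in> ell p" "\<And>k. ell_norm p (\<lambda>n. norm (z k n)) \<le> ?N (\<Psi> k) + \<eta> k"
    "\<And>k. ?N (\<Psi> (Suc k)) \<le> \<eta> k"
    "\<And>k y. y \<in> bidual_hull p s (\<Psi> k) \<Longrightarrow> \<exists>b\<in>dual_hull p s (z k). y - b \<in> bidual_hull p s (\<Psi> (Suc k))"
    by blast+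
  define w where "w k = (if k = 0 then 1 - \<theta> else \<theta> / 2 ^ k)" for k :: nat
  note w = geometric_weights[OF \<theta>, folded w_def]
  \<comment> \<open>For k \<ge> 1 the norm of z k is at most \<eta> (k - 1) + \<eta> k \<le> 2 *
    \<tau> / 4^(k - 1); division by \<theta> / 2^k gives (8 * \<tau> / \<theta>) 2^-k.\<close>
  define B where "B k = (if k = 0 then (C + \<tau>) / (1 - \<theta>) else 8 * \<tau> / \<theta> * (1 / 2) ^ k)" for k :: nat
  have "(\<lambda>k. B (Suc k)) sums (8 * \<tau> / \<theta> * 1)"
    using sums_mult[OF power_half_series, of "8 * \<tau> / \<theta>"] by (simp add: B_def)
  then have "B sums (8 * \<tau> / \<theta> * 1 + B 0)" by (rule sums_Suc)
  then have B: "B sums ((C + \<tau>) / (1 - \<theta>) + 8 * \<tau> / \<theta>)" by (simp add: B_def add.commute)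
  have le: "ell_norm p (\<lambda>n. norm (z k n)) / w k \<le> B k" for k
  proof (cases k)
    case 0
    have "ell_norm p (\<lambda>n. norm (z 0 n)) \<le> C + \<tau>" using z(2)[of 0] by (simp add: \<Psi>(2) C_def \<eta>_def)
    then show ?thesis using \<theta> 0 by (simp add: B_def w_def divide_right_mono)
  next
    case (Suc j)
    have "\<eta> (Suc j) \<le> \<eta> j" using \<tau>(1) by (simp add: \<eta>_def divide_simps)
    then have "ell_norm p (\<lambda>n. norm (z k n)) \<le> 2 * \<eta> j" using z(2)[of k] z(3)[of j] Suc by simp
    then have "ell_norm p (\<lambda>n. norm (z k n)) / w k \<le> 2 * \<eta> j / w k"
      using w(1)[of k] by (intro divide_right_mono) auto
    also have "\<dots> = B k"
    proof -
      have "(4::real) ^ j = 2 ^ j * 2 ^ j" by (simp flip: power_mult_distrib)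
      then show ?thesis using Suc by (simp add: B_def w_def \<eta>_def power_divide)
    qed
    finally show ?thesis .
  qed
  have cost: "summable (\<lambda>k. ell_norm p (\<lambda>n. norm (z k n)) / w k)"
    by (rule summable_comparison_test'[OF sums_summable[OF B]])
      (use le ell_norm_nonneg[OF p z(1)] less_imp_le[OF w(1)] in simp)
  note Z = dual_hull_superposition[OF p z(1) w cost]
  let ?Z = "concat_seq (\<lambda>k n. s (of_real (1 / w k)) (z k n))"
  have "ell_norm p (\<lambda>n. norm (?Z n)) \<le> C + \<epsilon>"
    using Z(2) suminf_le[OF le cost sums_summable[OF B]] sums_unique[OF B] \<tau>(2) by simp
  moreover have "bidual_hull p s \<phi> \<subseteq> dual_hull p s ?Z"
  proof
    fix y assume y: "y \<in> bidual_hull p s \<phi>"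
    have "\<exists>a. \<forall>k. (a k \<in> bidual_hull p s (\<Psi> k) \<and> (k = 0 \<longrightarrow> a k = y)) \<and> a k - a (Suc k) \<in> dual_hull p s (z k)"
    proof (rule dependent_nat_choice)
      show "\<exists>a. a \<in> bidual_hull p s (\<Psi> 0) \<and> (0 = (0::nat) \<longrightarrow> a = y)" using y \<Psi>(2) by simp
    next
      fix a k assume "a \<in> bidual_hull p s (\<Psi> k) \<and> (k = (0::nat) \<longrightarrow> a = y)"
      then obtain b where "b \<in> dual_hull p s (z k)" "a - b \<in> bidual_hull p s (\<Psi> (Suc k))" using z(4) by blast
      then show "\<exists>a'. (a' \<in> bidual_hull p s (\<Psi> (Suc k)) \<and> (Suc k = 0 \<longrightarrow> a' = y)) \<and> a - a' \<in> dual_hull p s (z k)"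
        by (intro exI[of _ "a - b"]) simp
    qed
    then obtain a where a: "\<And>k. a k \<in> bidual_hull p s (\<Psi> k)" "a 0 = y" "\<And>k. a k - a (Suc k) \<in> dual_hull p s (z k)"
      by auto
    have na: "norm (a (Suc k)) \<le> \<eta> k" for k
      using norm_le_of_bidual_hull[OF p s \<Psi>(1) a(1), of "Suc k"] z(3)[of k] by simp
    have "(\<lambda>k. \<tau> * (1 / 4) ^ k) \<longlonglongrightarrow> \<tau> * 0" by (intro tendsto_mult tendsto_const LIMSEQ_power_zero) simp
    then have "\<eta> \<longlonglongrightarrow> 0" by (simp add: \<eta>_def[abs_def] power_divide)
    then have "(\<lambda>k. a (Suc k)) \<longlonglongrightarrow> 0"
      by (rule Lim_null_comparison[rotated]) (simp add: na)
    then have "a \<longlonglongrightarrow> 0" by (rule LIMSEQ_imp_Suc)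
    then have "(\<lambda>k. a k - a (Suc k)) sums (a 0 - 0)" by (rule telescope_sums')
    then show "y \<in> dual_hull p s ?Z" using a(2) by (intro Z(3)[OF a(3)]) simp
  qed
  ultimately show ?thesis using Z(1) by (intro exI[of _ ?Z]) (simp add: C_def)
qed

section \<open>The duality of the two ideals\<close>

text \<open>Replaces \<open>p_co\<close> by \<open>dual_hull\<close>, both losses going into e.
  Nonemptiness is stated separately because the real infimum in \<open>kappa\<close> says nothing
  for an empty set of witnesses.\<close>

lemma kappa_le_of_dual_hull:
  fixes t :: "'k::{real_normed_field,euclidean_space} \<Rightarrow> 'b::banach \<Rightarrow> 'b"
  assumes p: "1 \<le> p" and t: "banach_over t" and W: "scale_subspace t W"
    and C: "\<And>e. 0 < e \<Longrightarrow> \<exists>x. (\<forall>n. x n \<in> W) \<and> (\<lambda>n. norm (x n)) \<in> ell p \<and>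
      ell_norm p (\<lambda>n. norm (x n)) \<le> C + e \<and> T ` {v\<in>V. norm v \<le> 1} \<subseteq> dual_hull p t x"
  shows "compact_witnesses p V t W T \<noteq> {}" "kappa p V t W T \<le> C"
proof -
  have bdd: "bdd_below ((\<lambda>x. ell_norm p (\<lambda>n. norm (x n))) ` compact_witnesses p V t W T)"
    using ell_norm_nonneg[OF p] by (intro bdd_belowI[of _ 0]) (auto simp: compact_witnesses_def)
  have ex: "\<exists>y\<in>compact_witnesses p V t W T. ell_norm p (\<lambda>n. norm (y n)) \<le> C + e" if e: "0 < e" for e
  proof -
    obtain x where x: "\<And>n. x n \<in> W" "(\<lambda>n. norm (x n)) \<in> ell p"
      "ell_norm p (\<lambda>n. norm (x n)) \<le> C + e / 2" "T ` {v\<in>V. norm v \<le> 1} \<subseteq> dual_hull p t x"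
      using C[of "e / 2"] e by auto
    obtain y where y: "\<And>n. \<exists>c. y n = t c (x n)" "(\<lambda>n. norm (y n)) \<in> ell p"
      "ell_norm p (\<lambda>n. norm (y n)) \<le> ell_norm p (\<lambda>n. norm (x n)) + e / 2" "dual_hull p t x \<subseteq> p_co p t y"
      using dual_hull_subset_p_co[OF p t x(2), of "e / 2"] e by auto
    have "y n \<in> W" for n using y(1)[of n] x(1)[of n] W by (auto simp: scale_subspace_def)
    then have "y \<in> compact_witnesses p V t W T"
      using y(2,4) x(4) by (auto simp: compact_witnesses_def)
    then show ?thesis using x(3) y(3) by (intro bexI[of _ y]) auto
  qed
  show "compact_witnesses p V t W T \<noteq> {}" using ex[of 1] by auto
  show "kappa p V t W T \<le> C"
  proof (rule field_le_epsilon)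
    fix e :: real assume "0 < e"
    then obtain y where y: "y \<in> compact_witnesses p V t W T" "ell_norm p (\<lambda>n. norm (y n)) \<le> C + e"
      using ex by blast
    have "kappa p V t W T \<le> ell_norm p (\<lambda>n. norm (y n))"
      unfolding kappa_def by (rule cINF_lower[OF bdd y(1)])
    then show "kappa p V t W T \<le> C + e" using y(2) by simp
  qed
qed

lemma nuQ_le:
  assumes p: "1 \<le> p" and \<phi>: "\<phi> \<in> nuclear_witnesses p s V T"
  shows "nuQ p s V T \<le> ell_norm p (\<lambda>n. op_norm V (\<phi> n))"
  unfolding nuQ_def
  by (rule cINF_lower[OF _ \<phi>])
    (use ell_norm_nonneg[OF p] in \<open>auto intro!: bdd_belowI[of _ 0] simp: nuclear_witnesses_def\<close>)

section \<open>Carrying witnesses between an operator and its adjoint\<close>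

context
  fixes p :: ennreal
    and sE :: "'k::{real_normed_field,euclidean_space} \<Rightarrow> 'a::banach \<Rightarrow> 'a"
    and sF :: "'k \<Rightarrow> 'b::banach \<Rightarrow> 'b"
    and T :: "'a \<Rightarrow>\<^sub>L 'b"
  assumes p: "1 \<le> p" and sE: "banach_over sE" and sF: "banach_over sF"
    and T: "\<And>c x. T (sE c x) = sF c (T x)"
begin

lemma bounded_operator_blinfun: "blinfun_apply T \<in> bounded_operators sE UNIV sF UNIV"
  by (auto simp: bounded_operators_def T blinfun.add_right intro!: exI[of _ "norm T"] norm_blinfun)

lemma norm_adjoint_op_le: "norm (adjoint_op T f) \<le> norm T * norm f"
  using norm_blinfun_compose[of f T] by (simp add: adjoint_op_def mult.commute)

lemma bounded_operator_adjoint: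
  "(adjoint_op T :: ('b \<Rightarrow>\<^sub>L 'k) \<Rightarrow> _) \<in> bounded_operators dual_scale (dual_space sF) dual_scale (dual_space sE)"
  using norm_adjoint_op_le
  by (auto simp: bounded_operators_def dual_space_def adjoint_op_def T blinfun.add_left
      intro!: exI[of _ "norm T"] blinfun_eqI)

lemma evaluation_functional:
  "(\<lambda>f. blinfun_apply f y) \<in> functionals (dual_scale :: 'k \<Rightarrow> ('b \<Rightarrow>\<^sub>L 'k) \<Rightarrow> _) (dual_space sF)"
  by (auto simp: bounded_operators_def blinfun.add_left mult.commute intro!: exI[of _ "norm y"])
    (metis mult.commute norm_blinfun)

lemma functional_of_dual_space:
  "f \<in> dual_space sE \<Longrightarrow> blinfun_apply f \<in> functionals sE UNIV"
  using functionals_UNIV[OF sE] by blast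

text \<open>The witnesses of T are functionals on E already, so the hull lies in the dual of E and
  no descent is called for. The series given pointwise by
  \<open>functional_dominated_by_ell_norm\<close> converges absolutely in the dual norm, so it
  represents the functional there.\<close>

lemma kappa_adjoint_le:
  assumes \<phi>: "\<phi> \<in> nuclear_witnesses p sE UNIV T"
  shows "compact_witnesses p (dual_space sF) dual_scale (dual_space sE) (adjoint_op T) \<noteq> {}"
    and "kappa p (dual_space sF) dual_scale (dual_space sE) (adjoint_op T) \<le> ell_norm p (\<lambda>n. op_norm UNIV (\<phi> n))"
proof -
  interpret dual: banach_over "dual_scale :: 'k \<Rightarrow> ('a \<Rightarrow>\<^sub>L 'k) \<Rightarrow> 'a \<Rightarrow>\<^sub>L 'k"
    by (rule banach_over_dual_scale)
  have "\<forall>n. \<exists>\<Phi>\<in>dual_space sE. \<phi> n = blinfun_apply \<Phi>"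
    using \<phi> functionals_UNIV[OF sE] by (auto simp: nuclear_witnesses_def)
  then obtain \<Phi> where \<Phi>: "\<And>n. \<Phi> n \<in> dual_space sE" "\<And>n. \<phi> n = blinfun_apply (\<Phi> n)" by metis
  have op: "op_norm UNIV (\<phi> n) = norm (\<Phi> n)" for n by (simp add: \<Phi>(2) op_norm_UNIV)
  have ell: "(\<lambda>n. norm (\<Phi> n)) \<in> ell p" using \<phi> by (simp add: nuclear_witnesses_def op)
  have ell_v: "(\<lambda>n. norm (\<Phi> n v)) \<in> ell p" for v
    by (rule ell_mono(1)[OF p ell_cmult(1)[OF p ell, of "norm v"]])
      (use norm_blinfun[of "\<Phi> _" v] in \<open>simp add: mult.commute\<close>)
  have sub: "adjoint_op T ` {f\<in>dual_space sF. norm f \<le> 1} \<subseteq> dual_hull p dual_scale \<Phi>"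
  proof safe
    fix f :: "'b \<Rightarrow>\<^sub>L 'k" assume f: "f \<in> dual_space sF" "norm f \<le> 1"
    let ?g = "adjoint_op T f"
    have "?g \<in> dual_space sE" using f(1) by (simp add: dual_space_def adjoint_op_def T)
    moreover have "norm (?g v) \<le> ell_norm p (\<lambda>n. norm (blinfun_apply (\<Phi> n) v))" for v
    proof -
      have "norm (?g v) \<le> norm f * norm (T v)" by (simp add: adjoint_op_def norm_blinfun)
      also have "\<dots> \<le> 1 * norm (T v)" using f(2) by (rule mult_right_mono) simp
      also have "\<dots> \<le> ell_norm p (\<lambda>n. norm (blinfun_apply (\<Phi> n) v))"
        using \<phi> by (simp add: nuclear_witnesses_def \<Phi>(2))
      finally show ?thesis .
    qed
    ultimately obtain \<alpha> where \<alpha>: "(\<lambda>n. norm (\<alpha> n)) \<in> dual_ball p"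
      "\<And>v. (\<lambda>n. \<alpha> n * blinfun_apply (\<Phi> n) v) sums blinfun_apply ?g v"
      using functional_dominated_by_ell_norm[OF p scale_subspace_UNIV[of sE],
          of "\<lambda>n. blinfun_apply (\<Phi> n)" "blinfun_apply ?g"] functional_of_dual_space \<Phi>(1) ell_v
      by blast
    have sums: "(\<lambda>n. dual_scale (\<alpha> n) (\<Phi> n)) sums (\<Sum>n. dual_scale (\<alpha> n) (\<Phi> n))"
      by (rule summable_sums[OF summable_norm_cancel[OF dual.dual_ball_abs_summable(1)[OF \<alpha>(1) ell]]])
    have "(\<Sum>n. dual_scale (\<alpha> n) (\<Phi> n)) = ?g"
    proof (rule blinfun_eqI)
      fix v
      have "(\<lambda>n. \<alpha> n * blinfun_apply (\<Phi> n) v) sums blinfun_apply (\<Sum>n. dual_scale (\<alpha> n) (\<Phi> n)) v"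
        using bounded_linear.sums[OF blinfun.bounded_linear_left[of v] sums] by simp
      then show "blinfun_apply (\<Sum>n. dual_scale (\<alpha> n) (\<Phi> n)) v = ?g v" using \<alpha>(2) by (rule sums_unique2)
    qed
    then show "?g \<in> dual_hull p dual_scale \<Phi>" using \<alpha>(1) sums by (auto simp: dual_hull_def)
  qed
  have "\<exists>x. (\<forall>n. x n \<in> dual_space sE) \<and> (\<lambda>n. norm (x n)) \<in> ell p \<and>
    ell_norm p (\<lambda>n. norm (x n)) \<le> ell_norm p (\<lambda>n. op_norm UNIV (\<phi> n)) + e \<and>
    adjoint_op T ` {f\<in>dual_space sF. norm f \<le> 1} \<subseteq> dual_hull p dual_scale x" if "0 < e" for e
    using \<Phi>(1) ell sub that by (intro exI[of _ \<Phi>]) (simp add: op)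
  from kappa_le_of_dual_hull[OF p banach_over_dual_scale scale_subspace_dual_space this]
  show "compact_witnesses p (dual_space sF) dual_scale (dual_space sE) (adjoint_op T) \<noteq> {}"
    and "kappa p (dual_space sF) dual_scale (dual_space sE) (adjoint_op T) \<le> ell_norm p (\<lambda>n. op_norm UNIV (\<phi> n))"
    by auto
qed

text \<open>Take f norming T v. Its image under the adjoint is a combination of the y n, and the
  Hoelder inequality applies at v.\<close>

lemma nuclear_witness_of_adjoint:
  assumes y: "y \<in> compact_witnesses p (dual_space sF) dual_scale (dual_space sE) (adjoint_op T)"
  shows "(\<lambda>n. blinfun_apply (y n)) \<in> nuclear_witnesses p sE UNIV T"
proof -
  have ell: "(\<lambda>n. norm (y n)) \<in> ell p" and y_dual: "\<And>n. y n \<in> dual_space sE"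
    using y by (auto simp: compact_witnesses_def)
  have ell_v: "(\<lambda>n. norm (y n v)) \<in> ell p" for v
    by (rule ell_mono(1)[OF p ell_cmult(1)[OF p ell, of "norm v"]])
      (use norm_blinfun[of "y _" v] in \<open>simp add: mult.commute\<close>)
  have "norm (T v) \<le> ell_norm p (\<lambda>n. norm (y n v))" for v
  proof -
    obtain f where f: "f \<in> dual_space sF" "norm f \<le> 1" "norm (T v) \<le> norm (f (T v))"
      using norming_functional[OF sF, of "T v"] by blast
    then have "adjoint_op T f \<in> dual_hull p dual_scale y"
      using y p_co_subset_dual_hull[OF p, of dual_scale y] by (auto simp: compact_witnesses_def)
    then obtain \<alpha> where \<alpha>: "(\<lambda>n. norm (\<alpha> n)) \<in> dual_ball p" "(\<lambda>n. dual_scale (\<alpha> n) (y n)) sums adjoint_op T f"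
      by (auto simp: dual_hull_def)
    have "(\<lambda>n. \<alpha> n * y n v) sums f (T v)"
      using bounded_linear.sums[OF blinfun.bounded_linear_left[of v] \<alpha>(2)] by (simp add: adjoint_op_def)
    then have "norm (f (T v)) \<le> ell_norm p (\<lambda>n. norm (y n v))"
      using banach_over.dual_ball_abs_summable(2)[OF banach_over_mult \<alpha>(1) ell_v, of v]
      by (simp add: sums_iff)
    then show ?thesis using f(3) by simp
  qed
  then show ?thesis
    using ell functional_of_dual_space[OF y_dual] by (simp add: nuclear_witnesses_def op_norm_UNIV)
qed

text \<open>Each x n acts on the dual of F by evaluation, with norm at most that of x n. The
  estimate is the Hoelder inequality for f (T v) = \<Sum> \<alpha> n * f (x n), uniformly in the
  unit ball of E.\<close>

lemma nuclear_witness_of_compact: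
  assumes x: "x \<in> compact_witnesses p UNIV sF UNIV T"
  defines "\<phi> \<equiv> \<lambda>n (f :: 'b \<Rightarrow>\<^sub>L 'k). blinfun_apply f (x n)"
  shows "\<phi> \<in> nuclear_witnesses p dual_scale (dual_space sF) (adjoint_op T)"
    and "ell_norm p (\<lambda>n. op_norm (dual_space sF) (\<phi> n)) \<le> ell_norm p (\<lambda>n. norm (x n))"
proof -
  have ell: "(\<lambda>n. norm (x n)) \<in> ell p" using x by (auto simp: compact_witnesses_def)
  have \<phi>_fun: "\<phi> n \<in> functionals dual_scale (dual_space sF)" for n
    unfolding \<phi>_def by (rule evaluation_functional)
  have op_le: "op_norm (dual_space sF) (\<phi> n) \<le> norm (x n)" for n
  proof (rule op_norm_leI[OF scale_subspace_dual_space])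
    fix f :: "'b \<Rightarrow>\<^sub>L 'k" assume "norm f \<le> 1"
    then show "norm (\<phi> n f) \<le> norm (x n)"
      using order_trans[OF norm_blinfun[of f "x n"] mult_right_mono[of "norm f" 1 "norm (x n)"]]
      by (simp add: \<phi>_def)
  qed
  have m: "\<bar>op_norm (dual_space sF) (\<phi> n)\<bar> \<le> \<bar>norm (x n)\<bar>" for n
    using op_le[of n] op_norm_nonneg[OF \<phi>_fun scale_subspace_dual_space, of n] by simp
  show "ell_norm p (\<lambda>n. op_norm (dual_space sF) (\<phi> n)) \<le> ell_norm p (\<lambda>n. norm (x n))"
    by (rule ell_mono(2)[OF p ell m])
  have "norm (adjoint_op T f) \<le> ell_norm p (\<lambda>n. norm (\<phi> n f))" if f: "f \<in> dual_space sF" for f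
    unfolding op_norm_UNIV[symmetric]
  proof (rule op_norm_leI[OF scale_subspace_UNIV])
    fix v :: 'a assume "norm v \<le> 1"
    then have "T v \<in> dual_hull p sF x"
      using x p_co_subset_dual_hull[OF p, of sF x] by (auto simp: compact_witnesses_def)
    then obtain \<alpha> where \<alpha>: "(\<lambda>n. norm (\<alpha> n)) \<in> dual_ball p" "(\<lambda>n. sF (\<alpha> n) (x n)) sums T v"
      by (auto simp: dual_hull_def)
    have "(\<lambda>n. \<alpha> n * \<phi> n f) sums f (T v)"
      using bounded_linear.sums[OF blinfun.bounded_linear_right[of f] \<alpha>(2)] f
      by (simp add: \<phi>_def dual_space_def)
    moreover have \<phi>_ell: "(\<lambda>n. norm (\<phi> n f)) \<in> ell p"
      by (rule ell_mono(1)[OF p ell_cmult(1)[OF p ell, of "norm f"]]) (simp add: \<phi>_def norm_blinfun)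
    ultimately show "norm (adjoint_op T f v) \<le> ell_norm p (\<lambda>n. norm (\<phi> n f))"
      using banach_over.dual_ball_abs_summable(2)[OF banach_over_mult \<alpha>(1) \<phi>_ell]
      by (simp add: sums_iff adjoint_op_def)
  qed
  then show "\<phi> \<in> nuclear_witnesses p dual_scale (dual_space sF) (adjoint_op T)"
    using \<phi>_fun ell_mono(1)[OF p ell m] by (simp add: nuclear_witnesses_def)
qed

text \<open>For v in the unit ball, evaluation at T v is bounded at f by the norm of the adjoint
  applied to f, hence dominated by the \<phi> n. So T v lies in
  \<open>bidual_hull p sF \<phi>\<close>, from which one descends to F.\<close>

lemma kappa_le_adjoint:
  assumes \<phi>: "\<phi> \<in> nuclear_witnesses p dual_scale (dual_space sF) (adjoint_op T)"
  shows "compact_witnesses p UNIV sF UNIV T \<noteq> {}"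
    and "kappa p UNIV sF UNIV T \<le> ell_norm p (\<lambda>n. op_norm (dual_space sF) (\<phi> n))"
proof -
  have \<phi>_seq: "\<phi> \<in> bidual_sequences p sF"
    using \<phi> by (simp add: nuclear_witnesses_def bidual_sequences_def)
  have sub: "blinfun_apply T ` {v\<in>UNIV. norm v \<le> 1} \<subseteq> bidual_hull p sF \<phi>"
  proof safe
    fix v :: 'a assume v: "norm v \<le> 1"
    let ?g = "\<lambda>f :: 'b \<Rightarrow>\<^sub>L 'k. f (T v)"
    have "norm (?g f) \<le> ell_norm p (\<lambda>n. norm (\<phi> n f))" if f: "f \<in> dual_space sF" for f
    proof -
      have "norm (?g f) \<le> norm (adjoint_op T f) * norm v"
        using norm_blinfun[of "adjoint_op T f" v] by (simp add: adjoint_op_def)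
      also have "\<dots> \<le> norm (adjoint_op T f) * 1" using v by (rule mult_left_mono) simp
      also have "\<dots> \<le> ell_norm p (\<lambda>n. norm (\<phi> n f))"
        using \<phi> f by (simp add: nuclear_witnesses_def)
      finally show ?thesis .
    qed
    moreover have "\<phi> n \<in> functionals dual_scale (dual_space sF)" for n
      using \<phi>_seq by (simp add: bidual_sequences_def)
    ultimately show "T v \<in> bidual_hull p sF \<phi>"
      using functional_dominated_by_ell_norm[OF p scale_subspace_dual_space _ evaluation_functional
          bidual_sequences_ell(1)[OF p \<phi>_seq]]
      by (simp add: bidual_hull_def)
  qed
  have "\<exists>x. (\<forall>n. x n \<in> UNIV) \<and> (\<lambda>n. norm (x n)) \<in> ell p \<and>
    ell_norm p (\<lambda>n. norm (x n)) \<le> ell_norm p (\<lambda>n. op_norm (dual_space sF) (\<phi> n)) + e \<and>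
    blinfun_apply T ` {v\<in>UNIV. norm v \<le> 1} \<subseteq> dual_hull p sF x" if "0 < e" for e
    using bidual_hull_subset_dual_hull[OF p sF \<phi>_seq that] sub by (blast intro: subset_trans)
  from kappa_le_of_dual_hull[OF p sF scale_subspace_UNIV this]
  show "compact_witnesses p UNIV sF UNIV T \<noteq> {}"
    and "kappa p UNIV sF UNIV T \<le> ell_norm p (\<lambda>n. op_norm (dual_space sF) (\<phi> n))"
    by auto
qed

lemma quasi_p_nuclear_iff_adjoint_p_compact:
  "blinfun_apply T \<in> quasi_p_nuclear p sE UNIV sF UNIV \<longleftrightarrow>
    adjoint_op T \<in> p_compact p dual_scale (dual_space sF) dual_scale (dual_space sE)"
  using bounded_operator_blinfun bounded_operator_adjoint kappa_adjoint_le(1) nuclear_witness_of_adjoint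
  by (auto simp: quasi_p_nuclear_def p_compact_def)

text \<open>Witnesses pass in one direction with the same norm and in the other with an arbitrarily
  small loss, so the two infima over nonempty sets agree.\<close>

lemma nuQ_eq_kappa_adjoint:
  assumes "blinfun_apply T \<in> quasi_p_nuclear p sE UNIV sF UNIV"
  shows "nuQ p sE UNIV T = kappa p (dual_space sF) dual_scale (dual_space sE) (adjoint_op T)"
proof (rule antisym)
  have nw: "nuclear_witnesses p sE UNIV T \<noteq> {}" using assms by (simp add: quasi_p_nuclear_def)
  then obtain \<phi> where "\<phi> \<in> nuclear_witnesses p sE UNIV T" by blast
  note cw = kappa_adjoint_le(1)[OF this]
  show "nuQ p sE UNIV T \<le> kappa p (dual_space sF) dual_scale (dual_space sE) (adjoint_op T)"
    unfolding kappa_def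
    by (rule cINF_greatest[OF cw]) (use nuQ_le[OF p nuclear_witness_of_adjoint] in \<open>simp add: op_norm_UNIV\<close>)
  show "kappa p (dual_space sF) dual_scale (dual_space sE) (adjoint_op T) \<le> nuQ p sE UNIV T"
    unfolding nuQ_def by (rule cINF_greatest[OF nw kappa_adjoint_le(2)])
qed

lemma p_compact_iff_adjoint_quasi_p_nuclear:
  "blinfun_apply T \<in> p_compact p sE UNIV sF UNIV \<longleftrightarrow>
    adjoint_op T \<in> quasi_p_nuclear p dual_scale (dual_space sF) dual_scale (dual_space sE)"
  using bounded_operator_blinfun bounded_operator_adjoint kappa_le_adjoint(1) nuclear_witness_of_compact(1)
  by (auto simp: quasi_p_nuclear_def p_compact_def)

lemma kappa_eq_nuQ_adjoint:
  assumes "blinfun_apply T \<in> p_compact p sE UNIV sF UNIV"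
  shows "kappa p UNIV sF UNIV T = nuQ p dual_scale (dual_space sF) (adjoint_op T)"
proof (rule antisym)
  have cw: "compact_witnesses p UNIV sF UNIV T \<noteq> {}" using assms by (simp add: p_compact_def)
  then obtain x where "x \<in> compact_witnesses p UNIV sF UNIV T" by blast
  from nuclear_witness_of_compact(1)[OF this]
  have nw: "nuclear_witnesses p dual_scale (dual_space sF) (adjoint_op T) \<noteq> {}" by blast
  show "kappa p UNIV sF UNIV T \<le> nuQ p dual_scale (dual_space sF) (adjoint_op T)"
    unfolding nuQ_def by (rule cINF_greatest[OF nw kappa_le_adjoint(2)])
  show "nuQ p dual_scale (dual_space sF) (adjoint_op T) \<le> kappa p UNIV sF UNIV T"
    unfolding kappa_def
    by (rule cINF_greatest[OF cw])
      (rule order_trans[OF nuQ_le[OF p nuclear_witness_of_compact(1)] nuclear_witness_of_compact(2)])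
qed

end

theorem theorem2p8:
  fixes p :: ennreal
    and sE :: "'k::{real_normed_field,euclidean_space} \<Rightarrow> 'a::banach \<Rightarrow> 'a"
    and sF :: "'k \<Rightarrow> 'b::banach \<Rightarrow> 'b"
    and T :: "'a \<Rightarrow>\<^sub>L 'b"
  assumes "1 \<le> p"
    and "banach_over sE"
    and "banach_over sF"
    and "\<And>c x. T (sE c x) = sF c (T x)"
  shows
    "(blinfun_apply T \<in> quasi_p_nuclear p sE UNIV sF UNIV \<longleftrightarrow>
        adjoint_op T \<in> p_compact p dual_scale (dual_space sF) dual_scale (dual_space sE)) \<and>
     (blinfun_apply T \<in> quasi_p_nuclear p sE UNIV sF UNIV \<longrightarrow>
        nuQ p sE UNIV T = kappa p (dual_space sF) dual_scale (dual_space sE) (adjoint_op T)) \<and>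
     (blinfun_apply T \<in> p_compact p sE UNIV sF UNIV \<longleftrightarrow>
        adjoint_op T \<in> quasi_p_nuclear p dual_scale (dual_space sF) dual_scale (dual_space sE)) \<and>
     (blinfun_apply T \<in> p_compact p sE UNIV sF UNIV \<longrightarrow>
        kappa p UNIV sF UNIV T = nuQ p dual_scale (dual_space sF) (adjoint_op T))"
  using quasi_p_nuclear_iff_adjoint_p_compact[OF assms] nuQ_eq_kappa_adjoint[OF assms]
    p_compact_iff_adjoint_quasi_p_nuclear[OF assms] kappa_eq_nuQ_adjoint[OF assms]
  by blast

end
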